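(* (1) Let $1\le p\le\infty$, $\frac1p+\frac1{p'}=1$, $s\ge0$, and $X=\mathfrak D_s^p$. Let $f\in X_A\cap\ell^1(\mathbb Z_+(\infty))_A$ be factorable in the sense that $f=\prod_{j\ge1}f_j$, where the $f_j$ are affine linear functions and $$0<\prod_{j\ge1}\|f_j\|_{\ell^1}<\infty.$$ If $s\le1/p'$ and $f(\zeta)\ne0$ for all $\zeta\in\mathbb B^\infty_{p'}$, then $f$ is $\sigma(X,X')$-cyclic in $X_A$. (2) Let $X=\mathfrak D^p_{s,t}$, where either $p>1$ and $s>1/p'$, $t\ge1/p'$, or $p=1$ and $s\ge0$, $t\ge0$. Then $X_A$ is a function algebra on its maximal ideal space $\mathbb D^\infty_{X'}$ (for $t=1/p'$, $\mathbb D^\infty_{X'}=\overline{\mathbb B}^\infty_{p'}$), and so a function $f\in X_A$ is cyclic if and only if $f(\zeta)\ne0$ for all $\zeta\in\mathbb D^\infty_{X'}$ (for $t=1/p'$: for all $\zeta\in\overline{\mathbb B}^\infty_{p'}$).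
   Context: $\mathbb Z_+(\infty)$ is the set of finitely supported sequences of nonnegative integers, $\alpha!=\alpha_1!\alpha_2!\cdots$, $|\alpha|=\alpha_1+\alpha_2+\cdots$. For $s,t\ge0$, $$\mathfrak D^p_{s,t}=\Big\{x=(x_\alpha)_{\alpha\in\mathbb Z_+(\infty)}:(x_\alpha w_\alpha)\in\ell^p(\mathbb Z_+(\infty))\Big\},\qquad w_\alpha=\Big(\frac{\alpha!}{|\alpha|!}\Big)^t(|\alpha|+1)^s,$$ with norm $\|(x_\alpha w_\alpha)\|_{\ell^p}$, and $\mathfrak D^p_s=\mathfrak D^p_{s,1/p'}$, where $\frac1p+\frac1{p'}=1$. $X'=\{y:\sum_\alpha|x_\alpha y_\alpha|<\infty\ \forall x\in X\}$ with pairing $\sum_\alpha x_\alpha y_\alpha$; $\sigma(X,X')$ is the corresponding weak topology on $X$. $\mathbb D^\infty_{X'}=\{\lambda=(\lambda_j)_{j\ge1}\in\mathbb C^\infty:(\lambda^\alpha)_{\alpha\in\mathbb Z_+(\infty)}\in X'\}$, $\lambda^\alpha=\prod_j\lambda_j^{\alpha_j}$. $\mathbb B^\infty_{p'}=\{\lambda:\sum_j|\lambda_j|^{p'}<1\}$ and $\overline{\mathbb B}^\infty_{p'}=\{\lambda:\sum_j|\lambda_j|^{p'}\le1\}$ (for $p'=\infty$: $\sup_j|\lambda_j|<1$, resp. $\sup_j|\lambda_j|\le1$). $X_A$ is the space of power series $f=\sum_\alpha x_\alpha\zeta^\alpha$, $x\in X$ (absolutely convergent on $\mathbb D^\infty_{X'}$),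 with the norm and topologies of $X$; $\ell^1(\mathbb Z_+(\infty))_A$ is the analogous space for $\ell^1(\mathbb Z_+(\infty))$, and $\|f\|_{\ell^1}$ is the sum of the moduli of the coefficients. Affine linear functions have the form $a+\sum_{k\ge1}a_k\zeta_k$. That $X_A$ is a function algebra on its maximal ideal space $\mathbb D^\infty_{X'}$ means that $X_A$ is a Banach algebra (after an equivalent renorming) under pointwise multiplication, whose nonzero complex homomorphisms are exactly the evaluations $f\mapsto f(\lambda)$, $\lambda\in\mathbb D^\infty_{X'}$. An element $f\in X_A$ is cyclic for a topology ($\sigma(X,X')$ if none is specified) if $\{qf:q\text{ a polynomial in finitely many of the }\zeta_j\}$ is dense in $X_A$ for it; for $1\le p<\infty$, $X'$ is the Banach dual of $X$, so cyclicity for $\sigma(X,X')$ and for the norm are equivalent.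
   Formalization: In (1), for p=1, f is also required to be nonzero on the closed ball (1-ζ_1 is a counterexample otherwise); in (2), p>1 means 1<p<∞, since for p=∞ the maximal ideal space claim fails (ultrafilter limits of evaluations), so all of (2) is omitted for p=∞. *)

theory Defs
  imports "HOL-Analysis.Analysis" "HOL-Library.Poly_Mapping"
begin

section \<open>Multi-indices\<close>

text \<open>The variables are indexed by \<open>nat\<close> starting at \<open>0\<close> instead of \<open>1\<close>.\<close>

type_synonym multiindex = "nat \<Rightarrow>\<^sub>0 nat"

definition mdeg :: "multiindex \<Rightarrow> nat" where
  "mdeg \<alpha> = (\<Sum>j\<in>Poly_Mapping.keys \<alpha>. Poly_Mapping.lookup \<alpha> j)"

definition mfact :: "multiindex \<Rightarrow> real" where
  "mfact \<alpha> = (\<Prod>j\<in>Poly_Mapping.keys \<alpha>. fact (Poly_Mapping.lookup \<alpha> j))"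

definition monomial_at :: "(nat \<Rightarrow> complex) \<Rightarrow> multiindex \<Rightarrow> complex" where
  "monomial_at z \<alpha> = (\<Prod>j\<in>Poly_Mapping.keys \<alpha>. z j ^ Poly_Mapping.lookup \<alpha> j)"


section \<open>Sequence spaces\<close>

text \<open>Exponents are extended nonnegative reals, so that \<open>p = \<infinity>\<close> is allowed; the definitions
  are meant for exponents in \<open>[1, \<infinity>]\<close>.\<close>

definition lp :: "ennreal \<Rightarrow> ('i \<Rightarrow> complex) set" where
  "lp p = {x. if p = \<infinity> then bounded (range x)
              else (\<lambda>i. cmod (x i) powr enn2real p) summable_on UNIV}"

definition lp_norm :: "ennreal \<Rightarrow> ('i \<Rightarrow> complex) \<Rightarrow> real" where
  "lp_norm p x = (if p = \<infinity> then (SUP i. cmod (x i))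
                  else (\<Sum>\<^sub>\<infinity>i. cmod (x i) powr enn2real p) powr (1 / enn2real p))"

definition lp_open_ball :: "ennreal \<Rightarrow> (nat \<Rightarrow> complex) set" where
  "lp_open_ball p = {z \<in> lp p. if p = \<infinity> then (SUP j. cmod (z j)) < 1
                               else (\<Sum>\<^sub>\<infinity>j. cmod (z j) powr enn2real p) < 1}"

definition lp_closed_ball :: "ennreal \<Rightarrow> (nat \<Rightarrow> complex) set" where
  "lp_closed_ball p = {z \<in> lp p. if p = \<infinity> then (SUP j. cmod (z j)) \<le> 1
                                 else (\<Sum>\<^sub>\<infinity>j. cmod (z j) powr enn2real p) \<le> 1}"

definition weight :: "real \<Rightarrow> real \<Rightarrow> multiindex \<Rightarrow> real" where
  "weight s t \<alpha> = (mfact \<alpha> / fact (mdeg \<alpha>)) powr t * (real (mdeg \<alpha>) + 1) powr s"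

definition D_space :: "ennreal \<Rightarrow> real \<Rightarrow> real \<Rightarrow> (multiindex \<Rightarrow> complex) set" where
  "D_space p s t = {x. (\<lambda>\<alpha>. x \<alpha> * of_real (weight s t \<alpha>)) \<in> lp p}"

definition D_norm :: "ennreal \<Rightarrow> real \<Rightarrow> real \<Rightarrow> (multiindex \<Rightarrow> complex) \<Rightarrow> real" where
  "D_norm p s t x = lp_norm p (\<lambda>\<alpha>. x \<alpha> * of_real (weight s t \<alpha>))"


section \<open>Duality and the associated domain\<close>

definition koethe_dual :: "('i \<Rightarrow> complex) set \<Rightarrow> ('i \<Rightarrow> complex) set" where
  "koethe_dual X = {y. \<forall>x\<in>X. (\<lambda>\<alpha>. cmod (x \<alpha> * y \<alpha>)) summable_on UNIV}"

definition pairing :: "('i \<Rightarrow> complex) \<Rightarrow> ('i \<Rightarrow> complex) \<Rightarrow> complex" where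
  "pairing x y = (\<Sum>\<^sub>\<infinity>\<alpha>. x \<alpha> * y \<alpha>)"

definition sigma_topology :: "('i \<Rightarrow> complex) set \<Rightarrow> ('i \<Rightarrow> complex) topology" where
  "sigma_topology X = topology_generated_by
     {{x \<in> X. pairing x y \<in> U} | y U. y \<in> koethe_dual X \<and> open U}"

definition D_infty :: "(multiindex \<Rightarrow> complex) set \<Rightarrow> (nat \<Rightarrow> complex) set" where
  "D_infty X = {z. monomial_at z \<in> koethe_dual X}"


section \<open>Power series\<close>

text \<open>A power series is given by its coefficient family \<open>x\<close>, and \<open>series x z\<close> is its value at \<open>z\<close>.
  For \<open>x \<in> X\<close> and \<open>z \<in> D_infty X\<close> the sum converges absolutely, by definition of \<open>D_infty X\<close>.\<close>

definition series :: "(multiindex \<Rightarrow> complex) \<Rightarrow> (nat \<Rightarrow> complex) \<Rightarrow> complex" where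
  "series x z = (\<Sum>\<^sub>\<infinity>\<alpha>. x \<alpha> * monomial_at z \<alpha>)"

definition polynomial :: "(multiindex \<Rightarrow> complex) \<Rightarrow> bool" where
  "polynomial q \<longleftrightarrow> finite {\<alpha>. q \<alpha> \<noteq> 0}"

definition affine_linear :: "(multiindex \<Rightarrow> complex) \<Rightarrow> bool" where
  "affine_linear g \<longleftrightarrow> (\<forall>\<alpha>. mdeg \<alpha> > 1 \<longrightarrow> g \<alpha> = 0)"

definition l1_norm :: "(multiindex \<Rightarrow> complex) \<Rightarrow> real" where
  "l1_norm x = (\<Sum>\<^sub>\<infinity>\<alpha>. cmod (x \<alpha>))"

text \<open>The product representing \<open>x\<close> is only required to converge pointwise on \<open>D_infty X\<close>. Partial
  products are used there rather than \<open>has_prod\<close>, because the latter imposes an extra condition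
  at zeros of the product.\<close>

definition factorable ::
  "(multiindex \<Rightarrow> complex) set \<Rightarrow> (multiindex \<Rightarrow> complex) \<Rightarrow> bool" where
  "factorable X x \<longleftrightarrow>
     (\<exists>g :: nat \<Rightarrow> multiindex \<Rightarrow> complex.
        (\<forall>j. affine_linear (g j) \<and> g j \<in> lp 1) \<and>
        (\<exists>P>0. (\<lambda>j. l1_norm (g j)) has_prod P) \<and>
        (\<forall>z\<in>D_infty X. (\<lambda>n. \<Prod>j<n. series (g j) z) \<longlonglongrightarrow> series x z))"

text \<open>The closure is taken in \<open>X\<close>: the products \<open>q f\<close> are represented by the
  coefficient families of the elements of \<open>X\<close> that agree with them on \<open>D_infty X\<close>.\<close>

definition cyclic ::
  "(multiindex \<Rightarrow> complex) set \<Rightarrow> (multiindex \<Rightarrow> complex) \<Rightarrow> bool" where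
  "cyclic X x \<longleftrightarrow>
     sigma_topology X closure_of
       {y \<in> X. \<exists>q. polynomial q \<and> (\<forall>z\<in>D_infty X. series y z = series q z * series x z)} = X"


section \<open>Function algebras\<close>

text \<open>Functions on a set \<open>\<Omega>\<close> are represented by total functions vanishing off \<open>\<Omega>\<close>.\<close>

definition banach_algebra_on ::
  "'a set \<Rightarrow> ('a \<Rightarrow> complex) set \<Rightarrow> (('a \<Rightarrow> complex) \<Rightarrow> real) \<Rightarrow> bool" where
  "banach_algebra_on \<Omega> A N \<longleftrightarrow>
     (\<forall>f\<in>A. \<forall>z. z \<notin> \<Omega> \<longrightarrow> f z = 0) \<and>
     indicator \<Omega> \<in> A \<and>
     (\<forall>f\<in>A. \<forall>g\<in>A. (\<lambda>z. f z + g z) \<in> A \<and> (\<lambda>z. f z * g z) \<in> A) \<and>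
     (\<forall>f\<in>A. \<forall>c. (\<lambda>z. c * f z) \<in> A) \<and>
     N (indicator \<Omega>) = 1 \<and>
     (\<forall>f\<in>A. N f \<ge> 0 \<and> (N f = 0 \<longleftrightarrow> f = (\<lambda>_. 0))) \<and>
     (\<forall>f\<in>A. \<forall>c. N (\<lambda>z. c * f z) = cmod c * N f) \<and>
     (\<forall>f\<in>A. \<forall>g\<in>A. N (\<lambda>z. f z + g z) \<le> N f + N g \<and> N (\<lambda>z. f z * g z) \<le> N f * N g) \<and>
     (\<forall>F :: nat \<Rightarrow> 'a \<Rightarrow> complex.
        range F \<subseteq> A \<and>
        (\<forall>e>0. \<exists>M. \<forall>m\<ge>M. \<forall>n\<ge>M. N (\<lambda>z. F m z - F n z) < e) \<longrightarrow>
        (\<exists>f\<in>A. (\<lambda>n. N (\<lambda>z. F n z - f z)) \<longlonglongrightarrow> 0))"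

definition complex_hom :: "('a \<Rightarrow> complex) set \<Rightarrow> (('a \<Rightarrow> complex) \<Rightarrow> complex) \<Rightarrow> bool" where
  "complex_hom A \<phi> \<longleftrightarrow>
     (\<forall>f\<in>A. \<forall>g\<in>A. \<phi> (\<lambda>z. f z + g z) = \<phi> f + \<phi> g \<and> \<phi> (\<lambda>z. f z * g z) = \<phi> f * \<phi> g) \<and>
     (\<forall>f\<in>A. \<forall>c. \<phi> (\<lambda>z. c * f z) = c * \<phi> f)"

definition realize ::
  "(multiindex \<Rightarrow> complex) set \<Rightarrow> (multiindex \<Rightarrow> complex) \<Rightarrow> (nat \<Rightarrow> complex) \<Rightarrow> complex" where
  "realize X x z = (if z \<in> D_infty X then series x z else 0)"

definition series_space ::
  "(multiindex \<Rightarrow> complex) set \<Rightarrow> ((nat \<Rightarrow> complex) \<Rightarrow> complex) set" where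
  "series_space X = realize X ` X"

text \<open>Here \<open>nrm\<close> is the given norm of \<open>X\<close>, and \<open>N\<close> is the equivalent algebra norm. The first
  inequality forces \<open>realize X\<close> to be injective on \<open>X\<close>.\<close>

definition function_algebra_on_max_ideal_space ::
  "(multiindex \<Rightarrow> complex) set \<Rightarrow> ((multiindex \<Rightarrow> complex) \<Rightarrow> real) \<Rightarrow> bool" where
  "function_algebra_on_max_ideal_space X nrm \<longleftrightarrow>
     (\<exists>N. banach_algebra_on (D_infty X) (series_space X) N \<and>
          (\<exists>c>0. \<exists>C>0. \<forall>x\<in>X. c * nrm x \<le> N (realize X x) \<and> N (realize X x) \<le> C * nrm x)) \<and>
     (\<forall>\<phi>. complex_hom (series_space X) \<phi> \<and> (\<exists>f\<in>series_space X. \<phi> f \<noteq> 0) \<longleftrightarrow>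
          (\<exists>z\<in>D_infty X. \<forall>f\<in>series_space X. \<phi> f = f z))"

end

theory Submission
  imports Defs
begin

text \<open>Part (2). By Hoelder's inequality and the Vandermonde identity for multinomial coefficients, \<open>X\<close>
  is a Banach algebra under convolution in which polynomials are dense. If \<open>f\<close> is not invertible, then
  Gelfand--Mazur modulo an ideal, applied to the variables one after another, yields a point \<open>z\<close> such
  that \<open>f\<close> and all \<open>\<zeta>\<^sub>j - z\<^sub>j\<close> lie in one proper ideal; hence \<open>z\<close> belongs to the domain and \<open>f\<close> vanishes at
  \<open>z\<close>. An invertible \<open>f\<close> is cyclic because its inverse is approximated by polynomials.

  Part (1). For \<open>p = 1\<close> this is part (2). Otherwise \<open>X\<close> is a module over the Banach algebra \<open>W\<close> of families with
  \<open>\<Sum>\<^sub>\<alpha> |x\<^sub>\<alpha>| (|\<alpha>| + 1) < \<infinity>\<close>. After normalization \<open>f\<close> is a constant times a product of factors \<open>1 - l\<^sub>j\<close>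
  with linear forms \<open>l\<^sub>j\<close> and \<open>\<Sum>\<^sub>j \<parallel>l\<^sub>j\<parallel>\<^sub>1 < \<infinity>\<close>, so that the tail of the product is invertible in \<open>W\<close> and it
  remains to treat a single factor \<open>1 - l\<close>. Nonvanishing on the ball means that the coefficients of \<open>l\<close>
  have \<open>\<ell>\<^sup>p\<close>-norm at most \<open>1\<close>; then \<open>l\<^sup>m\<close> has norm at most \<open>(m + 1)\<^sup>s\<close>, and \<open>s \<le> 1/p'\<close> forces \<open>0\<close> to be a weak
  cluster point of the powers \<open>l\<^sup>m\<close>, while every \<open>1 - l\<^sup>m\<close> is a multiple of \<open>1 - l\<close>.\<close>

section \<open>Commutative Banach algebras\<close>

text \<open>The spaces depend on real parameters, so they are carrier sets in one ring
  \<open>mser\<close>. The exponent \<open>t = 1/p'\<close> is critical because the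
  \<open>p'\<close>-th power of \<open>monomial / weight\<close> and the \<open>p\<close>-th power
  of a weighted coefficient of \<open>lin b ^ n\<close> then contain exactly one multinomial
  coefficient: sums over a fixed degree become multinomial expansions, which yield the unit ball as
  domain and the norms of powers of linear forms. In part (1) polynomials need not be norm dense
  (\<open>p = \<infinity>\<close>), so approximations are composed weakly, by letting multipliers
  act on functionals through their transposes. The bound \<open>s \<le> 1/p'\<close> enters through
  a sequence \<open>c\<close> that is not summable although \<open>c n * (n + 1) powr s\<close> is
  \<open>p\<close>-summable, or bounded for \<open>p = \<infinity>\<close>; for finite
  \<open>p\<close> a logarithmic factor achieves this up to the endpoint. For \<open>p = 1\<close>
  nonvanishing on the open ball would not suffice: \<open>1 - \<zeta>\<close> with a single variable
  \<open>\<zeta>\<close> vanishes at a point of the domain, the closed polydisc, where a cyclic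
  function has no zero; hence the extra condition in that case.\<close>

locale complex_subalgebra =
  fixes A :: "'a::comm_ring_1 set" and c :: "complex \<Rightarrow> 'a"
  assumes c_add: "c (k + l) = c k + c l"
    and c_mult: "c (k * l) = c k * c l"
    and c_one [simp]: "c 1 = 1"
    and c_in [simp]: "c k \<in> A"
    and add_in [simp]: "x \<in> A \<Longrightarrow> y \<in> A \<Longrightarrow> x + y \<in> A"
    and mult_in [simp]: "x \<in> A \<Longrightarrow> y \<in> A \<Longrightarrow> x * y \<in> A"
begin

lemma c_zero [simp]: "c 0 = 0"
  using c_add[of 0 0] by simp

lemma c_minus: "c (- k) = - c k"
  using c_add[of k "- k"] by (simp add: add_eq_0_iff)

lemma c_diff: "c (k - l) = c k - c l"
  using c_add[of k "- l"] by (simp add: c_minus)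

lemma c_power: "c (k ^ n) = c k ^ n"
  by (induction n) (auto simp: c_mult)

lemma c_sum: "c (sum f S) = (\<Sum>i\<in>S. c (f i))"
  by (induction S rule: infinite_finite_induct) (auto simp: c_add)

lemma zero_in [simp]: "0 \<in> A"
  using c_in[of 0] by simp

lemma one_in [simp]: "1 \<in> A"
  using c_in[of 1] by simp

lemma uminus_in [simp]: "x \<in> A \<Longrightarrow> - x \<in> A"
  using mult_in[OF c_in[of "-1"], of x] by (simp add: c_minus)

lemma diff_in [simp]: "x \<in> A \<Longrightarrow> y \<in> A \<Longrightarrow> x - y \<in> A"
  using add_in[of x "- y"] by simp

lemma power_in [simp]: "x \<in> A \<Longrightarrow> x ^ n \<in> A"
  by (induction n) auto

lemma sum_in [simp]: "(\<And>i. i \<in> S \<Longrightarrow> f i \<in> A) \<Longrightarrow> sum f S \<in> A"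
  by (induction S rule: infinite_finite_induct) auto

lemma prod_in [simp]: "(\<And>i. i \<in> S \<Longrightarrow> f i \<in> A) \<Longrightarrow> prod f S \<in> A"
  by (induction S rule: infinite_finite_induct) auto

end

text \<open>A quotient by an ideal is represented by its quotient seminorm on the same carrier; an
  identity in the quotient then appears as \<open>N e = 0\<close>.\<close>

locale algebra_seminorm = complex_subalgebra A c for A :: "'a::comm_ring_1 set" and c +
  fixes N :: "'a \<Rightarrow> real"
  assumes N_nonneg [simp]: "x \<in> A \<Longrightarrow> 0 \<le> N x"
    and N_triangle: "x \<in> A \<Longrightarrow> y \<in> A \<Longrightarrow> N (x + y) \<le> N x + N y"
    and N_mult: "x \<in> A \<Longrightarrow> y \<in> A \<Longrightarrow> N (x * y) \<le> N x * N y"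
    and N_scale_le: "x \<in> A \<Longrightarrow> N (c k * x) \<le> cmod k * N x"
begin

lemma N_zero [simp]: "N 0 = 0"
  using N_scale_le[of 0 0] by (intro antisym) auto

lemma N_uminus [simp]: assumes "x \<in> A" shows "N (- x) = N x"
proof -
  have "N (- y) \<le> N y" if "y \<in> A" for y
    using N_scale_le[OF that, of "-1"] by (simp add: c_minus)
  from this[of x] this[of "- x"] assms show ?thesis by simp
qed

lemma N_diff_le: "x \<in> A \<Longrightarrow> y \<in> A \<Longrightarrow> N (x - y) \<le> N x + N y"
  using N_triangle[of x "- y"] by simp

lemma N_diff_commute: "x \<in> A \<Longrightarrow> y \<in> A \<Longrightarrow> N (x - y) = N (y - x)"
  using N_uminus[of "x - y"] by simp

lemma N_sum_le: "(\<And>i. i \<in> S \<Longrightarrow> f i \<in> A) \<Longrightarrow> N (sum f S) \<le> (\<Sum>i\<in>S. N (f i))"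
proof (induction S rule: infinite_finite_induct)
  case (insert i S)
  have "N (f i + sum f S) \<le> N (f i) + N (sum f S)"
    using insert by (intro N_triangle) auto
  with insert show ?case by auto
qed auto

text \<open>Elements of seminorm 0 behave like an ideal that may be dropped from every estimate;
  this and the next \<open>N_null\<close> lemmas replace computation in a quotient ring.\<close>

lemma N_null_add: assumes "x \<in> A" "e \<in> A" "N e = 0" shows "N (x + e) = N x"
proof (rule antisym)
  show "N (x + e) \<le> N x" using N_triangle[of x e] assms by simp
  have "N (x + e - e) \<le> N (x + e) + N e" using assms by (intro N_diff_le) auto
  then show "N x \<le> N (x + e)" using assms by simp
qed

lemma N_null_mult: assumes "x \<in> A" "e \<in> A" "N e = 0" shows "N (x * e) = 0"
  using N_mult[of x e] assms by (intro antisym) auto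

lemma N_null_plus: assumes "x \<in> A" "e \<in> A" "N e = 0" "N x = 0" shows "N (x + e) = 0"
  using N_null_add[of x e] assms by simp

lemma N_null_sum:
  "(\<And>i. i \<in> S \<Longrightarrow> f i \<in> A) \<Longrightarrow> (\<And>i. i \<in> S \<Longrightarrow> N (f i) = 0) \<Longrightarrow> N (sum f S) = 0"
proof (induction S rule: infinite_finite_induct)
  case (insert i S)
  then show ?case using N_null_plus[of "f i" "sum f S"] by auto
qed auto

lemma N_power: assumes "x \<in> A" shows "N (x ^ n) \<le> N 1 * N x ^ n"
proof (induction n)
  case (Suc n)
  have "N (x ^ Suc n) \<le> N x * N (x ^ n)" using N_mult[of x "x ^ n"] assms by simp
  also have "\<dots> \<le> N x * (N 1 * N x ^ n)" using Suc assms by (intro mult_left_mono) auto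
  finally show ?case by (simp add: mult_ac)
qed auto

end

text \<open>A geometric sum with ratio \<open>cis (2 * pi / n) ^ i\<close>, which differs from 1
  although its \<open>n\<close>-th power is 1. Averaging over the \<open>n\<close>-th roots of unity
  thus keeps only the constant term of a polynomial of degree below \<open>n\<close>.\<close>

lemma sum_roots_of_unity_powers:
  fixes i n :: nat
  assumes "0 < i" "i < n"
  shows "(\<Sum>k<n. cis (2 * pi / n) ^ (k * i)) = 0"
proof -
  let ?w = "cis (2 * pi / n) ^ i"
  have w: "?w = cis (2 * pi * (i / n))" using Complex.DeMoivre[of "2 * pi / n" i] by (simp add: mult_ac)
  have "?w \<noteq> 1"
  proof
    assume "?w = 1"
    then have "cos (2 * pi * (i / n)) = 1" unfolding w by (auto simp: complex_eq_iff)
    then obtain m :: int where "2 * pi * (i / n) = of_int m * 2 * pi"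
      unfolding cos_one_2pi_int by blast
    then have "real i = m * n" using assms by (simp add: field_simps)
    then have "int i = m * int n" by (metis of_int_eq_iff of_int_mult of_int_of_nat_eq)
    then have "int n dvd int i" by simp
    then show False using assms by (metis int_dvd_int_iff nat_dvd_not_less)
  qed
  moreover have "?w ^ n = 1"
    using assms by (simp flip: power_mult) (simp add: mult.commute[of i] power_mult Complex.DeMoivre)
  ultimately have "(\<Sum>k<n. ?w ^ k) = 0"
    by (simp add: geometric_sum)
  then show ?thesis by (simp add: power_mult[symmetric] mult.commute)
qed

section \<open>The Gelfand--Mazur theorem for seminorms\<close>

context algebra_seminorm
begin

text \<open>Rickart's proof: the averages \<open>v n r\<close> of the resolvent over a circle of radius \<open>r\<close> are inverse
  to \<open>1 - (r a)^n\<close> and equicontinuous in \<open>r\<close>, so \<open>(r a)^n \<longlongrightarrow> 0\<close> propagates from \<open>r = 0\<close> to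
  arbitrarily large \<open>r\<close>, which contradicts the invertibility of \<open>a\<close>.\<close>

lemma Gelfand_Mazur:
  assumes a: "a \<in> A" and inv: "\<And>l. \<exists>b\<in>A. N ((a - c l) * b - 1) = 0"
  shows "N 1 = 0"
proof (rule ccontr)
  assume "N 1 \<noteq> 0"
  then have N1: "N 1 > 0" using N_nonneg[of 1] by (simp del: N_nonneg)
  \<comment> \<open>Inverting \<open>1 - c m * a\<close> instead of \<open>a - c (1 / m)\<close>
    includes the point \<open>m = 0\<close>, from which the radii start.\<close>
  have "\<exists>b\<in>A. N (b * (1 - c m * a) - 1) = 0" for m
  proof (cases "m = 0")
    case True
    then show ?thesis by (intro bexI[of _ 1]) auto
  next
    case False
    obtain b where b: "b \<in> A" "N ((a - c (1 / m)) * b - 1) = 0" using inv by blast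
    have "c m * c (1 / m) = 1" using False by (simp flip: c_mult)
    then have "- c (1/m) * b * (1 - c m * a) = (a - c (1 / m)) * b"
      by (simp add: algebra_simps)
    then show ?thesis using b by (intro bexI[of _ "- c (1/m) * b"]) auto
  qed
  then obtain F where F: "\<And>m. F m \<in> A" and F0: "\<And>m. N (F m * (1 - c m * a) - 1) = 0"
    by metis
  \<comment> \<open>The resolvent identity, up to the null elements \<open>E m\<close> and
    \<open>E n\<close>.\<close>
  have diff: "N (F m - F n) \<le> cmod (m - n) * (N a * N (F m) * N (F n))" for m n
  proof -
    define E where "E m = F m * (1 - c m * a) - 1" for m
    have E: "E m \<in> A" "N (E m) = 0" for m using F F0 a by (auto simp: E_def)
    have "F m - F n = (c (m - n) * (a * F m * F n) + (- F m) * E n) + F n * E m"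
      by (simp add: E_def c_diff algebra_simps)
    also have "N \<dots> = N (c (m - n) * (a * F m * F n))"
      using E F a by (simp add: N_null_add N_null_mult del: mult_minus_left)
    also have "\<dots> \<le> cmod (m - n) * N (a * F m * F n)"
      using F a by (intro N_scale_le) auto
    also have "N (a * F m * F n) \<le> N a * N (F m) * N (F n)"
      using N_mult[of "a * F m" "F n"] N_mult[of a "F m"] F a
      by (meson N_nonneg dual_order.trans mult_in mult_right_mono)
    finally show ?thesis by (simp add: mult_left_mono)
  qed
  obtain b where b: "b \<in> A" "N (a * b - 1) = 0" using inv[of 0] by auto
  \<comment> \<open>\<open>b\<close> inverts \<open>a\<close>, and the contradiction needs a good
    radius above \<open>N b\<close>; the radius finally reached is \<open>M - h / 2\<close> with
    \<open>h / 2 < 1\<close>.\<close>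
  define M where "M = N b + 1"
  have M: "M > 0" using b by (simp add: M_def add_nonneg_pos)
  \<comment> \<open>On a small disc around \<open>n\<close>, \<open>diff\<close> can be absorbed to
    give \<open>N (F m) \<le> 2 * N (F n)\<close>; a finite subcover of the closed disc makes the
    bound uniform.\<close>
  have "\<exists>B>0. \<forall>m\<in>cball 0 M. N (F m) \<le> B"
  proof -
    define d where "d n = 1 / (2 * (N a * N (F n) + 1))" for n
    have d: "d n > 0" for n using a F by (simp add: d_def add_nonneg_pos)
    have loc: "N (F m) \<le> 2 * N (F n)" if "m \<in> ball n (d n)" for m n
    proof -
      have "cmod (m - n) * (N a * N (F n)) \<le> d n * (N a * N (F n) + 1)"
        using that a F d[of n] by (intro mult_mono) (auto simp: dist_norm norm_minus_commute)
      also have "\<dots> = 1 / 2" using a F d[of n] by (simp add: d_def)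
      finally have h: "cmod (m - n) * (N a * N (F n)) \<le> 1 / 2" .
      have "N (F n + (F m - F n)) \<le> N (F n) + N (F m - F n)"
        using F by (intro N_triangle) auto
      also have "\<dots> \<le> N (F n) + (cmod (m - n) * (N a * N (F n))) * N (F m)"
        using diff[of m n] by (simp add: mult_ac)
      also have "\<dots> \<le> N (F n) + 1 / 2 * N (F m)"
        using h F by (intro add_left_mono mult_right_mono) auto
      finally show ?thesis by simp
    qed
    have "compact (cball (0::complex) M)" by simp
    moreover have "cball 0 M \<subseteq> (\<Union>n\<in>cball 0 M. ball n (d n))" using d by auto
    ultimately obtain C where C: "C \<subseteq> cball 0 M" "finite C" "cball 0 M \<subseteq> (\<Union>n\<in>C. ball n (d n))"
      using compactE_image[of "cball 0 M" "cball 0 M" "\<lambda>n. ball n (d n)"] by (metis open_ball)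
    have "N (F m) \<le> (\<Sum>n\<in>C. 2 * N (F n)) + 1" if m: "m \<in> cball 0 M" for m
    proof -
      obtain n where n: "n \<in> C" "m \<in> ball n (d n)" using subsetD[OF C(3) m] by (rule UN_E)
      have "N (F m) \<le> 2 * N (F n)" using loc n by blast
      also have "\<dots> \<le> (\<Sum>n\<in>C. 2 * N (F n))"
        using C n F by (intro member_le_sum) auto
      finally show ?thesis by simp
    qed
    moreover have "(\<Sum>n\<in>C. 2 * N (F n)) + 1 > 0" using F by (intro add_nonneg_pos sum_nonneg) auto
    ultimately show ?thesis by blast
  qed
  then obtain B where B: "B > 0" "\<And>m. cmod m \<le> M \<Longrightarrow> N (F m) \<le> B" by auto
  \<comment> \<open>By \<open>diff\<close> this is a Lipschitz constant of \<open>F\<close> on the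
    disc, hence of every average \<open>v n\<close>, independently of \<open>n\<close>.\<close>
  define L where "L = N a * B * B"
  have L0: "L \<ge> 0" using a B by (simp add: L_def)
  define w where "w n k = cis (2 * pi / n) ^ k" for n k :: nat
  have w1: "cmod (w n k) = 1" for n k by (simp add: w_def norm_power)
  define v where "v n r = c (1 / n) * (\<Sum>k<n. F (w n k * of_real r))" for n :: nat and r :: real
  have vA: "v n r \<in> A" for n r using F by (simp add: v_def)
  have vlip: "N (v n r - v n r') \<le> L * \<bar>r - r'\<bar>"
    if "n > 0" "0 \<le> r" "r \<le> M" "0 \<le> r'" "r' \<le> M" for n r r'
  proof -
    have "v n r - v n r' = c (1 / n) * (\<Sum>k<n. F (w n k * r) - F (w n k * r'))"
      by (simp add: v_def sum_subtractf right_diff_distrib)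
    also have "N \<dots> \<le> cmod (1 / n) * N (\<Sum>k<n. F (w n k * r) - F (w n k * r'))"
      using F by (intro N_scale_le) auto
    also have "N (\<Sum>k<n. F (w n k * r) - F (w n k * r')) \<le> (\<Sum>k<n. N (F (w n k * r) - F (w n k * r')))"
      using F by (intro N_sum_le) auto
    also have "\<dots> \<le> (\<Sum>k<n. L * \<bar>r - r'\<bar>)"
    proof (intro sum_mono)
      fix k
      have "N (F (w n k * r) - F (w n k * r')) \<le>
        cmod (w n k * r - w n k * r') * (N a * N (F (w n k * r)) * N (F (w n k * r')))"
        by (rule diff)
      also have "w n k * r - w n k * r' = w n k * of_real (r - r')" by (simp add: algebra_simps)
      also have "cmod \<dots> = \<bar>r - r'\<bar>" by (simp only: norm_mult w1 norm_of_real mult_1_left)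
      also have "N a * N (F (w n k * r)) * N (F (w n k * r')) \<le> L"
        unfolding L_def using that a F B(1)
        by (intro mult_mono B(2)) (auto simp: norm_mult w1)
      then have "\<bar>r - r'\<bar> * (N a * N (F (w n k * r)) * N (F (w n k * r'))) \<le> \<bar>r - r'\<bar> * L"
        by (rule mult_left_mono) simp
      finally show "N (F (w n k * r) - F (w n k * r')) \<le> L * \<bar>r - r'\<bar>"
        by (simp only: mult.commute[of L])
    qed
    finally show ?thesis using that by (simp add: divide_right_mono norm_divide)
  qed
  \<comment> \<open>Since \<open>w n k ^ n = 1\<close>, each \<open>1 - c (w n k * r) * a\<close>
    divides \<open>1 - (c r * a) ^ n\<close> with quotient \<open>P k\<close>, and the average of
    the \<open>P k\<close> over the roots of unity is 1.\<close>
  have vinv: "N (v n r * (1 - (c r * a) ^ n) - 1) = 0" if n: "n > 0" for n r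
  proof -
    define E where "E k = F (w n k * r) * (1 - c (w n k * r) * a) - 1" for k
    have E: "E k \<in> A" "N (E k) = 0" for k using F F0 a by (auto simp: E_def)
    define P where "P k = (\<Sum>i<n. (c (w n k * r) * a) ^ i)" for k
    have PA: "P k \<in> A" for k using a by (simp add: P_def)
    have wn: "w n k ^ n = 1" for k
    proof -
      have "w n k ^ n = (cis (2 * pi / n) ^ n) ^ k" by (simp add: w_def flip: power_mult) (simp add: mult.commute)
      also have "cis (2 * pi / n) ^ n = 1" using n by (simp add: Complex.DeMoivre)
      finally show ?thesis by simp
    qed
    have pk: "(c (w n k * r) * a) ^ n = (c r * a) ^ n" for k
      using wn[of k] by (simp add: power_mult_distrib c_mult flip: c_power)
    have "F (w n k * r) * (1 - (c r * a) ^ n) = P k + E k * P k" for k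
    proof -
      have "1 - (c r * a) ^ n = (1 - c (w n k * r) * a) * P k"
        unfolding P_def using one_diff_power_eq[of "c (w n k * r) * a" n] pk[of k] by simp
      then have "F (w n k * r) * (1 - (c r * a) ^ n) = F (w n k * r) * (1 - c (w n k * r) * a) * P k"
        by (simp only: mult.assoc)
      also have "\<dots> = P k + E k * P k" by (simp add: E_def algebra_simps)
      finally show ?thesis .
    qed
    then have "v n r * (1 - (c r * a) ^ n) = c (1 / n) * (\<Sum>k<n. P k) + c (1 / n) * (\<Sum>k<n. E k * P k)"
      by (simp add: v_def sum_distrib_right mult.assoc sum.distrib distrib_left)
    moreover have "c (1 / n) * (\<Sum>k<n. P k) = 1"
    proof -
      have "(\<Sum>k<n. P k) = (\<Sum>i<n. \<Sum>k<n. (c (w n k * r) * a) ^ i)"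
        unfolding P_def by (rule sum.swap)
      also have "\<dots> = (\<Sum>i<n. c (\<Sum>k<n. w n k ^ i) * (c r * a) ^ i)"
        by (intro sum.cong refl) (simp add: c_sum c_mult c_power power_mult_distrib sum_distrib_left sum_distrib_right mult_ac)
      also have "\<dots> = (\<Sum>i<n. if i = 0 then c n else 0)"
      proof (intro sum.cong refl)
        fix i assume "i \<in> {..<n}"
        then show "c (\<Sum>k<n. w n k ^ i) * (c r * a) ^ i = (if i = 0 then c n else 0)"
          using sum_roots_of_unity_powers[of i n] by (cases "i = 0") (auto simp: w_def power_mult)
      qed
      also have "\<dots> = c n" using n by simp
      finally show ?thesis using n by (simp flip: c_mult)
    qed
    moreover have "N (c (1 / n) * (\<Sum>k<n. E k * P k)) = 0"
    proof -
      have "N (E k * P k) = 0" for k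
        using N_null_mult[of "P k" "E k"] E PA by (simp add: mult.commute)
      then have "N (\<Sum>k<n. E k * P k) = 0" using E PA by (intro N_null_sum) auto
      then show ?thesis using E PA by (intro N_null_mult) auto
    qed
    ultimately show ?thesis by simp
  qed
  define good where "good r \<longleftrightarrow> (\<lambda>n. N ((c (of_real r) * a) ^ n)) \<longlonglongrightarrow> 0" for r :: real
  have good0: "good 0"
  proof -
    have "eventually (\<lambda>n. N ((c (of_real 0) * a) ^ n) = 0) sequentially"
      using eventually_gt_at_top[of 0] by eventually_elim (simp add: zero_power)
    then show ?thesis unfolding good_def by (rule tendsto_eventually)
  qed
  have good_less: "good r''" if r: "0 \<le> r''" "r'' < r'"
    and bd: "eventually (\<lambda>n. N ((c (of_real r') * a) ^ n) \<le> C) sequentially" for r'' r' C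
  proof -
    have "(\<lambda>n. (r'' / r') ^ n * C) \<longlonglongrightarrow> 0 * C"
      using r by (intro tendsto_mult LIMSEQ_power_zero tendsto_const) auto
    then have lim: "(\<lambda>n. (r'' / r') ^ n * C) \<longlonglongrightarrow> 0" by simp
    show ?thesis unfolding good_def
    proof (rule tendsto_sandwich[OF _ _ tendsto_const lim])
      show "eventually (\<lambda>n. 0 \<le> N ((c (of_real r'') * a) ^ n)) sequentially" using a by simp
      show "eventually (\<lambda>n. N ((c (of_real r'') * a) ^ n) \<le> (r'' / r') ^ n * C) sequentially"
        using bd
      proof eventually_elim
        case (elim n)
        have "c (of_real r'') = c (of_real (r'' / r')) * c (of_real r')" using r by (simp flip: c_mult)
        then have "(c (of_real r'') * a) ^ n = c (of_real ((r'' / r') ^ n)) * (c (of_real r') * a) ^ n"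
          by (simp only: power_mult_distrib c_power of_real_power mult_ac)
        also have "N \<dots> \<le> cmod (of_real ((r'' / r') ^ n)) * N ((c (of_real r') * a) ^ n)"
          using a by (intro N_scale_le) auto
        also have "cmod (of_real ((r'' / r') ^ n)) = (r'' / r') ^ n"
          using r by (simp only: norm_of_real) simp
        also have "(r'' / r') ^ n * N ((c (of_real r') * a) ^ n) \<le> (r'' / r') ^ n * C"
          using elim r by (intro mult_left_mono) auto
        finally show ?case .
      qed
    qed
  qed
  define e where "e = N 1 / (8 * (N 1 + 1) * (L + 1))"
  have e: "e > 0" using N1 L0 by (simp add: e_def)
  \<comment> \<open>If \<open>r\<close> is good, then \<open>v n r\<close> is within 1/4 of 1 for
    large \<open>n\<close>, so \<open>v n r'\<close> is within 1/2. Its inverse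
    \<open>1 - (r' a)^n\<close> is then bounded by \<open>2 * N 1\<close>, hence the powers of
    \<open>r' a\<close> are bounded, and a strictly smaller radius \<open>r''\<close> is
    good.\<close>
  have step: "good r''" if r: "0 \<le> r" "good r" "r \<le> M" "0 \<le> r''" "r'' < r'" "r \<le> r'" "r' \<le> M"
    "L * (r' - r) \<le> 1 / 4" for r r' r''
  proof -
    have "eventually (\<lambda>n. N ((c (of_real r) * a) ^ n) < 1 / (4 * B)) sequentially"
      using r(2) B(1) unfolding good_def by (intro order_tendstoD) auto
    then have "eventually (\<lambda>n. N ((c (of_real r') * a) ^ n) \<le> 3 * N 1) sequentially"
      using eventually_gt_at_top[of 0]
    proof eventually_elim
      case (elim n)
      define y where "y = 1 - (c (of_real r') * a) ^ n"
      define z where "z = (c (of_real r) * a) ^ n"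
      have yz: "y \<in> A" "z \<in> A" using a by (auto simp: y_def z_def)
      have Nv: "N (v n r) \<le> B"
      proof -
        have "N (v n r) \<le> cmod (1 / n) * N (\<Sum>k<n. F (w n k * r))"
          unfolding v_def using F by (intro N_scale_le) auto
        also have "N (\<Sum>k<n. F (w n k * r)) \<le> (\<Sum>k<n. N (F (w n k * r)))"
          using F by (intro N_sum_le) auto
        also have "\<dots> \<le> (\<Sum>k<n. B)"
          using r by (intro sum_mono B(2)) (auto simp: norm_mult w1)
        finally show ?thesis using elim by (simp add: divide_right_mono norm_divide)
      qed
      have "1 - v n r = - (v n r * z) + - (v n r * (1 - z) - 1)"
        by (simp add: algebra_simps)
      also have "N \<dots> = N (v n r * z)"
      proof (subst N_null_add)
        show "N (- (v n r * (1 - z) - 1)) = 0"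
          using vinv[of n r] elim yz vA by (subst N_uminus) (auto simp: z_def)
      qed (use vA yz in auto)
      also have "\<dots> \<le> N (v n r) * N z" using vA yz by (intro N_mult)
      also have "\<dots> \<le> B * (1 / (4 * B))"
        using Nv elim B(1) yz by (intro mult_mono) (auto simp: z_def)
      finally have 1: "N (1 - v n r) \<le> 1 / 4" using B by simp
      have "N (v n r - v n r') \<le> L * \<bar>r - r'\<bar>"
        using elim r by (intro vlip) auto
      then have 2: "N (v n r - v n r') \<le> 1 / 4" using r by simp
      have "N ((1 - v n r) + (v n r - v n r')) \<le> N (1 - v n r) + N (v n r - v n r')"
        using vA by (intro N_triangle) auto
      with 1 2 have 3: "N (1 - v n r') \<le> 1 / 2" by simp
      have "y = (1 + (1 - v n r') * y) + (v n r' * y - 1)" by (simp add: algebra_simps)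
      also have "N \<dots> = N (1 + (1 - v n r') * y)"
        using vinv[of n r'] elim yz vA by (subst N_null_add) (auto simp: y_def)
      also have "\<dots> \<le> N 1 + N ((1 - v n r') * y)" using yz vA by (intro N_triangle) auto
      also have "N ((1 - v n r') * y) \<le> N (1 - v n r') * N y" using yz vA by (intro N_mult) auto
      also have "\<dots> \<le> 1 / 2 * N y" using 3 yz by (intro mult_right_mono) auto
      finally have "N y \<le> 2 * N 1" by simp
      moreover have "N (1 - y) \<le> N 1 + N y" using yz by (intro N_diff_le) auto
      ultimately show ?case by (simp add: y_def)
    qed
    then show ?thesis using r by (intro good_less[of r'' r']) auto
  qed
  define h where "h = 1 / (4 * (L + 1))"
  have h: "h > 0" "L * h \<le> 1 / 4" using L0 by (auto simp: h_def field_simps)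
  \<comment> \<open>Only half of the step \<open>h\<close> is gained each time because
    \<open>r''\<close> must stay strictly below \<open>r'\<close>; the cap \<open>M - h / 2\<close>
    keeps \<open>r'\<close> inside the disc where the bound \<open>B\<close> holds.\<close>
  have iter: "good (min (real n * (h / 2)) (M - h / 2))" if "h < M" for n
  proof (induction n)
    case 0
    then show ?case using good0 that h by simp
  next
    case (Suc n)
    define u where "u = real n * (h / 2)"
    define r where "r = min u (M - h / 2)"
    define r' where "r' = min (r + h) M"
    have u: "u \<ge> 0" "real (Suc n) * (h / 2) = u + h / 2" using h by (auto simp: u_def algebra_simps)
    have "L * (r' - r) \<le> L * h" using L0 by (intro mult_left_mono) (auto simp: r'_def)
    moreover define m where "m = min (u + h / 2) (M - h / 2)"
    have mr: "m \<le> r + h / 2" "m \<le> M - h / 2" "0 \<le> m" "0 \<le> r" "r \<le> M - h / 2"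
      using u(1) that h(1) by (auto simp: m_def r_def)
    moreover have "r \<le> r'" "r' \<le> M" "m < r'" using mr h(1) by (auto simp: r'_def)
    moreover have "good r" using Suc by (simp add: u_def r_def)
    ultimately have "good m" using h by - (rule step[where r = r and r' = r' and r'' = m], (assumption | linarith)+)
    then show ?case by (simp only: m_def u(2))
  qed
  show False
  proof (cases "h < M \<and> h / 2 < 1")
    case True
    obtain n :: nat where "real n * (h / 2) > M" using h by (metis half_gt_zero reals_Archimedean3 mult.commute)
    then have "good (M - h / 2)" using iter[of n] True h by (simp add: min_def split: if_splits)
    moreover define R where "R = M - h / 2"
    ultimately have gR: "good R" by simp
    have "R > N b" using True by (auto simp: R_def M_def)
    with N_nonneg[OF b(1)] have R: "R > N b" "R > 0" by auto
    have "N (c (of_real (1 / R)) * b) \<le> cmod (of_real (1 / R)) * N b"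
      using b by (intro N_scale_le) auto
    also have "\<dots> \<le> 1" unfolding norm_of_real using R by simp
    finally have small: "N (c (of_real (1 / R)) * b) \<le> 1" .
    \<comment> \<open>Modulo null elements \<open>(R a)^n * (b / R)^n = (a b)^n\<close> equals 1,
      while \<open>(b / R)^n\<close> stays bounded because \<open>R > N b\<close>; so
      \<open>(R a)^n\<close> cannot tend to 0.\<close>
    have "N 1 \<le> N ((c (of_real R) * a) ^ n) * (N 1)" for n
    proof -
      have abn: "N ((a * b) ^ n - 1) = 0" 
      proof -
        have "(a * b) ^ n - 1 = (\<Sum>i<n. (a * b) ^ i) * (a * b - 1)"
          using power_diff_1_eq[of "a * b" n] by (simp add: mult.commute)
        then show ?thesis using a b by (simp add: N_null_mult)
      qed
      have "N 1 = N (1 + ((a * b) ^ n - 1))"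
        using abn a b by (intro N_null_add[symmetric]) auto
      also have "1 + ((a * b) ^ n - 1) = (c (of_real R) * a) ^ n * (c (of_real (1 / R)) * b) ^ n"
      proof -
        have "c (of_real R) * c (of_real (1 / R)) = 1" using R by (simp flip: c_mult)
        then have "a * b = (c (of_real R) * a) * (c (of_real (1 / R)) * b)"
          by (metis mult.assoc mult.commute mult.left_commute mult_1)
        then show ?thesis by (simp add: power_mult_distrib)
      qed
      also have "N \<dots> \<le> N ((c (of_real R) * a) ^ n) * N ((c (of_real (1 / R)) * b) ^ n)"
        using a b by (intro N_mult) auto
      also have "N ((c (of_real (1 / R)) * b) ^ n) \<le> N 1 * N (c (of_real (1 / R)) * b) ^ n"
        using b by (intro N_power) auto
      also have "\<dots> \<le> N 1 * 1"
        using b small by (intro mult_left_mono power_le_one) auto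
      finally show ?thesis using a by (simp add: mult_left_mono)
    qed
    then have "1 \<le> N ((c (of_real R) * a) ^ n)" for n using N1 by (metis mult_le_cancel_right1 not_le)
    then have "\<not> good R" unfolding good_def using LIMSEQ_le_const by fastforce
    then show False using gR by simp
  next
    case False
    \<comment> \<open>This case cannot occur: \<open>h\<close> is at most 1/4 and \<open>M\<close>
      is at least 1.\<close>
    have "h \<le> 1 / 4" unfolding h_def using L0 by (intro divide_left_mono) auto
    moreover have "1 \<le> M" using b by (simp add: M_def)
    ultimately show False using False by simp
  qed
qed

end

section \<open>Neumann series, characters and proper ideals\<close>

locale banach_algebra = algebra_seminorm A c N
  for A :: "'a::comm_ring_1 set" and c and N +
  assumes N_one [simp]: "N 1 = 1"
    and N_definite: "x \<in> A \<Longrightarrow> N x = 0 \<Longrightarrow> x = 0"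
    and complete: "(\<And>n::nat. F n \<in> A) \<Longrightarrow>
      (\<And>e. e > 0 \<Longrightarrow> \<exists>M. \<forall>m\<ge>M. \<forall>n\<ge>M. N (F m - F n) < e) \<Longrightarrow>
      \<exists>f\<in>A. (\<lambda>n. N (F n - f)) \<longlonglongrightarrow> 0"
begin

lemma complete_summable:
  assumes F: "\<And>n::nat. F n \<in> A" and u: "\<And>n. N (F (Suc n) - F n) \<le> u n" "summable u"
  shows "\<exists>f\<in>A. (\<lambda>n. N (F n - f)) \<longlonglongrightarrow> 0"
proof (rule complete[OF F])
  fix e :: real assume "e > 0"
  obtain M where M: "\<And>m n. m \<ge> M \<Longrightarrow> norm (sum u {m..<n}) < e"
    using u(2) \<open>e > 0\<close> unfolding summable_Cauchy by meson
  have ord: "N (F n - F m) \<le> sum u {m..<n}" if "m \<le> n" for m n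
    using that
  proof (induction n rule: dec_induct)
    case (step n)
    have "N ((F (Suc n) - F n) + (F n - F m)) \<le> N (F (Suc n) - F n) + N (F n - F m)"
      using F by (intro N_triangle) auto
    also have "\<dots> \<le> u n + sum u {m..<n}" using step u by (intro add_mono) auto
    also have "\<dots> = sum u {m..<Suc n}" using step by simp
    finally show ?case by simp
  qed auto
  have "N (F m - F n) < e" if "m \<ge> M" "n \<ge> M" for m n
  proof (cases "m \<le> n")
    case True
    have "N (F m - F n) = N (F n - F m)" using F by (intro N_diff_commute)
    also have "\<dots> \<le> sum u {m..<n}" by (rule ord[OF True])
    also have "\<dots> < e" using M[OF that(1), of n] by simp
    finally show ?thesis .
  next
    case False
    then have "N (F m - F n) \<le> sum u {n..<m}" by (intro ord) auto
    also have "\<dots> < e" using M[OF that(2), of m] by simp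
    finally show ?thesis .
  qed
  then show "\<exists>M. \<forall>m\<ge>M. \<forall>n\<ge>M. N (F m - F n) < e" by blast
qed

lemma N_eq_if_tendsto:
  assumes "\<And>n. N (x - y) \<le> u n" "u \<longlonglongrightarrow> 0" "x \<in> A" "y \<in> A"
  shows "x = y"
proof -
  have "N (x - y) \<le> 0" using assms(1,2) by (intro LIMSEQ_le_const) auto
  then have "N (x - y) = 0" using assms by (intro antisym) auto
  then show ?thesis using N_definite[of "x - y"] assms by simp
qed

text \<open>The inverse is the Neumann series \<open>\<Sum> (1 - x) ^ i\<close>.\<close>

lemma invertible_near_one:
  assumes x: "x \<in> A" "N (1 - x) < 1"
  shows "\<exists>b\<in>A. x * b = 1"
proof -
  define a where "a = 1 - x"
  have a: "a \<in> A" "N a < 1" using x by (auto simp: a_def)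
  have pow: "N (a ^ n) \<le> N a ^ n" for n using N_power[of a n] a by simp
  define S where "S n = (\<Sum>i<n. a ^ i)" for n
  have S: "S n \<in> A" for n using a by (simp add: S_def)
  have "\<exists>b\<in>A. (\<lambda>n. N (S n - b)) \<longlonglongrightarrow> 0"
    using a pow by (intro complete_summable[where u = "\<lambda>n. N a ^ n"] S summable_geometric)
      (auto simp: S_def)
  then obtain b where b: "b \<in> A" "(\<lambda>n. N (S n - b)) \<longlonglongrightarrow> 0" by blast
  have "x * b = 1"
  proof (rule N_eq_if_tendsto)
    fix n
    have "x * S n = 1 - a ^ n"
      unfolding S_def using one_diff_power_eq[of a n] by (simp add: a_def)
    then have "x * b - 1 = - (x * (S n - b)) - a ^ n" by (simp add: algebra_simps)
    also have "N \<dots> \<le> N (x * (S n - b)) + N (a ^ n)"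
      using N_diff_le[of "- (x * (S n - b))" "a ^ n"] a b S x by (simp del: minus_mult_right)
    also have "\<dots> \<le> N x * N (S n - b) + N a ^ n"
      using pow S b x by (intro add_mono N_mult) auto
    finally show "N (x * b - 1) \<le> N x * N (S n - b) + N a ^ n" .
  next
    have "(\<lambda>n. N x * N (S n - b) + N a ^ n) \<longlonglongrightarrow> N x * 0 + 0"
      using b a by (intro tendsto_intros LIMSEQ_power_zero) auto
    then show "(\<lambda>n. N x * N (S n - b) + N a ^ n) \<longlonglongrightarrow> 0" by simp
  qed (use b x in auto)
  then show ?thesis using b by blast
qed

text \<open>If \<open>\<phi> x\<close> were larger than \<open>N x\<close>, the element
  \<open>1 - x / \<phi> x\<close> would be invertible by the Neumann series although
  \<open>\<phi>\<close> maps it to 0.\<close>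

lemma character_bound:
  assumes add: "\<And>x y. x \<in> A \<Longrightarrow> y \<in> A \<Longrightarrow> \<phi> (x + y) = \<phi> x + \<phi> y"
    and mult: "\<And>x y. x \<in> A \<Longrightarrow> y \<in> A \<Longrightarrow> \<phi> (x * y) = \<phi> x * \<phi> y"
    and scale: "\<And>k x. x \<in> A \<Longrightarrow> \<phi> (c k * x) = k * \<phi> x"
    and nz: "\<exists>x\<in>A. \<phi> x \<noteq> 0" and x: "x \<in> A"
  shows "cmod (\<phi> x) \<le> N x"
proof (rule ccontr)
  assume *: "\<not> ?thesis"
  obtain y where y: "y \<in> A" "\<phi> y \<noteq> 0" using nz by blast
  have phi1: "\<phi> 1 = 1" using mult[OF y(1), of 1] y(2) by simp
  have nz: "\<phi> x \<noteq> 0" using * x by auto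
  define u where "u = 1 - c (1 / \<phi> x) * x"
  have "N (1 - u) \<le> cmod (1 / \<phi> x) * N x" unfolding u_def using N_scale_le x by simp
  also have "\<dots> < 1" using * nz by (simp add: norm_divide field_simps)
  finally obtain b where b: "b \<in> A" "u * b = 1"
    using invertible_near_one[of u] x by (auto simp: u_def)
  have "\<phi> u + \<phi> (c (1 / \<phi> x) * x) = \<phi> 1"
    using x by (subst add[symmetric]) (auto simp: u_def)
  then have "\<phi> u = 0" using scale[OF x] nz phi1 by simp
  then have "\<phi> (u * b) = 0" using mult[of u b] b x by (simp add: u_def)
  then show False using b phi1 by simp
qed

definition proper_ideal :: "'a set \<Rightarrow> bool" where
  "proper_ideal J \<longleftrightarrow> J \<subseteq> A \<and> 0 \<in> J \<and> 1 \<notin> J \<and> (\<forall>x\<in>J. \<forall>y\<in>J. x + y \<in> J) \<and> (\<forall>a\<in>A. \<forall>x\<in>J. a * x \<in> J)"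

lemma proper_idealD:
  assumes "proper_ideal J"
  shows "\<And>x. x \<in> J \<Longrightarrow> x \<in> A" "0 \<in> J" "1 \<notin> J" "\<And>x y. x \<in> J \<Longrightarrow> y \<in> J \<Longrightarrow> x + y \<in> J"
    "\<And>a x. a \<in> A \<Longrightarrow> x \<in> J \<Longrightarrow> a * x \<in> J" "\<And>x. x \<in> J \<Longrightarrow> - x \<in> J"
    "\<And>x y. x \<in> J \<Longrightarrow> y \<in> J \<Longrightarrow> x - y \<in> J"
proof -
  show *: "\<And>x. x \<in> J \<Longrightarrow> x \<in> A" "0 \<in> J" "1 \<notin> J" "\<And>x y. x \<in> J \<Longrightarrow> y \<in> J \<Longrightarrow> x + y \<in> J"
    "\<And>a x. a \<in> A \<Longrightarrow> x \<in> J \<Longrightarrow> a * x \<in> J"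
    using assms by (auto simp: proper_ideal_def)
  show m: "- x \<in> J" if "x \<in> J" for x
    using *(5)[of "- 1" x] that by simp
  show "\<And>x y. x \<in> J \<Longrightarrow> y \<in> J \<Longrightarrow> x - y \<in> J"
    using *(4) m by fastforce
qed

text \<open>Otherwise \<open>j\<close> would be invertible. This keeps 1 away from \<open>J\<close>
  in norm, so no passage to a closed ideal is necessary before forming the quotient
  seminorm.\<close>

lemma proper_ideal_dist:
  assumes J: "proper_ideal J" and j: "j \<in> J"
  shows "1 \<le> N (1 - j)"
proof (rule ccontr)
  assume "\<not> ?thesis"
  then obtain b where "b \<in> A" "j * b = 1"
    using invertible_near_one[of j] proper_idealD(1)[OF J j] by auto
  then show False using proper_idealD(3,5)[OF J] j by (metis mult.commute)
qed

text \<open>The quotient seminorm \<open>r\<close> of \<open>J\<close> satisfies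
  \<open>r 1 \<ge> 1\<close>, so by \<open>Gelfand_Mazur\<close> some \<open>a - c l\<close> has no
  inverse modulo \<open>r\<close>-null elements. The ideal generated by \<open>J\<close> and
  \<open>a - c l\<close> then cannot contain 1, because elements of \<open>J\<close> are
  \<open>r\<close>-null.\<close>

lemma proper_ideal_extend:
  assumes J: "proper_ideal J" and a: "a \<in> A"
  shows "\<exists>K l. proper_ideal K \<and> J \<subseteq> K \<and> a - c l \<in> K"
proof -
  note JD = proper_idealD[OF J]
  define r where "r x = (INF j\<in>J. N (x + j))" for x
  have ne: "J \<noteq> {}" using JD(2) by auto
  have bdd: "bdd_below ((\<lambda>j. N (x + j)) ` J)" if "x \<in> A" for x
    using that JD(1) by (intro bdd_belowI[of _ 0]) auto
  have r_le: "r x \<le> N (x + j)" if "x \<in> A" "j \<in> J" for x j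
    unfolding r_def using that bdd by (intro cINF_lower) auto
  have r_approx: "\<exists>j\<in>J. N (x + j) < r x + e" if "x \<in> A" "e > 0" for x e
    using cINF_less_iff[OF ne bdd[OF that(1)], of "r x + e"] that by (auto simp: r_def)
  have r0: "0 \<le> r x" if "x \<in> A" for x
    unfolding r_def using that JD(1) ne by (intro cINF_greatest) auto
  interpret q: algebra_seminorm A c r
  proof
    fix x y assume xy: "x \<in> A" "y \<in> A"
    show "r (x + y) \<le> r x + r y"
    proof (rule field_le_epsilon)
      fix e :: real assume e: "e > 0"
      obtain i j where ij: "i \<in> J" "N (x + i) < r x + e/2" "j \<in> J" "N (y + j) < r y + e/2"
        using r_approx[OF xy(1), of "e/2"] r_approx[OF xy(2), of "e/2"] e by auto
      have "r (x + y) \<le> N ((x + y) + (i + j))" using xy ij JD by (intro r_le) auto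
      also have "(x + y) + (i + j) = (x + i) + (y + j)" by (simp add: algebra_simps)
      also have "N \<dots> \<le> N (x + i) + N (y + j)" using xy ij JD by (intro N_triangle) auto
      finally show "r (x + y) \<le> r x + r y + e" using ij by simp
    qed
    show "r (x * y) \<le> r x * r y"
    proof (rule tendsto_lowerbound)
      have "((\<lambda>e. (r x + e) * (r y + e)) \<longlongrightarrow> (r x + 0) * (r y + 0)) (at_right 0)"
        by (intro tendsto_intros)
      then show "((\<lambda>e. (r x + e) * (r y + e)) \<longlongrightarrow> r x * r y) (at_right 0)" by simp
      show "eventually (\<lambda>e. r (x * y) \<le> (r x + e) * (r y + e)) (at_right 0)"
        using eventually_at_right_less[of 0]
      proof eventually_elim
        case (elim e)
        obtain i j where ij: "i \<in> J" "N (x + i) < r x + e" "j \<in> J" "N (y + j) < r y + e"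
          using r_approx[OF xy(1) elim] r_approx[OF xy(2) elim] by auto
        \<comment> \<open>The correction in \<open>J\<close> that turns \<open>x * y\<close> into
          \<open>(x + i) * (y + j)\<close>.\<close>
        have "x * j + (y + j) * i \<in> J" using xy ij JD by auto
        then have "r (x * y) \<le> N (x * y + (x * j + (y + j) * i))" using xy by (intro r_le) auto
        also have "x * y + (x * j + (y + j) * i) = (x + i) * (y + j)" by (simp add: algebra_simps)
        also have "N \<dots> \<le> N (x + i) * N (y + j)" using xy ij JD by (intro N_mult) auto
        also have "\<dots> \<le> (r x + e) * (r y + e)"
          using ij xy r0 JD elim by (intro mult_mono) (auto intro: less_imp_le add_nonneg_nonneg)
        finally show ?case .
      qed
    qed simp
    show "r (c k * x) \<le> cmod k * r x" for k
    proof (rule tendsto_lowerbound)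
      have "((\<lambda>e. cmod k * (r x + e)) \<longlongrightarrow> cmod k * (r x + 0)) (at_right 0)"
        by (intro tendsto_intros)
      then show "((\<lambda>e. cmod k * (r x + e)) \<longlongrightarrow> cmod k * r x) (at_right 0)" by simp
      show "eventually (\<lambda>e. r (c k * x) \<le> cmod k * (r x + e)) (at_right 0)"
        using eventually_at_right_less[of 0]
      proof eventually_elim
        case (elim e)
        obtain i where i: "i \<in> J" "N (x + i) < r x + e" using r_approx[OF xy(1) elim] by auto
        have "r (c k * x) \<le> N (c k * x + c k * i)" using i JD xy by (intro r_le) auto
        also have "c k * x + c k * i = c k * (x + i)" by (simp add: algebra_simps)
        also have "N \<dots> \<le> cmod k * N (x + i)" using i JD xy by (intro N_scale_le) auto
        also have "\<dots> \<le> cmod k * (r x + e)" using i by (intro mult_left_mono) auto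
        finally show ?case .
      qed
    qed simp
  qed (use r0 in auto)
  have rJ: "r j = 0" if "j \<in> J" for j
    using r_le[of j "- j"] r0[of j] JD that by (intro antisym) auto
  have "1 \<le> r 1" unfolding r_def
  proof (intro cINF_greatest ne)
    fix j assume "j \<in> J"
    then show "1 \<le> N (1 + j)" using proper_ideal_dist[OF J, of "- j"] JD(6) by simp
  qed
  then obtain l where l: "\<And>b. b \<in> A \<Longrightarrow> r ((a - c l) * b - 1) \<noteq> 0"
    using q.Gelfand_Mazur[OF a] by (metis not_one_le_zero)
  define K where "K = {j + (a - c l) * b | j b. j \<in> J \<and> b \<in> A}"
  have KI: "j + (a - c l) * b \<in> K" if "j \<in> J" "b \<in> A" for j b using that by (auto simp: K_def)
  have "proper_ideal K" unfolding proper_ideal_def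
  proof (intro conjI ballI)
    show "K \<subseteq> A" using JD a by (auto simp: K_def)
    show "0 \<in> K" using KI[OF JD(2) zero_in] by simp
    show "1 \<notin> K"
    proof
      assume "1 \<in> K"
      then obtain j b where jb: "1 = j + (a - c l) * b" "j \<in> J" "b \<in> A" by (auto simp: K_def)
      then have "(a - c l) * b - 1 = - j" by (simp add: algebra_simps)
      then show False using l[OF jb(3)] rJ JD(6) jb by simp
    qed
    fix x assume "x \<in> K"
    then obtain j b where x: "x = j + (a - c l) * b" "j \<in> J" "b \<in> A" by (auto simp: K_def)
    show "d * x \<in> K" if "d \<in> A" for d
    proof -
      have "d * x = d * j + (a - c l) * (d * b)" by (simp add: x algebra_simps)
      then show ?thesis using KI[of "d * j" "d * b"] JD(5)[OF that x(2)] x(3) that by simp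
    qed
    fix y assume "y \<in> K"
    then obtain i d where y: "y = i + (a - c l) * d" "i \<in> J" "d \<in> A" by (auto simp: K_def)
    have "x + y = (j + i) + (a - c l) * (b + d)" by (simp add: x y algebra_simps)
    then show "x + y \<in> K" using KI[of "j + i" "b + d"] JD(4) x(2,3) y(2,3) by simp
  qed
  moreover have "J \<subseteq> K"
  proof
    fix j assume "j \<in> J"
    then show "j \<in> K" using KI[of j 0] by simp
  qed
  moreover have "a - c l \<in> K"
    using KI[OF JD(2) one_in] by simp
  ultimately show ?thesis by blast
qed

text \<open>When the algebra is generated by the sequence \<open>z\<close>, this replaces the existence of a maximal
  ideal containing \<open>x\<close>.\<close>

lemma proper_ideal_sequence:
  assumes x: "x \<in> A" "\<And>b. b \<in> A \<Longrightarrow> x * b \<noteq> 1" and z: "\<And>n::nat. z n \<in> A"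
  shows "\<exists>J l. proper_ideal J \<and> x \<in> J \<and> (\<forall>n. z n - c (l n) \<in> J)"
proof -
  define J0 where "J0 = {x * b | b. b \<in> A}"
  have J0: "proper_ideal J0"
    unfolding proper_ideal_def
  proof (intro conjI ballI)
    show "J0 \<subseteq> A" using x by (auto simp: J0_def)
    show "0 \<in> J0" unfolding J0_def by (intro CollectI exI[of _ 0]) simp
    show "1 \<notin> J0"
    proof
      assume "1 \<in> J0"
      then obtain b where "1 = x * b" "b \<in> A" by (auto simp: J0_def)
      then show False using x(2)[of b] by simp
    qed
    fix u assume "u \<in> J0"
    then obtain b where u: "u = x * b" "b \<in> A" by (auto simp: J0_def)
    show "d * u \<in> J0" if "d \<in> A" for d
      unfolding J0_def using u that by (intro CollectI exI[of _ "d * b"]) (simp add: mult.left_commute)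
    fix v assume "v \<in> J0"
    then obtain d where v: "v = x * d" "d \<in> A" by (auto simp: J0_def)
    have "u + v = x * (b + d)" by (simp add: u v distrib_left)
    then show "u + v \<in> J0" unfolding J0_def using u(2) v(2) by (intro CollectI exI[of _ "b + d"]) simp
  qed
  have xJ0: "x \<in> J0" unfolding J0_def by (intro CollectI exI[of _ 1]) simp
  \<comment> \<open>Adjoining the \<open>z n\<close> one at a time gives an increasing chain; its
    union is proper because 1 lies in no member.\<close>
  have "\<exists>K. \<forall>n::nat. (proper_ideal (K n) \<and> J0 \<subseteq> K n) \<and> (K n \<subseteq> K (Suc n) \<and> (\<exists>l. z n - c l \<in> K (Suc n)))"
  proof (rule dependent_nat_choice)
    show "\<exists>K. proper_ideal K \<and> J0 \<subseteq> K" using J0 by blast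
    fix K n assume "proper_ideal K \<and> J0 \<subseteq> K"
    then show "\<exists>K'. (proper_ideal K' \<and> J0 \<subseteq> K') \<and> (K \<subseteq> K' \<and> (\<exists>l. z n - c l \<in> K'))"
      using proper_ideal_extend[of K "z n"] z by (meson dual_order.trans)
  qed
  then obtain K where K: "\<And>n. proper_ideal (K n)" "\<And>n. J0 \<subseteq> K n" "\<And>n::nat. K n \<subseteq> K (Suc n)"
    "\<And>n. \<exists>l. z n - c l \<in> K (Suc n)" by blast
  have mono: "K m \<subseteq> K n" if "m \<le> n" for m n using K(3) that by (rule lift_Suc_mono_le)
  define J where "J = (\<Union>n. K n)"
  have "proper_ideal J" unfolding proper_ideal_def
  proof (intro conjI ballI)
    show "J \<subseteq> A" "0 \<in> J" "1 \<notin> J" using proper_idealD(1-3)[OF K(1)] by (auto simp: J_def)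
    fix u assume "u \<in> J"
    then obtain m where m: "u \<in> K m" by (auto simp: J_def)
    show "d * u \<in> J" if "d \<in> A" for d
      using m that proper_idealD(5)[OF K(1)] by (auto simp: J_def)
    fix v assume "v \<in> J"
    then obtain n where n: "v \<in> K n" by (auto simp: J_def)
    have "u \<in> K (max m n)" "v \<in> K (max m n)" using m n mono[of m "max m n"] mono[of n "max m n"] by auto
    then show "u + v \<in> J" using proper_idealD(4)[OF K(1)] by (auto simp: J_def)
  qed
  moreover have "x \<in> J" using xJ0 K(2) by (auto simp: J_def)
  moreover have "\<exists>l. \<forall>n. z n - c (l n) \<in> J" using K(4) unfolding J_def by (metis UN_I UNIV_I)
  ultimately show ?thesis by blast
qed

end

section \<open>Renorming by the operator norm\<close>

text \<open>Hoelder's inequality makes the given norm submultiplicative only up to a constant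
  \<open>K\<close>.\<close>

locale quasi_banach_algebra = complex_subalgebra A c
  for A :: "'a::comm_ring_1 set" and c +
  fixes M :: "'a \<Rightarrow> real" and K :: real
  assumes M_nonneg: "x \<in> A \<Longrightarrow> 0 \<le> M x"
    and M_definite: "x \<in> A \<Longrightarrow> M x = 0 \<Longrightarrow> x = 0"
    and M_triangle: "x \<in> A \<Longrightarrow> y \<in> A \<Longrightarrow> M (x + y) \<le> M x + M y"
    and M_mult: "x \<in> A \<Longrightarrow> y \<in> A \<Longrightarrow> M (x * y) \<le> K * M x * M y"
    and M_scale: "x \<in> A \<Longrightarrow> M (c k * x) = cmod k * M x"
    and M_one: "M 1 = 1"
    and M_complete: "(\<And>n::nat. F n \<in> A) \<Longrightarrow>
      (\<And>e. e > 0 \<Longrightarrow> \<exists>m0. \<forall>m\<ge>m0. \<forall>n\<ge>m0. M (F m - F n) < e) \<Longrightarrow>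
      \<exists>f\<in>A. (\<lambda>n. M (F n - f)) \<longlonglongrightarrow> 0"
begin

text \<open>The norm of multiplication by \<open>x\<close> as an operator on the space normed by
  \<open>M\<close>. It is submultiplicative with constant 1, gives the unit norm 1, and lies between
  \<open>M\<close> and \<open>K * M\<close>.\<close>

definition opnorm :: "'a \<Rightarrow> real" where
  "opnorm x = (SUP y\<in>{y\<in>A. M y \<le> 1}. M (x * y))"

lemma K_pos: "K > 0"
proof -
  have "1 \<le> K" using M_mult[of 1 1] M_one by simp
  then show ?thesis by simp
qed

lemma bdd_above_opnorm: assumes "x \<in> A" shows "bdd_above ((\<lambda>y. M (x * y)) ` {y\<in>A. M y \<le> 1})"
proof (intro bdd_aboveI2)
  fix y assume "y \<in> {y\<in>A. M y \<le> 1}"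
  then have y: "y \<in> A" "M y \<le> 1" by auto
  have "M (x * y) \<le> K * M x * M y" using assms y by (intro M_mult)
  also have "\<dots> \<le> K * M x * 1" using assms y K_pos M_nonneg by (intro mult_left_mono) auto
  finally show "M (x * y) \<le> K * M x" by simp
qed

lemma ball_nonempty: "{y\<in>A. M y \<le> 1} \<noteq> {}"
  using M_one by (auto intro!: exI[of _ 1])

lemma opnorm_upper: "x \<in> A \<Longrightarrow> y \<in> A \<Longrightarrow> M y \<le> 1 \<Longrightarrow> M (x * y) \<le> opnorm x"
  unfolding opnorm_def by (intro cSUP_upper bdd_above_opnorm) auto

lemma opnorm_least: "(\<And>y. y \<in> A \<Longrightarrow> M y \<le> 1 \<Longrightarrow> M (x * y) \<le> B) \<Longrightarrow> opnorm x \<le> B"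
  unfolding opnorm_def using ball_nonempty by (intro cSUP_least) auto

lemma M_le_opnorm: "x \<in> A \<Longrightarrow> M x \<le> opnorm x"
  using opnorm_upper[of x 1] M_one by simp

lemma opnorm_nonneg: "x \<in> A \<Longrightarrow> 0 \<le> opnorm x"
  using M_le_opnorm[of x] M_nonneg[of x] by simp

lemma opnorm_le: assumes "x \<in> A" shows "opnorm x \<le> K * M x"
proof (rule opnorm_least)
  fix y assume y: "y \<in> A" "M y \<le> 1"
  have "M (x * y) \<le> K * M x * M y" using assms y by (intro M_mult)
  also have "\<dots> \<le> K * M x * 1" using assms y K_pos M_nonneg by (intro mult_left_mono) auto
  finally show "M (x * y) \<le> K * M x" by simp
qed

lemma opnorm_bound: assumes "x \<in> A" "y \<in> A" shows "M (x * y) \<le> opnorm x * M y"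
proof (cases "M y = 0")
  case True
  then show ?thesis using M_definite[of y] assms M_scale[of 1 0] M_one by simp
next
  case False
  then have My: "M y > 0" using M_nonneg[OF assms(2)] by simp
  define k :: complex where "k = of_real (1 / M y)"
  have k: "cmod k = 1 / M y" using My by (simp add: k_def norm_divide)
  have "M (x * (c k * y)) \<le> opnorm x"
    using assms My by (intro opnorm_upper) (auto simp: M_scale k)
  also have "x * (c k * y) = c k * (x * y)" by (simp add: mult_ac)
  finally have "1 / M y * M (x * y) \<le> opnorm x" using assms by (simp only: M_scale k mult_in)
  then show ?thesis using My by (simp add: field_simps)
qed

lemma banach_algebra_opnorm: "banach_algebra A c opnorm"
proof
  fix x y :: 'a assume xy: "x \<in> A" "y \<in> A"
  show "opnorm (x + y) \<le> opnorm x + opnorm y"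
  proof (rule opnorm_least)
    fix u assume u: "u \<in> A" "M u \<le> 1"
    have "M (x * u + y * u) \<le> M (x * u) + M (y * u)" using u xy by (intro M_triangle) auto
    also have "\<dots> \<le> opnorm x + opnorm y" using u xy by (intro add_mono opnorm_upper)
    finally show "M ((x + y) * u) \<le> opnorm x + opnorm y" by (simp add: distrib_right)
  qed
  show "opnorm (x * y) \<le> opnorm x * opnorm y"
  proof (rule opnorm_least)
    fix u assume u: "u \<in> A" "M u \<le> 1"
    have "M (x * (y * u)) \<le> opnorm x * M (y * u)" using u xy by (intro opnorm_bound) auto
    also have "\<dots> \<le> opnorm x * opnorm y"
      using u xy opnorm_nonneg by (intro mult_left_mono opnorm_upper) auto
    finally show "M (x * y * u) \<le> opnorm x * opnorm y" by (simp add: mult.assoc)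
  qed
next
  fix x k assume x: "x \<in> A"
  show "opnorm (c k * x) \<le> cmod k * opnorm x"
  proof (rule opnorm_least)
    fix u assume u: "u \<in> A" "M u \<le> 1"
    have "M (c k * x * u) = cmod k * M (x * u)" using x u by (simp add: M_scale mult.assoc)
    also have "\<dots> \<le> cmod k * opnorm x" using x u by (intro mult_left_mono opnorm_upper) auto
    finally show "M (c k * x * u) \<le> cmod k * opnorm x" .
  qed
  show "0 \<le> opnorm x" using x by (rule opnorm_nonneg)
  show "x = 0" if "opnorm x = 0"
    using M_le_opnorm[OF x] M_nonneg[OF x] M_definite[OF x] that by simp
next
  show "opnorm 1 = 1"
    using M_le_opnorm[of 1] by (intro antisym opnorm_least) (auto simp: M_one)
next
  fix F :: "nat \<Rightarrow> 'a"
  assume F: "\<And>n. F n \<in> A" and C: "\<And>e. e > 0 \<Longrightarrow> \<exists>m0. \<forall>m\<ge>m0. \<forall>n\<ge>m0. opnorm (F m - F n) < e"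
  have "\<exists>f\<in>A. (\<lambda>n. M (F n - f)) \<longlonglongrightarrow> 0"
  proof (rule M_complete[OF F])
    fix e :: real assume "e > 0"
    then obtain m0 where "\<forall>m\<ge>m0. \<forall>n\<ge>m0. opnorm (F m - F n) < e" using C by blast
    then show "\<exists>m0. \<forall>m\<ge>m0. \<forall>n\<ge>m0. M (F m - F n) < e"
      using M_le_opnorm[OF diff_in[OF F F]] by (meson le_less_trans)
  qed
  then obtain f where f: "f \<in> A" "(\<lambda>n. M (F n - f)) \<longlonglongrightarrow> 0" by blast
  have lim: "(\<lambda>n. K * M (F n - f)) \<longlonglongrightarrow> 0"
    using tendsto_mult[OF tendsto_const[of K] f(2)] by simp
  have "(\<lambda>n. opnorm (F n - f)) \<longlonglongrightarrow> 0"
  proof (rule tendsto_sandwich[OF _ _ tendsto_const lim])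
    show "eventually (\<lambda>n. 0 \<le> opnorm (F n - f)) sequentially"
      using F f by (intro always_eventually allI opnorm_nonneg) auto
    show "eventually (\<lambda>n. opnorm (F n - f) \<le> K * M (F n - f)) sequentially"
      using F f by (intro always_eventually allI opnorm_le) auto
  qed
  then show "\<exists>f\<in>A. (\<lambda>n. opnorm (F n - f)) \<longlonglongrightarrow> 0" using f by blast
qed

end

section \<open>Multi-indices\<close>

abbreviation lookup :: "multiindex \<Rightarrow> nat \<Rightarrow> nat" where
  "lookup \<equiv> Poly_Mapping.lookup"

abbreviation keys :: "multiindex \<Rightarrow> nat set" where
  "keys \<equiv> Poly_Mapping.keys"

definition unit_index :: "nat \<Rightarrow> multiindex" where
  "unit_index k = Poly_Mapping.single k 1"

lemma lookup_unit: "lookup (unit_index k) j = (if j = k then 1 else 0)"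
  by (simp add: unit_index_def lookup_single)

lemma keys_unit [simp]: "keys (unit_index k) = {k}"
  by (simp add: unit_index_def)

lemma unit_index_inj [simp]: "unit_index j = unit_index k \<longleftrightarrow> j = k"
  by (metis keys_unit singleton_inject)

lemma mdeg_superset:
  assumes "finite K" "keys \<alpha> \<subseteq> K"
  shows "mdeg \<alpha> = (\<Sum>j\<in>K. lookup \<alpha> j)"
  unfolding mdeg_def using assms by (intro sum.mono_neutral_left) (auto simp: in_keys_iff)

lemma mfact_superset:
  assumes "finite K" "keys \<alpha> \<subseteq> K"
  shows "mfact \<alpha> = (\<Prod>j\<in>K. fact (lookup \<alpha> j))"
  unfolding mfact_def using assms by (intro prod.mono_neutral_left) (auto simp: in_keys_iff)

lemma monomial_at_superset:
  assumes "finite K" "keys \<alpha> \<subseteq> K"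
  shows "monomial_at z \<alpha> = (\<Prod>j\<in>K. z j ^ lookup \<alpha> j)"
  unfolding monomial_at_def using assms by (intro prod.mono_neutral_left) (auto simp: in_keys_iff)

lemma mdeg_add [simp]: "mdeg (\<alpha> + \<beta>) = mdeg \<alpha> + mdeg \<beta>"
proof -
  have "mdeg (\<alpha> + \<beta>) = (\<Sum>j\<in>keys \<alpha> \<union> keys \<beta>. lookup (\<alpha> + \<beta>) j)"
    using keys_add[of \<alpha> \<beta>] by (intro mdeg_superset) auto
  then show ?thesis
    by (simp add: lookup_add sum.distrib flip: mdeg_superset)
qed

lemma monomial_at_add: "monomial_at z (\<alpha> + \<beta>) = monomial_at z \<alpha> * monomial_at z \<beta>"
proof -
  have "monomial_at z (\<alpha> + \<beta>) = (\<Prod>j\<in>keys \<alpha> \<union> keys \<beta>. z j ^ lookup (\<alpha> + \<beta>) j)"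
    using keys_add[of \<alpha> \<beta>] by (intro monomial_at_superset) auto
  then show ?thesis
    by (simp add: lookup_add power_add prod.distrib flip: monomial_at_superset)
qed

lemma mdeg_0 [simp]: "mdeg 0 = 0"
  by (simp add: mdeg_def)

lemma mdeg_eq_0_iff [simp]: "mdeg \<alpha> = 0 \<longleftrightarrow> \<alpha> = 0"
proof
  assume "mdeg \<alpha> = 0"
  then have "lookup \<alpha> j = 0" for j by (cases "j \<in> keys \<alpha>") (auto simp: mdeg_def in_keys_iff)
  then show "\<alpha> = 0" by (intro poly_mapping_eqI) simp
qed simp

lemma mdeg_unit [simp]: "mdeg (unit_index k) = 1"
  by (simp add: mdeg_def lookup_unit)

lemma mfact_0 [simp]: "mfact 0 = 1"
  by (simp add: mfact_def)

lemma monomial_at_0 [simp]: "monomial_at z 0 = 1"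
  by (simp add: monomial_at_def)

lemma monomial_at_unit [simp]: "monomial_at z (unit_index k) = z k"
  by (simp add: monomial_at_def lookup_unit)

lemma mfact_pos [simp]: "mfact \<alpha> > 0"
  unfolding mfact_def by (intro prod_pos) auto

lemma mfact_add_unit: "mfact (\<alpha> + unit_index k) = real (Suc (lookup \<alpha> k)) * mfact \<alpha>"
proof -
  let ?K = "insert k (keys \<alpha>)"
  have "mfact (\<alpha> + unit_index k) = (\<Prod>j\<in>?K. fact (lookup (\<alpha> + unit_index k) j))"
    using keys_add[of \<alpha> "unit_index k"] by (intro mfact_superset) auto
  also have "\<dots> = (\<Prod>j\<in>?K. (if j = k then real (Suc (lookup \<alpha> k)) else 1) * fact (lookup \<alpha> j))"
    by (intro prod.cong refl) (auto simp: lookup_add lookup_unit)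
  also have "\<dots> = real (Suc (lookup \<alpha> k)) * mfact \<alpha>"
    by (subst prod.distrib) (simp add: prod.delta mfact_superset[of ?K \<alpha>] subset_insertI)
  finally show ?thesis .
qed

lemma diff_unit_add: "k \<in> keys \<gamma> \<Longrightarrow> \<gamma> - unit_index k + unit_index k = \<gamma>"
  by (rule poly_mapping_eqI) (auto simp: lookup_add minus_poly_mapping.rep_eq lookup_unit in_keys_iff)

lemma add_unit_diff: "\<alpha> + unit_index k - unit_index k = \<alpha>"
  by simp

lemma degree_one: assumes "mdeg \<alpha> = 1" shows "\<exists>k. \<alpha> = unit_index k"
proof -
  have "keys \<alpha> \<noteq> {}" using assms by auto
  then obtain k where "k \<in> keys \<alpha>" by blast
  then have *: "\<alpha> - unit_index k + unit_index k = \<alpha>" by (rule diff_unit_add)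
  then have "mdeg (\<alpha> - unit_index k) = 0" using assms by (metis add_right_cancel add_0 mdeg_add mdeg_unit)
  then have "\<alpha> - unit_index k = 0" by (simp only: mdeg_eq_0_iff)
  then show ?thesis using * by (metis add_0)
qed

definition antidiag :: "multiindex \<Rightarrow> (multiindex \<times> multiindex) set" where
  "antidiag \<gamma> = {(\<alpha>, \<beta>). \<alpha> + \<beta> = \<gamma>}"

lemma in_antidiag [simp]: "(\<alpha>, \<beta>) \<in> antidiag \<gamma> \<longleftrightarrow> \<alpha> + \<beta> = \<gamma>"
  by (simp add: antidiag_def)

text \<open>The first components are dominated by \<open>\<gamma>\<close>, hence determined by their
  restriction to the finite set \<open>keys \<gamma>\<close>, where they take finitely many values;
  the second component follows by cancellation.\<close>

lemma finite_antidiag [simp]: "finite (antidiag \<gamma>)"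
proof -
  define D where "D = fst ` antidiag \<gamma>"
  have le: "lookup \<alpha> j \<le> lookup \<gamma> j" if "\<alpha> \<in> D" for \<alpha> j
    using that by (auto simp: D_def antidiag_def lookup_add)
  have "inj_on (\<lambda>\<alpha>. restrict (lookup \<alpha>) (keys \<gamma>)) D"
  proof (rule inj_onI)
    fix \<alpha> \<beta> assume ab: "\<alpha> \<in> D" "\<beta> \<in> D" and eq: "restrict (lookup \<alpha>) (keys \<gamma>) = restrict (lookup \<beta>) (keys \<gamma>)"
    show "\<alpha> = \<beta>"
    proof (rule poly_mapping_eqI)
      fix j show "lookup \<alpha> j = lookup \<beta> j"
      proof (cases "j \<in> keys \<gamma>")
        case True
        then show ?thesis using fun_cong[OF eq, of j] by simp
      next
        case False
        then show ?thesis using le[OF ab(1), of j] le[OF ab(2), of j] by (simp add: in_keys_iff)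
      qed
    qed
  qed
  moreover have "(\<lambda>\<alpha>. restrict (lookup \<alpha>) (keys \<gamma>)) ` D \<subseteq> PiE (keys \<gamma>) (\<lambda>j. {..lookup \<gamma> j})"
    using le by auto
  ultimately have "finite D"
    by (meson finite_PiE finite_atMost finite_keys finite_imageD finite_subset)
  moreover have "inj_on fst (antidiag \<gamma>)" by (auto simp: inj_on_def antidiag_def)
  ultimately show ?thesis unfolding D_def by (rule finite_imageD)
qed

lemma sum_antidiag_swap:
  "(\<Sum>(\<alpha>, \<beta>)\<in>antidiag \<gamma>. f \<alpha> \<beta>) = (\<Sum>(\<alpha>, \<beta>)\<in>antidiag \<gamma>. f \<beta> \<alpha>)"
  by (rule sum.reindex_bij_witness[of _ prod.swap prod.swap]) (auto simp: antidiag_def add.commute)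

text \<open>Both sides sum over the triples with
  \<open>\<alpha> + \<beta> + \<epsilon> = \<gamma>\<close>; this is associativity of
  convolution.\<close>

lemma sum_antidiag_assoc:
  "(\<Sum>(\<delta>, \<epsilon>)\<in>antidiag \<gamma>. \<Sum>(\<alpha>, \<beta>)\<in>antidiag \<delta>. f \<alpha> \<beta> \<epsilon>) =
   (\<Sum>(\<alpha>, \<delta>)\<in>antidiag \<gamma>. \<Sum>(\<beta>, \<epsilon>)\<in>antidiag \<delta>. f \<alpha> \<beta> \<epsilon>)"
proof -
  have "(\<Sum>(\<delta>, \<epsilon>)\<in>antidiag \<gamma>. \<Sum>(\<alpha>, \<beta>)\<in>antidiag \<delta>. f \<alpha> \<beta> \<epsilon>) =
    (\<Sum>((\<delta>, \<epsilon>), \<alpha>, \<beta>)\<in>Sigma (antidiag \<gamma>) (\<lambda>(\<delta>, \<epsilon>). antidiag \<delta>). f \<alpha> \<beta> \<epsilon>)"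
    by (subst sum.Sigma[symmetric]) (auto simp: split_beta)
  also have "\<dots> = (\<Sum>((\<alpha>, \<delta>), \<beta>, \<epsilon>)\<in>Sigma (antidiag \<gamma>) (\<lambda>(\<alpha>, \<delta>). antidiag \<delta>). f \<alpha> \<beta> \<epsilon>)"
    by (rule sum.reindex_bij_witness[of _ "\<lambda>((\<alpha>, \<delta>), \<beta>, \<epsilon>). ((\<alpha> + \<beta>, \<epsilon>), \<alpha>, \<beta>)"
        "\<lambda>((\<delta>, \<epsilon>), \<alpha>, \<beta>). ((\<alpha>, \<beta> + \<epsilon>), \<beta>, \<epsilon>)"]) (auto simp: add.assoc)
  also have "\<dots> = (\<Sum>(\<alpha>, \<delta>)\<in>antidiag \<gamma>. \<Sum>(\<beta>, \<epsilon>)\<in>antidiag \<delta>. f \<alpha> \<beta> \<epsilon>)"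
    by (subst sum.Sigma[symmetric]) (auto simp: split_beta)
  finally show ?thesis .
qed

text \<open>Convolution with a family supported at one index \<open>\<delta>\<close> is a shift; it
  serves the unit, the constants and the monomials.\<close>

lemma sum_antidiag_single:
  assumes "\<And>\<alpha>. \<alpha> \<noteq> \<delta> \<Longrightarrow> f \<alpha> = 0"
  shows "(\<Sum>(\<alpha>, \<beta>)\<in>antidiag \<gamma>. f \<alpha> * g \<beta>) =
    (if \<exists>\<beta>. \<delta> + \<beta> = \<gamma> then f \<delta> * g (\<gamma> - \<delta>) else (0::'a::semiring_0))"
proof (cases "\<exists>\<beta>. \<delta> + \<beta> = \<gamma>")
  case True
  then obtain \<beta> where b: "\<delta> + \<beta> = \<gamma>" by blast
  have "(\<Sum>(\<alpha>, \<beta>)\<in>antidiag \<gamma>. f \<alpha> * g \<beta>) = (\<Sum>(\<alpha>, \<beta>)\<in>{(\<delta>, \<beta>)}. f \<alpha> * g \<beta>)"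
  proof (rule sum.mono_neutral_right)
    show "\<forall>i\<in>antidiag \<gamma> - {(\<delta>, \<beta>)}. (case i of (\<alpha>, \<beta>) \<Rightarrow> f \<alpha> * g \<beta>) = 0"
    proof safe
      fix a d assume ad: "(a, d) \<in> antidiag \<gamma>" "f a * g d \<noteq> 0"
      then show a: "a = \<delta>" using assms by force
      show "d = \<beta>" using ad(1) b a by auto
    qed
  qed (use b in auto)
  then show ?thesis using b True by auto
next
  case False
  have "f a * g d = 0" if "a + d = \<gamma>" for a d
  proof -
    have "a \<noteq> \<delta>" using that False by blast
    then show ?thesis using assms by simp
  qed
  then have "(\<Sum>(\<alpha>, \<beta>)\<in>antidiag \<gamma>. f \<alpha> * g \<beta>) = 0" by (intro sum.neutral) auto
  then show ?thesis using False by simp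
qed

section \<open>The convolution ring of coefficient families\<close>

text \<open>A copy of the full function type, so that convolution can be its ring multiplication.
  Antidiagonals are finite, so the product needs no convergence.\<close>

typedef mser = "UNIV :: (multiindex \<Rightarrow> complex) set"
  morphisms cf Ser ..

setup_lifting type_definition_mser

lemma cf_Ser [simp]: "cf (Ser x) = x"
  by (simp add: Ser_inverse)

lemma mser_eqI: "(\<And>\<alpha>. cf x \<alpha> = cf y \<alpha>) \<Longrightarrow> x = y"
  by (metis cf_inject ext)

instantiation mser :: comm_ring_1
begin

lift_definition zero_mser :: mser is "\<lambda>_. 0" .
lift_definition one_mser :: mser is "\<lambda>\<alpha>. if \<alpha> = 0 then 1 else 0" .
lift_definition plus_mser :: "mser \<Rightarrow> mser \<Rightarrow> mser" is "\<lambda>x y \<alpha>. x \<alpha> + y \<alpha>" .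
lift_definition minus_mser :: "mser \<Rightarrow> mser \<Rightarrow> mser" is "\<lambda>x y \<alpha>. x \<alpha> - y \<alpha>" .
lift_definition uminus_mser :: "mser \<Rightarrow> mser" is "\<lambda>x \<alpha>. - x \<alpha>" .
lift_definition times_mser :: "mser \<Rightarrow> mser \<Rightarrow> mser" is
  "\<lambda>x y \<gamma>. \<Sum>(\<alpha>, \<beta>)\<in>antidiag \<gamma>. x \<alpha> * y \<beta>" .

instance
proof
  fix a b c :: mser
  show "a * b * c = a * (b * c)"
  proof (transfer, intro ext)
    fix a b c :: "multiindex \<Rightarrow> complex" and \<gamma>
    have "(\<Sum>(\<delta>, \<epsilon>)\<in>antidiag \<gamma>. (\<Sum>(\<alpha>, \<beta>)\<in>antidiag \<delta>. a \<alpha> * b \<beta>) * c \<epsilon>) =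
      (\<Sum>(\<delta>, \<epsilon>)\<in>antidiag \<gamma>. \<Sum>(\<alpha>, \<beta>)\<in>antidiag \<delta>. a \<alpha> * (b \<beta> * c \<epsilon>))"
      by (simp add: sum_distrib_right split_beta mult.assoc)
    also have "\<dots> = (\<Sum>(\<alpha>, \<delta>)\<in>antidiag \<gamma>. \<Sum>(\<beta>, \<epsilon>)\<in>antidiag \<delta>. a \<alpha> * (b \<beta> * c \<epsilon>))"
      by (rule sum_antidiag_assoc)
    also have "\<dots> = (\<Sum>(\<alpha>, \<delta>)\<in>antidiag \<gamma>. a \<alpha> * (\<Sum>(\<beta>, \<epsilon>)\<in>antidiag \<delta>. b \<beta> * c \<epsilon>))"
      by (simp add: sum_distrib_left split_beta)
    finally show "(\<Sum>(\<delta>, \<epsilon>)\<in>antidiag \<gamma>. (\<Sum>(\<alpha>, \<beta>)\<in>antidiag \<delta>. a \<alpha> * b \<beta>) * c \<epsilon>) =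
      (\<Sum>(\<alpha>, \<delta>)\<in>antidiag \<gamma>. a \<alpha> * (\<Sum>(\<beta>, \<epsilon>)\<in>antidiag \<delta>. b \<beta> * c \<epsilon>))" .
  qed
  show "a * b = b * a"
    by (transfer, intro ext, subst sum_antidiag_swap) (simp add: mult.commute)
  show "1 * a = a"
    by (transfer, intro ext, subst sum_antidiag_single[of 0]) auto
  show "(a + b) * c = a * c + b * c"
    by (transfer, intro ext) (simp add: distrib_right sum.distrib split_beta)
  show "(0::mser) \<noteq> 1"
    by transfer (metis zero_neq_one)
qed (transfer; auto simp: algebra_simps)+

end

lemma cf_0 [simp]: "cf 0 \<alpha> = 0" by transfer simp
lemma cf_1: "cf 1 \<alpha> = (if \<alpha> = 0 then 1 else 0)" by transfer simp
lemma cf_add [simp]: "cf (x + y) \<alpha> = cf x \<alpha> + cf y \<alpha>" by transfer simp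
lemma cf_diff [simp]: "cf (x - y) \<alpha> = cf x \<alpha> - cf y \<alpha>" by transfer simp
lemma cf_mult: "cf (x * y) \<gamma> = (\<Sum>(\<alpha>, \<beta>)\<in>antidiag \<gamma>. cf x \<alpha> * cf y \<beta>)" by transfer simp

lemma cf_sum [simp]: "cf (sum f S) \<alpha> = (\<Sum>i\<in>S. cf (f i) \<alpha>)"
  by (induction S rule: infinite_finite_induct) auto

lemma norm_cf_mult_le: "cmod (cf (x * y) \<gamma>) \<le> (\<Sum>(\<alpha>, \<beta>)\<in>antidiag \<gamma>. cmod (cf x \<alpha>) * cmod (cf y \<beta>))"
  unfolding cf_mult using norm_sum[of "\<lambda>(\<alpha>, \<beta>). cf x \<alpha> * cf y \<beta>" "antidiag \<gamma>"]
  by (simp add: split_beta norm_mult)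

lift_definition const :: "complex \<Rightarrow> mser" is "\<lambda>k \<alpha>. if \<alpha> = 0 then k else 0" .

lemma cf_const: "cf (const k) \<alpha> = (if \<alpha> = 0 then k else 0)" by transfer simp

lemma cf_const_mult [simp]: "cf (const k * x) \<alpha> = k * cf x \<alpha>"
  unfolding cf_mult by (subst sum_antidiag_single[of 0]) (auto simp: cf_const)

lemma const_add: "const (k + l) = const k + const l"
  by (rule mser_eqI) (simp add: cf_const)

lemma const_mult: "const (k * l) = const k * const l"
  by (rule mser_eqI) (simp add: cf_const)

lemma const_1 [simp]: "const 1 = 1"
  by (rule mser_eqI) (simp add: cf_const cf_1)

definition monom :: "multiindex \<Rightarrow> mser" where
  "monom \<alpha> = Ser (\<lambda>\<beta>. if \<beta> = \<alpha> then 1 else 0)"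

lemma cf_monom: "cf (monom \<alpha>) \<beta> = (if \<beta> = \<alpha> then 1 else 0)"
  by (simp add: monom_def)

lemma monom_0 [simp]: "monom 0 = 1"
  by (rule mser_eqI) (simp add: cf_monom cf_1)

lemma monom_mult: "monom \<alpha> * monom \<beta> = monom (\<alpha> + \<beta>)"
proof (rule mser_eqI)
  fix \<gamma>
  show "cf (monom \<alpha> * monom \<beta>) \<gamma> = cf (monom (\<alpha> + \<beta>)) \<gamma>"
    unfolding cf_mult by (subst sum_antidiag_single[of \<alpha>]) (auto simp: cf_monom)
qed

text \<open>The linear form \<open>\<Sum>\<^sub>k b\<^sub>k \<zeta>\<^sub>k\<close>.\<close>

lift_definition lin :: "(nat \<Rightarrow> complex) \<Rightarrow> mser" is
  "\<lambda>b \<alpha>. if mdeg \<alpha> = 1 then monomial_at b \<alpha> else 0" .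

lemma cf_lin: "cf (lin b) \<alpha> = (if mdeg \<alpha> = 1 then monomial_at b \<alpha> else 0)" by transfer simp

lemma cf_lin_unit [simp]: "cf (lin b) (unit_index k) = b k"
  by (simp add: cf_lin)

text \<open>A pair in \<open>antidiag \<gamma>\<close> whose first entry has degree 1 is
  \<open>(unit_index k, \<gamma> - unit_index k)\<close> with \<open>k\<close> in
  \<open>keys \<gamma>\<close>.\<close>

lemma cf_lin_mult: "cf (lin b * x) \<gamma> = (\<Sum>k\<in>keys \<gamma>. b k * cf x (\<gamma> - unit_index k))"
proof -
  have inj: "inj_on (\<lambda>k. (unit_index k, \<gamma> - unit_index k)) (keys \<gamma>)"
    by (auto simp: inj_on_def)
  have "cf (lin b * x) \<gamma> = (\<Sum>(\<alpha>, \<beta>)\<in>(\<lambda>k. (unit_index k, \<gamma> - unit_index k)) ` keys \<gamma>. cf (lin b) \<alpha> * cf x \<beta>)"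
    unfolding cf_mult
  proof (rule sum.mono_neutral_right)
    show "(\<lambda>k. (unit_index k, \<gamma> - unit_index k)) ` keys \<gamma> \<subseteq> antidiag \<gamma>"
      using diff_unit_add by (auto simp: add.commute)
    show "\<forall>i\<in>antidiag \<gamma> - (\<lambda>k. (unit_index k, \<gamma> - unit_index k)) ` keys \<gamma>.
      (case i of (\<alpha>, \<beta>) \<Rightarrow> cf (lin b) \<alpha> * cf x \<beta>) = 0"
    proof safe
      fix \<alpha> \<beta> assume g: "(\<alpha>, \<beta>) \<in> antidiag \<gamma>" "(\<alpha>, \<beta>) \<notin> (\<lambda>k. (unit_index k, \<gamma> - unit_index k)) ` keys \<gamma>"
      have "mdeg \<alpha> \<noteq> 1"
      proof
        assume "mdeg \<alpha> = 1"
        then obtain k where k: "\<alpha> = unit_index k" using degree_one by blast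
        have "k \<in> keys \<gamma>" using g(1) k by (auto simp: in_keys_iff lookup_add lookup_unit)
        moreover have "\<beta> = \<gamma> - unit_index k" using g(1) k by auto
        ultimately show False using g(2) k by auto
      qed
      then show "cf (lin b) \<alpha> * cf x \<beta> = 0" by (simp add: cf_lin)
    qed
  qed simp
  also have "\<dots> = (\<Sum>k\<in>keys \<gamma>. b k * cf x (\<gamma> - unit_index k))"
    by (subst sum.reindex[OF inj]) simp
  finally show ?thesis .
qed

text \<open>The reciprocal of the quotient in \<open>weight\<close>; it is at least 1 and is a
  coefficient of a power of a linear form.\<close>

definition multinomial :: "multiindex \<Rightarrow> real" where
  "multinomial \<alpha> = fact (mdeg \<alpha>) / mfact \<alpha>"

lemma multinomial_pos [simp]: "multinomial \<alpha> > 0"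
  by (simp add: multinomial_def)

lemma multinomial_0 [simp]: "multinomial 0 = 1"
  by (simp add: multinomial_def)

text \<open>The multinomial theorem. In the induction step the index \<open>k\<close> contributes a
  common factor times \<open>lookup \<gamma> k\<close>, and these exponents add up to the
  degree.\<close>

lemma cf_lin_power:
  "cf (lin b ^ n) \<alpha> = (if mdeg \<alpha> = n then of_real (multinomial \<alpha>) * monomial_at b \<alpha> else 0)"
proof (induction n arbitrary: \<alpha>)
  case 0
  then show ?case by (auto simp: cf_1)
next
  case (Suc n \<gamma>)
  have "cf (lin b ^ Suc n) \<gamma> = (\<Sum>k\<in>keys \<gamma>. b k * cf (lin b ^ n) (\<gamma> - unit_index k))"
    by (simp add: cf_lin_mult)
  also have "\<dots> = (\<Sum>k\<in>keys \<gamma>. if mdeg \<gamma> = Suc n then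
    of_real (fact n / mfact \<gamma>) * monomial_at b \<gamma> * of_nat (lookup \<gamma> k) else 0)"
  proof (intro sum.cong refl)
    fix k assume "k \<in> keys \<gamma>"
    then obtain \<beta> where \<beta>: "\<gamma> = \<beta> + unit_index k" using diff_unit_add by metis
    show "b k * cf (lin b ^ n) (\<gamma> - unit_index k) = (if mdeg \<gamma> = Suc n then
      of_real (fact n / mfact \<gamma>) * monomial_at b \<gamma> * of_nat (lookup \<gamma> k) else 0)"
      unfolding \<beta> add_unit_diff Suc mdeg_add mdeg_unit mfact_add_unit monomial_at_add
      by (simp add: multinomial_def lookup_add lookup_unit field_simps del: of_nat_Suc)
  qed
  also have "\<dots> = (if mdeg \<gamma> = Suc n then
    of_real (fact n / mfact \<gamma>) * monomial_at b \<gamma> * of_nat (mdeg \<gamma>) else 0)"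
  proof -
    have *: "(\<Sum>k\<in>keys \<gamma>. C * of_nat (lookup \<gamma> k)) = C * of_nat (mdeg \<gamma>)" for C :: complex
      by (simp add: mdeg_def sum_distrib_left)
    show ?thesis
    proof (cases "mdeg \<gamma> = Suc n")
      case True
      show ?thesis unfolding if_P[OF True] by (rule *)
    qed simp
  qed
  also have "\<dots> = (if mdeg \<gamma> = Suc n then of_real (multinomial \<gamma>) * monomial_at b \<gamma> else 0)"
    by (simp add: multinomial_def)
  finally show ?case .
qed

text \<open>Compare the coefficients in \<open>l ^ k * l ^ (n - k) = l ^ n\<close>, where
  \<open>l\<close> is the sum of all variables.\<close>

lemma Vandermonde:
  assumes "k \<le> mdeg \<gamma>"
  shows "(\<Sum>(\<alpha>, \<beta>)\<in>antidiag \<gamma>. if mdeg \<alpha> = k then multinomial \<alpha> * multinomial \<beta> else 0) = multinomial \<gamma>"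
proof -
  have one: "monomial_at (\<lambda>_. 1) \<alpha> = 1" for \<alpha> by (simp add: monomial_at_def)
  define l where "l = lin (\<lambda>_. 1)"
  define n where "n = mdeg \<gamma>"
  have "l ^ k * l ^ (n - k) = l ^ n" using assms by (simp add: n_def flip: power_add)
  then have "cf (l ^ k * l ^ (n - k)) \<gamma> = of_real (multinomial \<gamma>)"
    by (simp add: l_def cf_lin_power one n_def)
  also have "cf (l ^ k * l ^ (n - k)) \<gamma> =
    of_real (\<Sum>(\<alpha>, \<beta>)\<in>antidiag \<gamma>. if mdeg \<alpha> = k then multinomial \<alpha> * multinomial \<beta> else 0)"
    unfolding cf_mult of_real_sum
    by (intro sum.cong refl) (auto simp: l_def cf_lin_power one n_def)
  finally show ?thesis by (simp only: of_real_eq_iff)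
qed

text \<open>The left side is one term of the nonnegative Vandermonde sum.\<close>

lemma multinomial_mult_le: "multinomial \<alpha> * multinomial \<beta> \<le> multinomial (\<alpha> + \<beta>)"
proof -
  have "(case (\<alpha>, \<beta>) of (a, b) \<Rightarrow> if mdeg a = mdeg \<alpha> then multinomial a * multinomial b else 0)
    \<le> (\<Sum>(a, b)\<in>antidiag (\<alpha> + \<beta>). if mdeg a = mdeg \<alpha> then multinomial a * multinomial b else 0)"
  proof (rule member_le_sum)
    show "0 \<le> (case p of (a, b) \<Rightarrow> if mdeg a = mdeg \<alpha> then multinomial a * multinomial b else 0)" for p
      by (cases p) (simp add: less_imp_le)
  qed auto
  then show ?thesis using Vandermonde[of "mdeg \<alpha>" "\<alpha> + \<beta>"] by simp
qed

lemma multinomial_ge_1: "multinomial \<alpha> \<ge> 1"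
proof (induction "mdeg \<alpha>" arbitrary: \<alpha>)
  case 0
  then have "\<alpha> = 0" by (metis mdeg_eq_0_iff)
  then show ?case by simp
next
  case (Suc n)
  then have "keys \<alpha> \<noteq> {}" by auto
  then obtain k where "k \<in> keys \<alpha>" by blast
  then obtain \<beta> where \<beta>: "\<alpha> = \<beta> + unit_index k" using diff_unit_add by metis
  have "1 \<le> multinomial \<beta>" using Suc \<beta> by simp
  also have "\<dots> = multinomial \<beta> * multinomial (unit_index k)" by (simp add: multinomial_def mfact_def lookup_unit)
  also have "\<dots> \<le> multinomial \<alpha>" unfolding \<beta> by (rule multinomial_mult_le)
  finally show ?case .
qed

lemma multinomial_mono: "multinomial \<alpha> \<le> multinomial (\<alpha> + \<beta>)"
proof -
  have "multinomial \<alpha> * 1 \<le> multinomial \<alpha> * multinomial \<beta>"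
    by (rule mult_left_mono[OF multinomial_ge_1 less_imp_le[OF multinomial_pos]])
  then show ?thesis using multinomial_mult_le[of \<alpha> \<beta>] by linarith
qed

section \<open>Summation over antidiagonals\<close>

text \<open>Every pair lies on exactly one antidiagonal, so a sum over pairs may be grouped by
  \<open>\<alpha> + \<beta>\<close>.\<close>

lemma cauchy_product_aux:
  fixes f :: "multiindex \<times> multiindex \<Rightarrow> 'a::{topological_comm_monoid_add,t3_space}"
  assumes "(f has_sum S) (UNIV \<times> UNIV)"
  shows "((\<lambda>\<gamma>. sum f (antidiag \<gamma>)) has_sum S) UNIV"
proof (rule has_sum_SigmaD)
  show "((\<lambda>(\<gamma>, p). f p) has_sum S) (Sigma UNIV antidiag)"
    using assms by (subst has_sum_reindex_bij_witness[of _ "\<lambda>(\<alpha>, \<beta>). (\<alpha> + \<beta>, \<alpha>, \<beta>)" snd "UNIV \<times> UNIV" f]) auto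
  fix \<gamma> show "((\<lambda>p. case (\<gamma>, p) of (\<gamma>, p) \<Rightarrow> f p) has_sum sum f (antidiag \<gamma>)) (antidiag \<gamma>)"
    by (simp add: has_sum_finite)
qed

lemma cauchy_product:
  fixes A B :: "multiindex \<Rightarrow> 'a::{real_normed_field,banach,second_countable_topology}"
  assumes A: "(\<lambda>\<alpha>. norm (A \<alpha>)) summable_on UNIV" and B: "(\<lambda>\<alpha>. norm (B \<alpha>)) summable_on UNIV"
  shows "((\<lambda>\<gamma>. \<Sum>(\<alpha>, \<beta>)\<in>antidiag \<gamma>. A \<alpha> * B \<beta>) has_sum (infsum A UNIV * infsum B UNIV)) UNIV"
    and "((\<lambda>\<gamma>. \<Sum>(\<alpha>, \<beta>)\<in>antidiag \<gamma>. norm (A \<alpha>) * norm (B \<beta>)) has_sum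
      (infsum (\<lambda>\<alpha>. norm (A \<alpha>)) UNIV * infsum (\<lambda>\<alpha>. norm (B \<alpha>)) UNIV)) UNIV"
proof -
  have abs: "(\<lambda>p. norm (case p of (\<alpha>, \<beta>) \<Rightarrow> A \<alpha> * B \<beta>)) summable_on UNIV \<times> UNIV"
    by (rule iffD2[OF Infinite_Sum.abs_summable_on_Sigma_iff[where A = UNIV and B = "\<lambda>_. UNIV" and f = "\<lambda>(\<alpha>, \<beta>). A \<alpha> * B \<beta>"]])
      (use A B in \<open>auto simp: norm_mult infsum_cmult_right' abs_mult infsum_nonneg intro: summable_on_cmult_right summable_on_cmult_left\<close>)
  have "infsum (\<lambda>(\<alpha>, \<beta>). A \<alpha> * B \<beta>) (UNIV \<times> UNIV) = (\<Sum>\<^sub>\<infinity>\<alpha>. \<Sum>\<^sub>\<infinity>\<beta>. A \<alpha> * B \<beta>)"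
    using infsum_Sigma'_banach[OF abs_summable_summable[OF abs]] by simp
  also have "\<dots> = infsum A UNIV * infsum B UNIV"
    using A B by (simp add: infsum_cmult_right infsum_cmult_left abs_summable_summable)
  finally have "((\<lambda>(\<alpha>, \<beta>). A \<alpha> * B \<beta>) has_sum (infsum A UNIV * infsum B UNIV)) (UNIV \<times> UNIV)"
    using abs_summable_summable[OF abs] by (metis has_sum_infsum)
  from cauchy_product_aux[OF this]
  show "((\<lambda>\<gamma>. \<Sum>(\<alpha>, \<beta>)\<in>antidiag \<gamma>. A \<alpha> * B \<beta>) has_sum (infsum A UNIV * infsum B UNIV)) UNIV" .
  have abs': "(\<lambda>(\<alpha>, \<beta>). norm (A \<alpha>) * norm (B \<beta>)) summable_on UNIV \<times> UNIV"
    using abs by (simp add: case_prod_unfold norm_mult)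
  have "infsum (\<lambda>(\<alpha>, \<beta>). norm (A \<alpha>) * norm (B \<beta>)) (UNIV \<times> UNIV) = (\<Sum>\<^sub>\<infinity>\<alpha>. \<Sum>\<^sub>\<infinity>\<beta>. norm (A \<alpha>) * norm (B \<beta>))"
    using infsum_Sigma'_banach[OF abs'] by simp
  also have "\<dots> = infsum (\<lambda>\<alpha>. norm (A \<alpha>)) UNIV * infsum (\<lambda>\<alpha>. norm (B \<alpha>)) UNIV"
    using A B by (simp add: infsum_cmult_right infsum_cmult_left)
  finally have "((\<lambda>(\<alpha>, \<beta>). norm (A \<alpha>) * norm (B \<beta>)) has_sum
    (infsum (\<lambda>\<alpha>. norm (A \<alpha>)) UNIV * infsum (\<lambda>\<alpha>. norm (B \<alpha>)) UNIV)) (UNIV \<times> UNIV)"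
    using abs' by (metis has_sum_infsum)
  from cauchy_product_aux[OF this]
  show "((\<lambda>\<gamma>. \<Sum>(\<alpha>, \<beta>)\<in>antidiag \<gamma>. norm (A \<alpha>) * norm (B \<beta>)) has_sum
      (infsum (\<lambda>\<alpha>. norm (A \<alpha>)) UNIV * infsum (\<lambda>\<alpha>. norm (B \<alpha>)) UNIV)) UNIV" .
qed

text \<open>The common last step of the product estimates below: after Hoelder's inequality on each
  antidiagonal, a convolution of two summable families remains.\<close>

lemma convolution_bound:
  fixes A B v :: "multiindex \<Rightarrow> real"
  assumes A: "A summable_on UNIV" "\<And>\<alpha>. 0 \<le> A \<alpha>" and B: "B summable_on UNIV" "\<And>\<alpha>. 0 \<le> B \<alpha>"
    and v: "\<And>\<gamma>. 0 \<le> v \<gamma>" "\<And>\<gamma>. v \<gamma> \<le> K * (\<Sum>(\<alpha>, \<beta>)\<in>antidiag \<gamma>. A \<alpha> * B \<beta>)"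
  shows "v summable_on UNIV" "infsum v UNIV \<le> K * (infsum A UNIV * infsum B UNIV)"
proof -
  have "((\<lambda>\<gamma>. \<Sum>(\<alpha>, \<beta>)\<in>antidiag \<gamma>. A \<alpha> * B \<beta>) has_sum (infsum A UNIV * infsum B UNIV)) UNIV"
    using cauchy_product(1)[of A B] A B by simp
  then have hs: "((\<lambda>\<gamma>. K * (\<Sum>(\<alpha>, \<beta>)\<in>antidiag \<gamma>. A \<alpha> * B \<beta>)) has_sum (K * (infsum A UNIV * infsum B UNIV))) UNIV"
    by (rule has_sum_cmult_right)
  then show 1: "v summable_on UNIV"
    using v by (intro summable_on_comparison_test[OF has_sum_imp_summable[OF hs]]) auto
  show "infsum v UNIV \<le> K * (infsum A UNIV * infsum B UNIV)"
    using has_sum_mono[OF has_sum_infsum[OF 1] hs] v by auto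
qed

section \<open>Weighted sequence spaces\<close>

lemma Holder_sum:
  fixes a b :: "'i \<Rightarrow> real"
  assumes pq: "p > 1" "q > 1" "1 / p + 1 / q = 1"
    and nn: "\<And>i. i \<in> I \<Longrightarrow> 0 \<le> a i" "\<And>i. i \<in> I \<Longrightarrow> 0 \<le> b i" and "finite I"
  shows "(\<Sum>i\<in>I. a i * b i) \<le> (\<Sum>i\<in>I. a i powr p) powr (1 / p) * (\<Sum>i\<in>I. b i powr q) powr (1 / q)"
proof -
  define S where "S = (\<Sum>i\<in>I. a i powr p)"
  define T where "T = (\<Sum>i\<in>I. b i powr q)"
  show ?thesis
  proof (cases "S = 0 \<or> T = 0")
    case True
    then have "(\<forall>i\<in>I. a i = 0) \<or> (\<forall>i\<in>I. b i = 0)"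
      unfolding S_def T_def using \<open>finite I\<close> by (simp add: sum_nonneg_eq_0_iff)
    then have "(\<Sum>i\<in>I. a i * b i) = 0" by (auto intro!: sum.neutral)
    then show ?thesis by simp
  next
    case False
    then have ST: "S > 0" "T > 0" unfolding S_def T_def by (simp_all add: sum_nonneg less_le)
    define A where "A = S powr (1 / p)"
    define B where "B = T powr (1 / q)"
    have AB: "A > 0" "B > 0" "A powr p = S" "B powr q = T"
      using ST pq by (auto simp: A_def B_def powr_powr)
    have "(\<Sum>i\<in>I. (a i / A) * (b i / B)) \<le> (\<Sum>i\<in>I. (a i / A) powr p / p + (b i / B) powr q / q)"
      using AB nn by (intro sum_mono Youngs_inequality pq) auto
    also have "\<dots> = (\<Sum>i\<in>I. a i powr p / S / p + b i powr q / T / q)"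
      using AB nn by (intro sum.cong refl) (auto simp: powr_divide)
    also have "\<dots> = S / S / p + T / T / q"
      by (simp add: sum.distrib S_def T_def flip: sum_divide_distrib)
    also have "\<dots> = 1" using ST pq by simp
    finally have "(\<Sum>i\<in>I. a i * b i) / (A * B) \<le> 1"
      by (simp add: sum_divide_distrib)
    then show ?thesis using AB by (simp add: A_def B_def S_def T_def field_simps)
  qed
qed

text \<open>Hoelder's inequality raised to the power \<open>p\<close>, with
  \<open>p / q = p - 1\<close>; the factor \<open>b\<close> enters only through a bound that will be
  uniform over all antidiagonals.\<close>

lemma Holder_sum_powr:
  fixes a b :: "'i \<Rightarrow> real"
  assumes pq: "p > 1" "q > 1" "1 / p + 1 / q = 1"
    and nn: "\<And>i. i \<in> I \<Longrightarrow> 0 \<le> a i" "\<And>i. i \<in> I \<Longrightarrow> 0 \<le> b i" and "finite I"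
    and b: "(\<Sum>i\<in>I. b i powr q) \<le> K"
  shows "(\<Sum>i\<in>I. a i * b i) powr p \<le> K powr (p - 1) * (\<Sum>i\<in>I. a i powr p)"
proof -
  have pe: "p / q = p - 1" using pq by (simp add: field_simps)
  have "(\<Sum>i\<in>I. a i * b i) powr p \<le>
    ((\<Sum>i\<in>I. a i powr p) powr (1 / p) * (\<Sum>i\<in>I. b i powr q) powr (1 / q)) powr p"
    using pq nn by (intro powr_mono2 Holder_sum sum_nonneg \<open>finite I\<close>) auto
  also have "\<dots> = (\<Sum>i\<in>I. a i powr p) * (\<Sum>i\<in>I. b i powr q) powr (p - 1)"
    using pq pe by (simp add: powr_mult powr_powr sum_nonneg)
  also have "\<dots> \<le> (\<Sum>i\<in>I. a i powr p) * K powr (p - 1)"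
    using b pq by (intro mult_left_mono powr_mono2 sum_nonneg) auto
  finally show ?thesis by (simp add: mult.commute)
qed

text \<open>When \<open>u\<close> or \<open>v\<close> is 0, the inequality reduces to
  \<open>m powr p \<le> m\<close> on the unit interval; otherwise it is
  \<open>powr_convex\<close>.\<close>

lemma powr_convex_nonneg:
  fixes p u v :: real
  assumes p: "p \<ge> 1" and "0 \<le> u" "0 \<le> v" "0 \<le> l" "0 \<le> m" "l + m = 1"
  shows "(l * u + m * v) powr p \<le> l * u powr p + m * v powr p"
proof -
  have one: "(m * v) powr p \<le> m * v powr p" if "0 \<le> m" "m \<le> 1" "0 \<le> v" for m v :: real
  proof -
    have "m powr p \<le> m" using powr_mono'[of 1 p m] that p by simp
    then show ?thesis using that by (auto simp: powr_mult intro: mult_right_mono)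
  qed
  show ?thesis
  proof (cases "u = 0 \<or> v = 0")
    case True
    then show ?thesis using one[of l u] one[of m v] assms by auto
  next
    case False
    then show ?thesis using powr_convex[OF p] assms unfolding convex_on_def by auto
  qed
qed

definition trunc_coeffs :: "multiindex set \<Rightarrow> mser \<Rightarrow> mser" where
  "trunc_coeffs S x = Ser (\<lambda>\<alpha>. if \<alpha> \<in> S then cf x \<alpha> else 0)"

lemma cf_trunc_coeffs [simp]: "cf (trunc_coeffs S x) \<alpha> = (if \<alpha> \<in> S then cf x \<alpha> else 0)"
  by (simp add: trunc_coeffs_def)

text \<open>Finite exponents only; the space for \<open>p = \<infinity>\<close> is
  \<open>X_inf\<close> below.\<close>

locale weighted_space =
  fixes p :: real and w :: "multiindex \<Rightarrow> real"
  assumes p_ge_1: "p \<ge> 1" and w_pos: "w \<alpha> > 0"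
begin

definition X :: "mser set" where
  "X = {x. (\<lambda>\<alpha>. (cmod (cf x \<alpha>) * w \<alpha>) powr p) summable_on UNIV}"

definition nrm :: "mser \<Rightarrow> real" where
  "nrm x = (\<Sum>\<^sub>\<infinity>\<alpha>. (cmod (cf x \<alpha>) * w \<alpha>) powr p) powr (1 / p)"

lemma w_nonneg [simp]: "0 \<le> w \<alpha>"
  using w_pos[of \<alpha>] by simp

lemma p_pos: "p > 0"
  using p_ge_1 by simp

lemma nrm_nonneg [simp]: "0 \<le> nrm x"
  by (simp add: nrm_def)

lemma nrm_powr: "nrm x powr p = (\<Sum>\<^sub>\<infinity>\<alpha>. (cmod (cf x \<alpha>) * w \<alpha>) powr p)"
  using p_pos by (simp add: nrm_def powr_powr infsum_nonneg)

lemma X_I: "(\<lambda>\<alpha>. (cmod (cf x \<alpha>) * w \<alpha>) powr p) summable_on UNIV \<Longrightarrow> x \<in> X"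
  by (simp add: X_def)

lemma X_D: "x \<in> X \<Longrightarrow> (\<lambda>\<alpha>. (cmod (cf x \<alpha>) * w \<alpha>) powr p) summable_on UNIV"
  by (simp add: X_def)

lemma nrm_leI:
  assumes "\<And>S. finite S \<Longrightarrow> (\<Sum>\<alpha>\<in>S. (cmod (cf x \<alpha>) * w \<alpha>) powr p) \<le> B powr p" "0 \<le> B"
  shows "x \<in> X" "nrm x \<le> B"
proof -
  show X: "x \<in> X"
    using assms(1) by (intro X_I nonneg_bdd_above_summable_on) (auto intro!: bdd_aboveI2)
  have "nrm x powr p \<le> B powr p"
    unfolding nrm_powr by (rule infsum_le_finite_sums[OF X_D[OF X]]) (use assms in auto)
  then show "nrm x \<le> B" using p_pos assms(2) powr_less_mono2[of p B "nrm x"] by fastforce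
qed

lemma finite_sum_le_nrm: "x \<in> X \<Longrightarrow> finite S \<Longrightarrow> (\<Sum>\<alpha>\<in>S. (cmod (cf x \<alpha>) * w \<alpha>) powr p) \<le> nrm x powr p"
  unfolding nrm_powr by (intro finite_sum_le_infsum X_D) auto

lemma cf_le_nrm: assumes "x \<in> X" shows "cmod (cf x \<alpha>) * w \<alpha> \<le> nrm x"
proof -
  have "(cmod (cf x \<alpha>) * w \<alpha>) powr p \<le> nrm x powr p"
    using finite_sum_le_nrm[OF assms, of "{\<alpha>}"] by simp
  then show ?thesis using p_pos powr_less_mono2[of p "nrm x" "cmod (cf x \<alpha>) * w \<alpha>"] by fastforce
qed

lemma X_mono:
  assumes "y \<in> X" "\<And>\<alpha>. cmod (cf x \<alpha>) \<le> cmod (cf y \<alpha>)"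
  shows "x \<in> X" "nrm x \<le> nrm y"
proof -
  have "(\<Sum>\<alpha>\<in>S. (cmod (cf x \<alpha>) * w \<alpha>) powr p) \<le> nrm y powr p" if "finite S" for S
  proof -
    have "(\<Sum>\<alpha>\<in>S. (cmod (cf x \<alpha>) * w \<alpha>) powr p) \<le> (\<Sum>\<alpha>\<in>S. (cmod (cf y \<alpha>) * w \<alpha>) powr p)"
      using assms(2) p_pos by (intro sum_mono powr_mono2 mult_right_mono) auto
    also have "\<dots> \<le> nrm y powr p" by (rule finite_sum_le_nrm[OF assms(1) that])
    finally show ?thesis .
  qed
  from nrm_leI[OF this] show "x \<in> X" "nrm x \<le> nrm y" by auto
qed

lemma nrm_definite: assumes "x \<in> X" "nrm x = 0" shows "x = 0"
proof (rule mser_eqI)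
  fix \<alpha>
  have "cmod (cf x \<alpha>) * w \<alpha> \<le> 0" using cf_le_nrm[OF assms(1)] assms(2) by simp
  then show "cf x \<alpha> = cf 0 \<alpha>" using w_pos[of \<alpha>] by (simp add: mult_le_0_iff)
qed

lemma nrm_scale: "x \<in> X \<Longrightarrow> const k * x \<in> X" "nrm (const k * x) = cmod k * nrm x"
proof -
  have eq: "(\<lambda>\<alpha>. (cmod (cf (const k * x) \<alpha>) * w \<alpha>) powr p) =
    (\<lambda>\<alpha>. cmod k powr p * (cmod (cf x \<alpha>) * w \<alpha>) powr p)" for x
    by (auto simp: norm_mult powr_mult mult.assoc)
  show "const k * x \<in> X" if "x \<in> X"
    unfolding X_def mem_Collect_eq eq using X_D[OF that] by (rule summable_on_cmult_right)
  show "nrm (const k * x) = cmod k * nrm x"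
    unfolding nrm_def eq infsum_cmult_right' using p_pos by (simp add: powr_mult powr_powr infsum_nonneg)
qed

text \<open>Minkowski's inequality by convexity: \<open>x + y\<close> is
  \<open>nrm x + nrm y\<close> times a convex combination of the normalized \<open>x\<close> and
  \<open>y\<close>.\<close>

lemma nrm_triangle:
  assumes "x \<in> X" "y \<in> X"
  shows "x + y \<in> X" "nrm (x + y) \<le> nrm x + nrm y"
proof -
  have "(\<Sum>\<alpha>\<in>S. (cmod (cf (x + y) \<alpha>) * w \<alpha>) powr p) \<le> (nrm x + nrm y) powr p" if S: "finite S" for S
  proof (cases "nrm x = 0 \<or> nrm y = 0")
    case True
    then have "x = 0 \<or> y = 0" using nrm_definite assms by blast
    then show ?thesis
    proof
      assume x: "x = 0"
      have "(\<Sum>\<alpha>\<in>S. (cmod (cf y \<alpha>) * w \<alpha>) powr p) \<le> nrm y powr p" by (rule finite_sum_le_nrm[OF assms(2) S])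
      also have "\<dots> \<le> (nrm x + nrm y) powr p" using p_pos by (intro powr_mono2) auto
      finally show ?thesis using x by simp
    next
      assume y: "y = 0"
      have "(\<Sum>\<alpha>\<in>S. (cmod (cf x \<alpha>) * w \<alpha>) powr p) \<le> nrm x powr p" by (rule finite_sum_le_nrm[OF assms(1) S])
      also have "\<dots> \<le> (nrm x + nrm y) powr p" using p_pos by (intro powr_mono2) auto
      finally show ?thesis using y by simp
    qed
  next
    case False
    define F where "F = nrm x"
    define G where "G = nrm y"
    have FG: "F > 0" "G > 0" using False by (auto simp: F_def G_def less_le)
    define l where "l = F / (F + G)"
    define m where "m = G / (F + G)"
    have lm: "0 \<le> l" "0 \<le> m" "l + m = 1" using FG by (auto simp: l_def m_def simp flip: add_divide_distrib)
    have le: "(cmod (cf (x + y) \<alpha>) * w \<alpha>) powr p \<le> (F + G) powr p *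
      (l * ((cmod (cf x \<alpha>) * w \<alpha>) powr p / F powr p) + m * ((cmod (cf y \<alpha>) * w \<alpha>) powr p / G powr p))" for \<alpha>
    proof -
      define a where "a = cmod (cf x \<alpha>) * w \<alpha>"
      define b where "b = cmod (cf y \<alpha>) * w \<alpha>"
      have ab: "a \<ge> 0" "b \<ge> 0" by (auto simp: a_def b_def)
      have "cmod (cf (x + y) \<alpha>) * w \<alpha> \<le> a + b"
        using mult_right_mono[OF norm_triangle_ineq[of "cf x \<alpha>" "cf y \<alpha>"], of "w \<alpha>"]
        by (simp add: a_def b_def distrib_right)
      also have "a + b = (F + G) * (l * (a / F) + m * (b / G))"
      proof -
        have "(F + G) * l = F" "(F + G) * m = G" using FG by (auto simp: l_def m_def)
        then have "(F + G) * (l * (a / F) + m * (b / G)) = F * (a / F) + G * (b / G)"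
          by (simp only: distrib_left mult.assoc[symmetric])
        then show ?thesis using FG by simp
      qed
      finally have "(cmod (cf (x + y) \<alpha>) * w \<alpha>) powr p \<le> ((F + G) * (l * (a / F) + m * (b / G))) powr p"
        using p_pos by (intro powr_mono2) auto
      also have "\<dots> = (F + G) powr p * (l * (a / F) + m * (b / G)) powr p"
        using FG lm ab by (simp add: powr_mult)
      also have "\<dots> \<le> (F + G) powr p * (l * (a / F) powr p + m * (b / G) powr p)"
        using FG ab lm p_ge_1 by (intro mult_left_mono powr_convex_nonneg) auto
      finally show ?thesis using FG ab by (simp add: a_def b_def powr_divide)
    qed
    have "(\<Sum>\<alpha>\<in>S. (cmod (cf (x + y) \<alpha>) * w \<alpha>) powr p) \<le> (\<Sum>\<alpha>\<in>S. (F + G) powr p *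
      (l * ((cmod (cf x \<alpha>) * w \<alpha>) powr p / F powr p) + m * ((cmod (cf y \<alpha>) * w \<alpha>) powr p / G powr p)))"
      by (intro sum_mono le)
    also have "\<dots> = (F + G) powr p * (l * ((\<Sum>\<alpha>\<in>S. (cmod (cf x \<alpha>) * w \<alpha>) powr p) / F powr p) +
        m * ((\<Sum>\<alpha>\<in>S. (cmod (cf y \<alpha>) * w \<alpha>) powr p) / G powr p))"
      by (simp only: sum_distrib_left[symmetric] sum.distrib sum_divide_distrib[symmetric])
    also have "\<dots> \<le> (F + G) powr p * (l * (F powr p / F powr p) + m * (G powr p / G powr p))"
      using lm finite_sum_le_nrm[OF assms(1) S] finite_sum_le_nrm[OF assms(2) S]
      by (intro mult_left_mono add_mono divide_right_mono) (auto simp: F_def G_def)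
    also have "\<dots> = (F + G) powr p" using FG lm by simp
    finally show ?thesis by (simp add: F_def G_def)
  qed
  from nrm_leI[OF this] show "x + y \<in> X" "nrm (x + y) \<le> nrm x + nrm y" by auto
qed

lemma X_diff: "x \<in> X \<Longrightarrow> y \<in> X \<Longrightarrow> x - y \<in> X"
proof -
  assume "x \<in> X" "y \<in> X"
  then have "x + const (- 1) * y \<in> X" by (intro nrm_triangle nrm_scale)
  moreover have "x + const (- 1) * y = x - y" by (rule mser_eqI) simp
  ultimately show "x - y \<in> X" by simp
qed

text \<open>The limit is taken coefficientwise; Cauchy bounds pass to it because they are tested on
  finite sets of indices.\<close>

lemma X_complete:
  fixes F :: "nat \<Rightarrow> mser"
  assumes F: "\<And>n. F n \<in> X" and C: "\<And>e. e > 0 \<Longrightarrow> \<exists>m0. \<forall>m\<ge>m0. \<forall>n\<ge>m0. nrm (F m - F n) < e"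
  shows "\<exists>f\<in>X. (\<lambda>n. nrm (F n - f)) \<longlonglongrightarrow> 0"
proof -
  have "Cauchy (\<lambda>n. cf (F n) \<alpha>)" for \<alpha>
  proof (rule metric_CauchyI)
    fix e :: real assume "e > 0"
    then have "e * w \<alpha> > 0" using w_pos by simp
    then obtain m0 where m0: "\<forall>m\<ge>m0. \<forall>n\<ge>m0. nrm (F m - F n) < e * w \<alpha>" using C by blast
    have "dist (cf (F m) \<alpha>) (cf (F n) \<alpha>) < e" if "m \<ge> m0" "n \<ge> m0" for m n
    proof -
      have "cmod (cf (F m - F n) \<alpha>) * w \<alpha> < e * w \<alpha>"
        using cf_le_nrm[OF X_diff[OF F F], of m n \<alpha>] m0 that by fastforce
      then show ?thesis using w_pos[of \<alpha>] by (simp add: dist_norm)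
    qed
    then show "\<exists>M. \<forall>m\<ge>M. \<forall>n\<ge>M. dist (cf (F m) \<alpha>) (cf (F n) \<alpha>) < e" by blast
  qed
  then have "\<exists>l. (\<lambda>n. cf (F n) \<alpha>) \<longlonglongrightarrow> l" for \<alpha>
    using Cauchy_convergent convergent_def by blast
  then obtain l where l: "\<And>\<alpha>. (\<lambda>n. cf (F n) \<alpha>) \<longlonglongrightarrow> l \<alpha>" by metis
  define f where "f = Ser l"
  have lim: "F m - f \<in> X \<and> nrm (F m - f) \<le> e"
    if m: "\<forall>n\<ge>m0. nrm (F m - F n) < e" and e: "e > 0" for m m0 e
  proof -
    have "(\<Sum>\<alpha>\<in>S. (cmod (cf (F m - f) \<alpha>) * w \<alpha>) powr p) \<le> e powr p" if S: "finite S" for S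
    proof (rule LIMSEQ_le_const2)
      show "(\<lambda>n. \<Sum>\<alpha>\<in>S. (cmod (cf (F m - F n) \<alpha>) * w \<alpha>) powr p) \<longlonglongrightarrow>
        (\<Sum>\<alpha>\<in>S. (cmod (cf (F m - f) \<alpha>) * w \<alpha>) powr p)"
        unfolding cf_diff using l p_pos by (intro tendsto_intros) (auto simp: f_def)
      have "(\<Sum>\<alpha>\<in>S. (cmod (cf (F m - F n) \<alpha>) * w \<alpha>) powr p) \<le> e powr p" if "n \<ge> m0" for n
      proof -
        have "(\<Sum>\<alpha>\<in>S. (cmod (cf (F m - F n) \<alpha>) * w \<alpha>) powr p) \<le> nrm (F m - F n) powr p"
          by (intro finite_sum_le_nrm S X_diff F)
        also have "\<dots> \<le> e powr p" using m that p_pos by (intro powr_mono2) (auto intro: less_imp_le)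
        finally show ?thesis .
      qed
      then show "\<exists>N. \<forall>n\<ge>N. (\<Sum>\<alpha>\<in>S. (cmod (cf (F m - F n) \<alpha>) * w \<alpha>) powr p) \<le> e powr p" by blast
    qed
    from nrm_leI[OF this] e show ?thesis by auto
  qed
  have "f \<in> X"
  proof -
    obtain m0 where "\<forall>m\<ge>m0. \<forall>n\<ge>m0. nrm (F m - F n) < 1" using C[of 1] by auto
    then have "F m0 - f \<in> X" using lim[of m0 m0 1] by auto
    from X_diff[OF F[of m0] this] show ?thesis by simp
  qed
  moreover have "(\<lambda>n. nrm (F n - f)) \<longlonglongrightarrow> 0"
  proof (rule LIMSEQ_I)
    fix e :: real assume e: "e > 0"
    then obtain m0 where m0: "\<forall>m\<ge>m0. \<forall>n\<ge>m0. nrm (F m - F n) < e / 2" using C[of "e/2"] by auto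
    have "norm (nrm (F m - f) - 0) < e" if "m \<ge> m0" for m
    proof -
      have "nrm (F m - f) \<le> e / 2" using lim[of m0 m "e/2"] m0 that e by auto
      also have "\<dots> < e" using e by simp
      finally show ?thesis by simp
    qed
    then show "\<exists>N. \<forall>n\<ge>N. norm (nrm (F n - f) - 0) < e" by blast
  qed
  ultimately show ?thesis by blast
qed

text \<open>The error is the tail of a convergent sum; this is the density of polynomials in
  norm.\<close>

lemma trunc_approx:
  assumes x: "x \<in> X" and e: "e > 0"
  shows "\<exists>S. finite S \<and> x - trunc_coeffs S x \<in> X \<and> nrm (x - trunc_coeffs S x) \<le> e"
proof -
  let ?f = "\<lambda>\<alpha>. (cmod (cf x \<alpha>) * w \<alpha>) powr p"
  have ep: "e powr p > 0" using e by simp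
  then obtain S where S: "finite S" "dist (sum ?f S) (infsum ?f UNIV) \<le> e powr p"
    using infsum_finite_approximation[OF X_D[OF x] ep] by blast
  have "(\<Sum>\<alpha>\<in>T. (cmod (cf (x - trunc_coeffs S x) \<alpha>) * w \<alpha>) powr p) \<le> e powr p" if T: "finite T" for T
  proof -
    have "(\<Sum>\<alpha>\<in>T. (cmod (cf (x - trunc_coeffs S x) \<alpha>) * w \<alpha>) powr p) = (\<Sum>\<alpha>\<in>T. if \<alpha> \<in> S then 0 else ?f \<alpha>)"
      by (intro sum.cong refl) simp
    also have "\<dots> = sum ?f (T - S)"
      using T by (intro sum.mono_neutral_cong_right) auto
    also have "sum ?f (T - S) + sum ?f S = sum ?f (T \<union> S)"
      using T S by (subst sum.union_disjoint[symmetric]) auto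
    then have "sum ?f (T - S) = sum ?f (T \<union> S) - sum ?f S" by simp
    also have "sum ?f (T \<union> S) \<le> infsum ?f UNIV"
      using T S by (intro finite_sum_le_infsum X_D x) auto
    also have "infsum ?f UNIV - sum ?f S \<le> e powr p" using S(2) by (simp add: dist_real_def)
    finally show ?thesis by simp
  qed
  note * = nrm_leI[OF this less_imp_le[OF e]]
  show ?thesis by (intro exI[of _ S] conjI S(1) *)
qed

end

section \<open>The weighted spaces as Banach algebras\<close>

context weighted_space
begin

lemma finite_support_X:
  assumes "finite {\<alpha>. cf x \<alpha> \<noteq> 0}"
  shows "x \<in> X"
proof (rule X_I)
  have "(\<lambda>\<alpha>. (cmod (cf x \<alpha>) * w \<alpha>) powr p) summable_on {\<alpha>. cf x \<alpha> \<noteq> 0}"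
    using assms by (rule summable_on_finite)
  then show "(\<lambda>\<alpha>. (cmod (cf x \<alpha>) * w \<alpha>) powr p) summable_on UNIV"
    by (rule summable_on_cong_neutral[THEN iffD1, rotated -1]) auto
qed

lemma const_X: "const k \<in> X"
proof (rule finite_support_X)
  have "{\<alpha>. cf (const k) \<alpha> \<noteq> 0} \<subseteq> {0}" by (auto simp: cf_const)
  then show "finite {\<alpha>. cf (const k) \<alpha> \<noteq> 0}" by (rule finite_subset) simp
qed

lemma nrm_one: assumes "w 0 = 1" shows "nrm 1 = 1"
proof -
  have "(\<Sum>\<^sub>\<infinity>\<alpha>. (cmod (cf 1 \<alpha>) * w \<alpha>) powr p) = (\<Sum>\<^sub>\<infinity>\<alpha>\<in>{0}. (cmod (cf 1 \<alpha>) * w \<alpha>) powr p)"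
    by (rule infsum_cong_neutral) (auto simp: cf_1)
  then show ?thesis using assms by (simp add: nrm_def cf_1)
qed

lemma mult_X_aux:
  assumes x: "x \<in> X" and y: "y \<in> X" and K: "K \<ge> 0"
    and le: "\<And>\<gamma>. (cmod (cf (x * y) \<gamma>) * w \<gamma>) powr p \<le> K powr p *
      (\<Sum>(\<alpha>, \<beta>)\<in>antidiag \<gamma>. (cmod (cf x \<alpha>) * w \<alpha>) powr p * (cmod (cf y \<beta>) * w \<beta>) powr p)"
  shows "x * y \<in> X" "nrm (x * y) \<le> K * nrm x * nrm y"
proof -
  note cb = convolution_bound[OF X_D[OF x] powr_ge_zero X_D[OF y] powr_ge_zero powr_ge_zero le]
  show "x * y \<in> X" using cb(1) by (rule X_I)
  have "nrm (x * y) powr p \<le> K powr p * (nrm x powr p * nrm y powr p)"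
    unfolding nrm_powr by (rule cb(2))
  also have "\<dots> = (K * nrm x * nrm y) powr p" using K by (simp add: powr_mult)
  finally show "nrm (x * y) \<le> K * nrm x * nrm y"
    using p_pos K powr_less_mono2[of p "K * nrm x * nrm y" "nrm (x * y)"] by fastforce
qed

lemma cf_mult_weight_le:
  "cmod (cf (x * y) \<gamma>) * w \<gamma> \<le>
    (\<Sum>i\<in>antidiag \<gamma>. (cmod (cf x (fst i)) * w (fst i)) * (cmod (cf y (snd i)) * w (snd i)) *
      (w \<gamma> / (w (fst i) * w (snd i))))"
proof -
  have "cmod (cf (x * y) \<gamma>) * w \<gamma> \<le> (\<Sum>(\<alpha>, \<beta>)\<in>antidiag \<gamma>. cmod (cf x \<alpha>) * cmod (cf y \<beta>)) * w \<gamma>"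
    by (intro mult_right_mono norm_cf_mult_le) simp
  also have "\<dots> = (\<Sum>i\<in>antidiag \<gamma>. (cmod (cf x (fst i)) * w (fst i)) * (cmod (cf y (snd i)) * w (snd i)) *
      (w \<gamma> / (w (fst i) * w (snd i))))"
    unfolding sum_distrib_right
    by (intro sum.cong refl) (use w_pos in \<open>auto simp: split_beta less_imp_neq[symmetric]\<close>)
  finally show ?thesis .
qed

text \<open>On each antidiagonal Hoelder's inequality separates the weight ratios, whose
  \<open>q\<close>-sums are bounded by \<open>L\<close>, from the \<open>p\<close>-th powers of the
  weighted coefficients. The constant is a \<open>p\<close>-th root because
  \<open>mult_X_aux\<close> takes \<open>K powr p\<close>.\<close>

lemma mult_X:
  assumes pq: "p > 1" "q > 1" "1 / p + 1 / q = 1"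
    and L: "\<And>\<gamma>. (\<Sum>i\<in>antidiag \<gamma>. (w \<gamma> / (w (fst i) * w (snd i))) powr q) \<le> L"
    and x: "x \<in> X" and y: "y \<in> X"
  shows "x * y \<in> X" "nrm (x * y) \<le> (L powr (p - 1)) powr (1 / p) * nrm x * nrm y"
proof -
  have "(cmod (cf (x * y) \<gamma>) * w \<gamma>) powr p \<le> ((L powr (p - 1)) powr (1 / p)) powr p *
      (\<Sum>(\<alpha>, \<beta>)\<in>antidiag \<gamma>. (cmod (cf x \<alpha>) * w \<alpha>) powr p * (cmod (cf y \<beta>) * w \<beta>) powr p)" for \<gamma>
  proof -
    have "(cmod (cf (x * y) \<gamma>) * w \<gamma>) powr p \<le>
      (\<Sum>i\<in>antidiag \<gamma>. (cmod (cf x (fst i)) * w (fst i)) * (cmod (cf y (snd i)) * w (snd i)) *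
      (w \<gamma> / (w (fst i) * w (snd i)))) powr p"
      using p_pos by (intro powr_mono2 cf_mult_weight_le) auto
    also have "\<dots> \<le> L powr (p - 1) *
      (\<Sum>i\<in>antidiag \<gamma>. ((cmod (cf x (fst i)) * w (fst i)) * (cmod (cf y (snd i)) * w (snd i))) powr p)"
      by (rule Holder_sum_powr[OF pq _ _ _ L]) auto
    also have "L powr (p - 1) = ((L powr (p - 1)) powr (1 / p)) powr p"
      using pq by (simp add: powr_powr)
    finally show ?thesis by (simp add: powr_mult split_beta)
  qed
  from mult_X_aux[OF x y _ this] show "x * y \<in> X"
    "nrm (x * y) \<le> (L powr (p - 1)) powr (1 / p) * nrm x * nrm y" by auto
qed

lemma mult_X_1:
  assumes p: "p = 1" and sub: "\<And>\<alpha> \<beta>. w (\<alpha> + \<beta>) \<le> w \<alpha> * w \<beta>" and x: "x \<in> X" and y: "y \<in> X"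
  shows "x * y \<in> X" "nrm (x * y) \<le> 1 * nrm x * nrm y"
proof -
  have "(cmod (cf (x * y) \<gamma>) * w \<gamma>) powr p \<le> 1 powr p *
      (\<Sum>(\<alpha>, \<beta>)\<in>antidiag \<gamma>. (cmod (cf x \<alpha>) * w \<alpha>) powr p * (cmod (cf y \<beta>) * w \<beta>) powr p)" for \<gamma>
  proof -
    have "cmod (cf (x * y) \<gamma>) * w \<gamma> \<le>
      (\<Sum>i\<in>antidiag \<gamma>. (cmod (cf x (fst i)) * w (fst i)) * (cmod (cf y (snd i)) * w (snd i)) *
      (w \<gamma> / (w (fst i) * w (snd i))))" by (rule cf_mult_weight_le)
    also have "\<dots> \<le> (\<Sum>i\<in>antidiag \<gamma>. (cmod (cf x (fst i)) * w (fst i)) * (cmod (cf y (snd i)) * w (snd i)) * 1)"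
    proof (intro sum_mono mult_left_mono)
      fix i assume "i \<in> antidiag \<gamma>"
      then show "w \<gamma> / (w (fst i) * w (snd i)) \<le> 1"
        using sub[of "fst i" "snd i"] w_pos by (cases i) (auto simp: divide_le_eq_1)
    qed auto
    finally show ?thesis by (simp add: p split_beta sum_nonneg)
  qed
  from mult_X_aux[OF x y _ this] show "x * y \<in> X" "nrm (x * y) \<le> 1 * nrm x * nrm y" by auto
qed

end

locale weighted_algebra = weighted_space +
  fixes K :: real
  assumes w_0: "w 0 = 1"
    and mult_closed: "x \<in> X \<Longrightarrow> y \<in> X \<Longrightarrow> x * y \<in> X"
    and mult_bound: "x \<in> X \<Longrightarrow> y \<in> X \<Longrightarrow> nrm (x * y) \<le> K * nrm x * nrm y"
begin

sublocale qa: quasi_banach_algebra X const nrm K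
proof
  show "const (k + l) = const k + const l" "const (k * l) = const k * const l" for k l
    by (rule const_add const_mult)+
  fix x y assume xy: "x \<in> X" "y \<in> X"
  show "x + y \<in> X" "nrm (x + y) \<le> nrm x + nrm y" using nrm_triangle xy by auto
  show "x * y \<in> X" "nrm (x * y) \<le> K * nrm x * nrm y" using mult_closed mult_bound xy by auto
next
  fix x k assume x: "x \<in> X"
  show "nrm (const k * x) = cmod k * nrm x" by (rule nrm_scale(2))
  show "x = 0" if "nrm x = 0" using nrm_definite x that .
next
  show "\<exists>f\<in>X. (\<lambda>n. nrm (F n - f)) \<longlonglongrightarrow> 0"
    if "\<And>n. F n \<in> X" "\<And>e. e > 0 \<Longrightarrow> \<exists>m0. \<forall>m\<ge>m0. \<forall>n\<ge>m0. nrm (F m - F n) < e" for F :: "nat \<Rightarrow> mser"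
    using X_complete that by blast
qed (auto simp: const_X nrm_one w_0)

sublocale ba: banach_algebra X const qa.opnorm
  by (rule qa.banach_algebra_opnorm)

end

section \<open>Estimates for the weights built from multinomial coefficients\<close>

lemma multinomial_neq_0 [simp]: "multinomial \<alpha> \<noteq> 0"
  using multinomial_pos[of \<alpha>] by linarith

lemma multinomial_nonneg [simp]: "0 \<le> multinomial \<alpha>"
  using multinomial_pos[of \<alpha>] by linarith

lemma weight_eq: "weight s t \<alpha> = multinomial \<alpha> powr - t * (real (mdeg \<alpha>) + 1) powr s"
proof -
  have "mfact \<alpha> / fact (mdeg \<alpha>) = inverse (multinomial \<alpha>)"
    by (simp add: multinomial_def)
  then show ?thesis
    unfolding weight_def by (simp add: powr_minus inverse_powr less_imp_le)
qed

lemma weight_pos [simp]: "weight s t \<alpha> > 0"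
  by (simp add: weight_eq less_imp_neq[symmetric])

lemma weight_0 [simp]: "weight s t 0 = 1"
  by (simp add: weight_eq)

lemma weight_submult:
  assumes "s \<ge> 0" "t \<ge> 0"
  shows "weight s t (\<alpha> + \<beta>) \<le> weight s t \<alpha> * weight s t \<beta>"
proof -
  have "multinomial (\<alpha> + \<beta>) powr - t \<le> (multinomial \<alpha> * multinomial \<beta>) powr - t"
    using assms multinomial_mult_le[of \<alpha> \<beta>] by (intro powr_mono2') auto
  moreover have "(real (mdeg (\<alpha> + \<beta>)) + 1) powr s \<le> ((real (mdeg \<alpha>) + 1) * (real (mdeg \<beta>) + 1)) powr s"
    using assms by (intro powr_mono2) (auto simp: algebra_simps)
  ultimately have "weight s t (\<alpha> + \<beta>) \<le> (multinomial \<alpha> * multinomial \<beta>) powr - t *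
      ((real (mdeg \<alpha>) + 1) * (real (mdeg \<beta>) + 1)) powr s"
    unfolding weight_eq by (intro mult_mono) auto
  then show ?thesis by (simp add: weight_eq powr_mult less_imp_le mult_ac)
qed

text \<open>Multinomial coefficients increase under addition, so a translation costs only the degree
  factor, at most \<open>(mdeg \<alpha> + 1) powr s\<close>; with \<open>s \<le> 1\<close> this is
  the weight of the multiplier algebra.\<close>

lemma weight_shift:
  assumes "0 \<le> s" "s \<le> 1" "t \<ge> 0"
  shows "weight s t (\<alpha> + \<beta>) \<le> (real (mdeg \<alpha>) + 1) * weight s t \<beta>"
proof -
  have "multinomial (\<alpha> + \<beta>) powr - t \<le> multinomial \<beta> powr - t"
    using assms multinomial_mono[of \<beta> \<alpha>] by (intro powr_mono2') (auto simp: add.commute)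
  moreover have "(real (mdeg (\<alpha> + \<beta>)) + 1) powr s \<le> (real (mdeg \<alpha>) + 1) * (real (mdeg \<beta>) + 1) powr s"
  proof -
    have "(real (mdeg (\<alpha> + \<beta>)) + 1) powr s \<le> ((real (mdeg \<alpha>) + 1) * (real (mdeg \<beta>) + 1)) powr s"
      using assms by (intro powr_mono2) (auto simp: algebra_simps)
    also have "\<dots> = (real (mdeg \<alpha>) + 1) powr s * (real (mdeg \<beta>) + 1) powr s"
      by (simp add: powr_mult)
    also have "(real (mdeg \<alpha>) + 1) powr s \<le> (real (mdeg \<alpha>) + 1) powr 1"
      using assms by (intro powr_mono) auto
    finally show ?thesis by (simp add: mult_right_mono)
  qed
  ultimately have "weight s t (\<alpha> + \<beta>) \<le> multinomial \<beta> powr - t *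
      ((real (mdeg \<alpha>) + 1) * (real (mdeg \<beta>) + 1) powr s)"
    unfolding weight_eq by (intro mult_mono) auto
  then show ?thesis by (simp add: weight_eq mult_ac)
qed

lemma summable_Suc_powr: assumes "r > 1" shows "summable (\<lambda>k. (1 / (real k + 1)) powr r)"
proof -
  have "summable (\<lambda>k. real k powr - r)" using assms by (simp add: summable_real_powr_iff)
  then have "summable (\<lambda>k. real (Suc k) powr - r)" by (subst summable_Suc_iff)
  then show ?thesis by (simp add: powr_minus powr_divide inverse_eq_divide add.commute)
qed

text \<open>The ratio is at most \<open>1 / (k + 1) + 1 / (n - k + 1)\<close>, hence at most twice
  the larger term; this gives \<open>2 powr r\<close> and two copies of a series that converges for
  \<open>r > 1\<close>.\<close>

lemma degree_ratio_sum_bounded: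
  assumes r: "r > 1"
  shows "(\<Sum>k\<le>n. ((real n + 1) / ((real k + 1) * (real (n - k) + 1))) powr r) \<le>
    2 powr r * (2 * suminf (\<lambda>k. (1 / (real k + 1)) powr r))"
proof -
  define Z where "Z = suminf (\<lambda>k. (1 / (real k + 1)) powr r)"
  have Z: "(\<Sum>k\<le>n. (1 / (real k + 1)) powr r) \<le> Z"
    unfolding Z_def using summable_Suc_powr[OF r] by (intro sum_le_suminf) auto
  have "(\<Sum>k\<le>n. ((real n + 1) / ((real k + 1) * (real (n - k) + 1))) powr r) \<le>
    (\<Sum>k\<le>n. 2 powr r * ((1 / (real k + 1)) powr r + (1 / (real (n - k) + 1)) powr r))"
  proof (intro sum_mono)
    fix k assume k: "k \<in> {..n}"
    define a where "a = 1 / (real k + 1)"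
    define b where "b = 1 / (real (n - k) + 1)"
    have ab: "a > 0" "b > 0" by (auto simp: a_def b_def)
    have "(real n + 1) / ((real k + 1) * (real (n - k) + 1)) \<le>
      ((real k + 1) + (real (n - k) + 1)) / ((real k + 1) * (real (n - k) + 1))"
      using k by (intro divide_right_mono) (auto simp: of_nat_diff)
    also have "\<dots> = a + b" unfolding a_def b_def by (subst add_frac_eq) auto
    also have "\<dots> \<le> 2 * max a b" by simp
    finally have "((real n + 1) / ((real k + 1) * (real (n - k) + 1))) powr r \<le> (2 * max a b) powr r"
      using r by (intro powr_mono2) auto
    also have "\<dots> = 2 powr r * (max a b) powr r" using ab by (simp add: powr_mult)
    also have "(max a b) powr r \<le> a powr r + b powr r" by (simp add: max_def)
    finally show "((real n + 1) / ((real k + 1) * (real (n - k) + 1))) powr r \<le>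
      2 powr r * ((1 / (real k + 1)) powr r + (1 / (real (n - k) + 1)) powr r)"
      by (simp add: a_def b_def)
  qed
  also have "\<dots> = 2 powr r * ((\<Sum>k\<le>n. (1 / (real k + 1)) powr r) + (\<Sum>k\<le>n. (1 / (real (n - k) + 1)) powr r))"
    by (simp only: sum.distrib sum_distrib_left[symmetric])
  also have "(\<Sum>k\<le>n. (1 / (real (n - k) + 1)) powr r) = (\<Sum>k\<le>n. (1 / (real k + 1)) powr r)"
    by (rule sum.reindex_bij_witness[of _ "\<lambda>k. n - k" "\<lambda>k. n - k"]) auto
  also have "2 powr r * ((\<Sum>k\<le>n. (1 / (real k + 1)) powr r) + (\<Sum>k\<le>n. (1 / (real k + 1)) powr r)) \<le> 2 powr r * (Z + Z)"
    using Z by (intro mult_left_mono add_mono) auto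
  finally show ?thesis by (simp add: Z_def)
qed

text \<open>The weight ratio is \<open>m powr t\<close> times a ratio of degrees to the power
  \<open>s\<close>, with \<open>m \<le> 1\<close> the ratio of multinomial coefficients. Since
  \<open>t * q \<ge> 1\<close>, the \<open>q\<close>-th power costs at most one factor
  \<open>m\<close>, and by \<open>Vandermonde\<close> the \<open>m\<close> with
  \<open>mdeg \<alpha> = k\<close> sum to 1. What remains is a sum over \<open>k\<close> with
  exponent \<open>s * q > 1\<close>.\<close>

lemma weight_ratio_sum_bounded:
  assumes q: "q > 0" and s: "s * q > 1" and t: "t * q \<ge> 1"
  shows "(\<Sum>i\<in>antidiag \<gamma>. (weight s t \<gamma> / (weight s t (fst i) * weight s t (snd i))) powr q) \<le>
    2 powr (s * q) * (2 * suminf (\<lambda>k. (1 / (real k + 1)) powr (s * q)))"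
proof -
  define n where "n = mdeg \<gamma>"
  define R where "R k = ((real n + 1) / ((real k + 1) * (real (n - k) + 1))) powr (s * q)" for k
  have summand: "(weight s t \<gamma> / (weight s t (fst i) * weight s t (snd i))) powr q \<le>
    (\<Sum>k\<le>n. (if mdeg (fst i) = k then multinomial (fst i) * multinomial (snd i) else 0) / multinomial \<gamma> * R k)"
    if i: "i \<in> antidiag \<gamma>" for i
  proof -
    obtain \<alpha> \<beta> where ab: "i = (\<alpha>, \<beta>)" "\<alpha> + \<beta> = \<gamma>" using i by (cases i) auto
    define m where "m = multinomial \<alpha> * multinomial \<beta> / multinomial \<gamma>"
    have m: "0 < m" "m \<le> 1" using multinomial_mult_le[of \<alpha> \<beta>] ab by (auto simp: m_def divide_le_eq_1)
    have n: "n = mdeg \<alpha> + mdeg \<beta>" using ab by (auto simp: n_def)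
    have "weight s t \<gamma> / (weight s t \<alpha> * weight s t \<beta>) =
      m powr t * ((real n + 1) / ((real (mdeg \<alpha>) + 1) * (real (mdeg \<beta>) + 1))) powr s"
      unfolding weight_eq m_def
      by (simp add: powr_mult powr_divide powr_minus n_def divide_simps)
    also have "\<dots> powr q = m powr (t * q) * R (mdeg \<alpha>)"
      using m by (simp add: powr_mult powr_powr R_def n)
    also have "\<dots> \<le> m * R (mdeg \<alpha>)"
      using powr_mono'[of 1 "t * q" m] m t by (intro mult_right_mono) (auto simp: R_def)
    also have "m * R (mdeg \<alpha>) = (\<Sum>k\<le>n. (if mdeg \<alpha> = k then multinomial \<alpha> * multinomial \<beta> else 0) / multinomial \<gamma> * R k)"
    proof -
      have "(\<Sum>k\<le>n. (if mdeg \<alpha> = k then multinomial \<alpha> * multinomial \<beta> else 0) / multinomial \<gamma> * R k) =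
        (\<Sum>k\<le>n. if k = mdeg \<alpha> then m * R k else 0)"
        by (intro sum.cong refl) (auto simp: m_def)
      then show ?thesis using n by (simp add: sum.delta)
    qed
    finally show ?thesis unfolding ab(1) fst_conv snd_conv .
  qed
  have "(\<Sum>i\<in>antidiag \<gamma>. (weight s t \<gamma> / (weight s t (fst i) * weight s t (snd i))) powr q) \<le>
    (\<Sum>i\<in>antidiag \<gamma>. \<Sum>k\<le>n. (if mdeg (fst i) = k then multinomial (fst i) * multinomial (snd i) else 0) / multinomial \<gamma> * R k)"
    by (intro sum_mono summand)
  also have "\<dots> = (\<Sum>k\<le>n. \<Sum>i\<in>antidiag \<gamma>. (if mdeg (fst i) = k then multinomial (fst i) * multinomial (snd i) else 0) / multinomial \<gamma> * R k)"
    by (rule sum.swap)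
  also have "\<dots> = (\<Sum>k\<le>n. R k)"
  proof (intro sum.cong refl)
    fix k assume "k \<in> {..n}"
    then have V: "(\<Sum>i\<in>antidiag \<gamma>. if mdeg (fst i) = k then multinomial (fst i) * multinomial (snd i) else 0) = multinomial \<gamma>"
      using Vandermonde[of k \<gamma>] by (simp add: n_def split_beta)
    show "(\<Sum>i\<in>antidiag \<gamma>. (if mdeg (fst i) = k then multinomial (fst i) * multinomial (snd i) else 0) / multinomial \<gamma> * R k) = R k"
      by (simp only: sum_distrib_right[symmetric] sum_divide_distrib[symmetric] V)
        (simp add: less_imp_neq[symmetric])
  qed
  also have "\<dots> \<le> 2 powr (s * q) * (2 * suminf (\<lambda>k. (1 / (real k + 1)) powr (s * q)))"
    unfolding R_def by (rule degree_ratio_sum_bounded[OF s])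
  finally show ?thesis .
qed

lemma weighted_space_weight: "p \<ge> 1 \<Longrightarrow> weighted_space p (weight s t)"
  by unfold_locales auto

lemma weighted_algebra_weight_1:
  assumes "s \<ge> 0" "t \<ge> 0"
  shows "weighted_algebra 1 (weight s t) 1"
proof -
  interpret weighted_space 1 "weight s t" by (rule weighted_space_weight) simp
  show ?thesis
    using mult_X_1 weight_submult[OF assms] by unfold_locales auto
qed

lemma weighted_algebra_weight:
  assumes "p > 1" "q > 1" "1 / p + 1 / q = 1" "s > 1 / q" "t \<ge> 1 / q"
  shows "\<exists>K. weighted_algebra p (weight s t) K"
proof -
  interpret weighted_space p "weight s t" by (rule weighted_space_weight) (use assms in simp)
  have sq: "q > 0" "s * q > 1" "t * q \<ge> 1" using assms by (auto simp: field_simps)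
  have "weighted_algebra p (weight s t) (((2 powr (s * q) * (2 * suminf (\<lambda>k. (1 / (real k + 1)) powr (s * q)))) powr (p - 1)) powr (1 / p))"
    using mult_X[OF assms(1-3) weight_ratio_sum_bounded[OF sq]] by unfold_locales auto
  then show ?thesis by blast
qed

text \<open>Young's inequality; the factor \<open>|\<alpha>| + 1\<close> absorbs the growth of the weight under translation by \<open>\<alpha>\<close>.\<close>

lemma module_X:
  assumes "p > 1" "0 \<le> s" "s \<le> 1" "t \<ge> 0"
    and h: "h \<in> weighted_space.X 1 (weight 1 0)" and x: "x \<in> weighted_space.X p (weight s t)"
  shows "h * x \<in> weighted_space.X p (weight s t)"
proof -
  interpret W: weighted_space 1 "weight 1 0" by (rule weighted_space_weight) simp
  interpret weighted_space p "weight s t" by (rule weighted_space_weight) (use assms in simp)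
  define q where "q = p / (p - 1)"
  have pq: "p > 1" "q > 1" "1 / p + 1 / q = 1" using assms by (auto simp: q_def field_simps)
  define H where "H \<alpha> = cmod (cf h \<alpha>) * (real (mdeg \<alpha>) + 1)" for \<alpha>
  define Y where "Y \<beta> = cmod (cf x \<beta>) * weight s t \<beta>" for \<beta>
  have nn [simp]: "H \<alpha> \<ge> 0" "Y \<alpha> \<ge> 0" for \<alpha> by (auto simp: H_def Y_def)
  have H: "H summable_on UNIV" using W.X_D[OF h] by (simp add: H_def[abs_def] weight_eq)
  have Yp: "(\<lambda>\<alpha>. Y \<alpha> powr p) summable_on UNIV" using X_D[OF x] by (simp add: Y_def)
  define L where "L = infsum H UNIV"
  have bound: "(cmod (cf (h * x) \<gamma>) * weight s t \<gamma>) powr p \<le> L powr (p - 1) * (\<Sum>(\<alpha>, \<beta>)\<in>antidiag \<gamma>. H \<alpha> * Y \<beta> powr p)" for \<gamma>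
  proof -
    have "cmod (cf (h * x) \<gamma>) * weight s t \<gamma> \<le> (\<Sum>(\<alpha>, \<beta>)\<in>antidiag \<gamma>. cmod (cf h \<alpha>) * cmod (cf x \<beta>)) * weight s t \<gamma>"
      by (intro mult_right_mono norm_cf_mult_le) simp
    also have "\<dots> \<le> (\<Sum>i\<in>antidiag \<gamma>. H (fst i) * Y (snd i))"
      unfolding sum_distrib_right
    proof (intro sum_mono)
      fix i assume "i \<in> antidiag \<gamma>"
      then obtain \<alpha> \<beta> where i: "i = (\<alpha>, \<beta>)" "\<gamma> = \<alpha> + \<beta>" by (cases i) auto
      have "cmod (cf h \<alpha>) * cmod (cf x \<beta>) * weight s t \<gamma> \<le>
        cmod (cf h \<alpha>) * cmod (cf x \<beta>) * ((real (mdeg \<alpha>) + 1) * weight s t \<beta>)"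
        unfolding i using assms by (intro mult_left_mono weight_shift) auto
      then show "(case i of (\<alpha>, \<beta>) \<Rightarrow> cmod (cf h \<alpha>) * cmod (cf x \<beta>)) * weight s t \<gamma> \<le> H (fst i) * Y (snd i)"
        by (simp add: i H_def Y_def mult_ac)
    qed
    \<comment> \<open>Only the part \<open>H powr (1 / p)\<close> stays with \<open>Y\<close>; the
      \<open>q\<close>-th powers of the other part sum to at most \<open>L\<close>, and its
      \<open>p\<close>-th power leaves a convolution with \<open>H\<close>.\<close>
    also have "\<dots> = (\<Sum>i\<in>antidiag \<gamma>. (H (fst i) powr (1 / p) * Y (snd i)) * H (fst i) powr (1 / q))"
    proof (intro sum.cong refl)
      fix i :: "multiindex \<times> multiindex"
      have "H (fst i) powr (1 / p) * H (fst i) powr (1 / q) = H (fst i)"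
        using pq by (simp flip: powr_add)
      then show "H (fst i) * Y (snd i) = (H (fst i) powr (1 / p) * Y (snd i)) * H (fst i) powr (1 / q)"
        by (metis mult.assoc mult.commute)
    qed
    finally have "(cmod (cf (h * x) \<gamma>) * weight s t \<gamma>) powr p \<le>
      (\<Sum>i\<in>antidiag \<gamma>. (H (fst i) powr (1 / p) * Y (snd i)) * H (fst i) powr (1 / q)) powr p"
      using pq by (intro powr_mono2) auto
    also have "\<dots> \<le> L powr (p - 1) * (\<Sum>i\<in>antidiag \<gamma>. (H (fst i) powr (1 / p) * Y (snd i)) powr p)"
    proof (rule Holder_sum_powr[OF pq])
      have "(\<Sum>i\<in>antidiag \<gamma>. (H (fst i) powr (1 / q)) powr q) = (\<Sum>i\<in>antidiag \<gamma>. H (fst i))"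
        using pq by (simp add: powr_powr)
      also have "\<dots> = sum H (fst ` antidiag \<gamma>)"
        by (subst sum.reindex) (auto simp: inj_on_def)
      also have "\<dots> \<le> L" unfolding L_def by (rule finite_sum_le_infsum[OF H]) auto
      finally show "(\<Sum>i\<in>antidiag \<gamma>. (H (fst i) powr (1 / q)) powr q) \<le> L" .
    qed auto
    also have "(\<Sum>i\<in>antidiag \<gamma>. (H (fst i) powr (1 / p) * Y (snd i)) powr p) = (\<Sum>(\<alpha>, \<beta>)\<in>antidiag \<gamma>. H \<alpha> * Y \<beta> powr p)"
      using pq by (simp add: powr_mult powr_powr split_beta)
    finally show ?thesis .
  qed
  show ?thesis
    by (rule X_I) (rule convolution_bound(1)[OF H _ Yp _ _ bound], auto)
qed

section \<open>Evaluation of power series\<close>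

definition conv_at :: "(nat \<Rightarrow> complex) \<Rightarrow> mser \<Rightarrow> bool" where
  "conv_at z x \<longleftrightarrow> (\<lambda>\<alpha>. cmod (cf x \<alpha> * monomial_at z \<alpha>)) summable_on UNIV"

lemma D_infty_iff: "z \<in> D_infty (cf ` X) \<longleftrightarrow> (\<forall>x\<in>X. conv_at z x)"
  by (simp add: D_infty_def koethe_dual_def conv_at_def)

lemma conv_atD: "conv_at z x \<Longrightarrow> (\<lambda>\<alpha>. cf x \<alpha> * monomial_at z \<alpha>) summable_on UNIV"
  unfolding conv_at_def by (rule abs_summable_summable)

lemma series_has_sum: "conv_at z x \<Longrightarrow> ((\<lambda>\<alpha>. cf x \<alpha> * monomial_at z \<alpha>) has_sum series (cf x) z) UNIV"
  unfolding series_def by (rule has_sum_infsum) (rule conv_atD)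

lemma series_add: "conv_at z x \<Longrightarrow> conv_at z y \<Longrightarrow> series (cf (x + y)) z = series (cf x) z + series (cf y) z"
  unfolding series_def by (simp add: distrib_right infsum_add conv_atD)

lemma series_diff: "conv_at z x \<Longrightarrow> conv_at z y \<Longrightarrow> series (cf (x - y)) z = series (cf x) z - series (cf y) z"
  using has_sum_add[OF series_has_sum has_sum_uminusI[OF series_has_sum], of z x z y]
  by (simp add: series_def left_diff_distrib infsumI)

lemma series_const_mult: "series (cf (const k * x)) z = k * series (cf x) z"
  unfolding series_def by (simp add: mult.assoc infsum_cmult_right')

lemma conv_at_mult:
  assumes "conv_at z x" "conv_at z y"
  shows "conv_at z (x * y)" "series (cf (x * y)) z = series (cf x) z * series (cf y) z"
proof -
  define A where "A \<alpha> = cf x \<alpha> * monomial_at z \<alpha>" for \<alpha>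
  define B where "B \<alpha> = cf y \<alpha> * monomial_at z \<alpha>" for \<alpha>
  have eq: "cf (x * y) \<gamma> * monomial_at z \<gamma> = (\<Sum>(\<alpha>, \<beta>)\<in>antidiag \<gamma>. A \<alpha> * B \<beta>)" for \<gamma>
    unfolding cf_mult sum_distrib_right
    by (intro sum.cong refl) (auto simp: A_def B_def monomial_at_add)
  note cp = cauchy_product[of A B, folded conv_at_def]
  have AB: "(\<lambda>\<alpha>. cmod (A \<alpha>)) summable_on UNIV" "(\<lambda>\<alpha>. cmod (B \<alpha>)) summable_on UNIV"
    using assms by (simp_all add: conv_at_def A_def B_def)
  have "series (cf (x * y)) z = infsum A UNIV * infsum B UNIV"
    unfolding series_def eq by (rule infsumI[OF cp(1)[OF AB]])
  then show "series (cf (x * y)) z = series (cf x) z * series (cf y) z"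
    by (simp add: series_def A_def[abs_def] B_def[abs_def])
  show "conv_at z (x * y)" unfolding conv_at_def eq
  proof (rule summable_on_comparison_test[OF has_sum_imp_summable[OF cp(2)[OF AB]]])
    show "cmod (\<Sum>(\<alpha>, \<beta>)\<in>antidiag \<gamma>. A \<alpha> * B \<beta>) \<le> (\<Sum>(\<alpha>, \<beta>)\<in>antidiag \<gamma>. cmod (A \<alpha>) * cmod (B \<beta>))" for \<gamma>
      using norm_sum[of "\<lambda>(\<alpha>, \<beta>). A \<alpha> * B \<beta>" "antidiag \<gamma>"] by (simp add: split_beta norm_mult)
  qed simp
qed

lemma finite_support_has_sum:
  assumes "finite S" "\<And>\<alpha>. \<alpha> \<notin> S \<Longrightarrow> cf x \<alpha> = 0"
  shows "conv_at z x" "series (cf x) z = (\<Sum>\<alpha>\<in>S. cf x \<alpha> * monomial_at z \<alpha>)"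
proof -
  show "conv_at z x" unfolding conv_at_def
  proof (rule finite_nonzero_values_imp_summable_on)
    have "{\<alpha>. cmod (cf x \<alpha> * monomial_at z \<alpha>) \<noteq> 0} \<subseteq> S" using assms(2) by auto
    then show "finite {\<alpha> \<in> UNIV. cmod (cf x \<alpha> * monomial_at z \<alpha>) \<noteq> 0}" using assms(1) finite_subset by auto
  qed
  have "series (cf x) z = infsum (\<lambda>\<alpha>. cf x \<alpha> * monomial_at z \<alpha>) S"
    unfolding series_def by (rule infsum_cong_neutral) (use assms in auto)
  then show "series (cf x) z = (\<Sum>\<alpha>\<in>S. cf x \<alpha> * monomial_at z \<alpha>)" using assms by simp
qed

lemma series_const [simp]: "conv_at z (const k)" "series (cf (const k)) z = k"
  using finite_support_has_sum[of "{0}" "const k" z] by (auto simp: cf_const)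

lemma series_one [simp]: "conv_at z 1" "series (cf 1) z = 1"
  using series_const[where k = 1 and z = z] by simp_all

lemma series_monom [simp]: "conv_at z (monom \<alpha>)" "series (cf (monom \<alpha>)) z = monomial_at z \<alpha>"
  using finite_support_has_sum[of "{\<alpha>}" "monom \<alpha>" z] by (auto simp: cf_monom)

lemma monomial_at_mono:
  assumes "\<And>j. cmod (z j) \<le> cmod (z' j)"
  shows "cmod (monomial_at z \<alpha>) \<le> cmod (monomial_at z' \<alpha>)"
  unfolding monomial_at_def prod_norm[symmetric] norm_power
  using assms by (intro prod_mono) (auto intro: power_mono)

lemma conv_at_mono:
  assumes "conv_at z' x" "\<And>j. cmod (z j) \<le> cmod (z' j)"
  shows "conv_at z x"
  unfolding conv_at_def
  by (rule summable_on_comparison_test[OF assms(1)[unfolded conv_at_def]])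
    (auto simp: norm_mult intro!: mult_left_mono monomial_at_mono assms(2))

lemma D_infty_mono: "z' \<in> D_infty (cf ` X) \<Longrightarrow> (\<And>j. cmod (z j) \<le> cmod (z' j)) \<Longrightarrow> z \<in> D_infty (cf ` X)"
  unfolding D_infty_iff using conv_at_mono by blast

section \<open>Uniqueness of coefficients\<close>

text \<open>Once the coefficients below \<open>m\<close> vanish, divide by \<open>u ^ m\<close> and
  let \<open>u\<close> tend to 0.\<close>

lemma powser_unique_zero:
  fixes a :: "nat \<Rightarrow> complex"
  assumes "\<And>u. cmod u \<le> 1 \<Longrightarrow> (\<lambda>n. u ^ n * a n) sums 0"
  shows "a m = 0"
proof (induction m rule: less_induct)
  case (less m)
  have "(\<lambda>n. a (n + m) * u ^ n) sums 0" if u: "u \<noteq> 0" "cmod u < 1" for u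
  proof -
    have "(\<lambda>n. u ^ (n + m) * a (n + m)) sums (0 - (\<Sum>n<m. u ^ n * a n))"
      using assms[of u] u by (intro sums_split_initial_segment) auto
    then have "(\<lambda>n. u ^ (n + m) * a (n + m)) sums 0" using less by simp
    then have "(\<lambda>n. inverse (u ^ m) * (u ^ (n + m) * a (n + m))) sums (inverse (u ^ m) * 0)"
      by (rule sums_mult)
    moreover have "inverse (u ^ m) * (u ^ (n + m) * a (n + m)) = a (n + m) * u ^ n" for n
      using u by (simp add: power_add)
    ultimately show ?thesis by simp
  qed
  then have "((\<lambda>_. 0) \<longlongrightarrow> a (0 + m)) (at (0::complex))"
    by (intro powser_limit_0_strong[of 1 "\<lambda>n. a (n + m)" "\<lambda>_. 0"]) auto
  then show ?case by (simp add: tendsto_const_iff)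
qed

lemma monomial_at_upd:
  assumes "r \<noteq> 0"
  shows "monomial_at (z(j := u * r)) \<alpha> = u ^ lookup \<alpha> j * monomial_at (z(j := r)) \<alpha>"
proof -
  let ?K = "insert j (keys \<alpha>)"
  have "monomial_at (z(j := u * r)) \<alpha> = (\<Prod>i\<in>?K. (if i = j then u ^ lookup \<alpha> j else 1) * (z(j := r)) i ^ lookup \<alpha> i)"
    by (subst monomial_at_superset[of ?K]) (auto simp: power_mult_distrib intro!: prod.cong)
  also have "\<dots> = u ^ lookup \<alpha> j * monomial_at (z(j := r)) \<alpha>"
    by (subst prod.distrib) (simp add: prod.delta monomial_at_superset[of ?K \<alpha>] subset_insertI)
  finally show ?thesis .
qed

text \<open>Fixing the exponents one variable at a time reduces uniqueness to one-variable power series.\<close>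

lemma series_split_variable:
  assumes r: "\<And>j. r j > 0" and conv: "conv_at (\<lambda>j. of_real (r j)) x"
    and zero: "\<And>z. (\<And>i. cmod (z i) \<le> r i) \<Longrightarrow> infsum (\<lambda>\<alpha>. cf x \<alpha> * monomial_at z \<alpha>) S = 0"
    and z: "\<And>i. cmod (z i) \<le> r i"
  shows "infsum (\<lambda>\<alpha>. cf x \<alpha> * monomial_at z \<alpha>) {\<alpha> \<in> S. lookup \<alpha> j = k} = 0"
proof -
  \<comment> \<open>Putting the \<open>j\<close>-th variable at full radius writes it as
    \<open>u * r j\<close> with \<open>u\<close> in the closed unit disc; the slice of exponent
    \<open>k\<close> becomes the \<open>k\<close>-th coefficient of a power series in
    \<open>u\<close>.\<close>
  define z1 where "z1 = z(j := of_real (r j))"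
  define a where "a k = infsum (\<lambda>\<alpha>. cf x \<alpha> * monomial_at z1 \<alpha>) {\<alpha> \<in> S. lookup \<alpha> j = k}" for k
  have upd: "monomial_at (z(j := u * of_real (r j))) \<alpha> = u ^ lookup \<alpha> j * monomial_at z1 \<alpha>" for u \<alpha>
    unfolding z1_def using r[of j] by (intro monomial_at_upd) simp
  have slice: "infsum (\<lambda>\<alpha>. cf x \<alpha> * monomial_at (z(j := u * of_real (r j))) \<alpha>) {\<alpha> \<in> S. lookup \<alpha> j = k} = u ^ k * a k" for u k
  proof -
    have "infsum (\<lambda>\<alpha>. cf x \<alpha> * monomial_at (z(j := u * of_real (r j))) \<alpha>) {\<alpha> \<in> S. lookup \<alpha> j = k} =
      infsum (\<lambda>\<alpha>. u ^ k * (cf x \<alpha> * monomial_at z1 \<alpha>)) {\<alpha> \<in> S. lookup \<alpha> j = k}"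
      by (rule infsum_cong) (auto simp: upd)
    then show ?thesis by (simp add: a_def infsum_cmult_right')
  qed
  have "(\<lambda>k. u ^ k * a k) sums 0" if u: "cmod u \<le> 1" for u
  proof -
    define z2 where "z2 = z(j := u * of_real (r j))"
    define f where "f \<alpha> = cf x \<alpha> * monomial_at z2 \<alpha>" for \<alpha>
    have z2: "cmod (z2 i) \<le> r i" for i
      using z[of i] u r[of j] by (auto simp: z2_def norm_mult mult_le_cancel_right1)
    have "conv_at z2 x" using conv by (rule conv_at_mono) (use z2 r in \<open>auto simp: less_imp_le\<close>)
    then have sm: "f summable_on UNIV" unfolding f_def by (rule conv_atD)
    have sub: "f summable_on T" for T by (rule summable_on_subset_banach[OF sm]) simp
    have "(f has_sum 0) S" using zero[OF z2] has_sum_infsum[OF sub[of S]] by (simp add: f_def[abs_def])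
    then have "((\<lambda>(k, \<alpha>). f \<alpha>) has_sum 0) (Sigma UNIV (\<lambda>k. {\<alpha> \<in> S. lookup \<alpha> j = k}))"
      by (subst has_sum_reindex_bij_witness[of _ "\<lambda>\<alpha>. (lookup \<alpha> j, \<alpha>)" snd S f]) auto
    then have "((\<lambda>k. infsum f {\<alpha> \<in> S. lookup \<alpha> j = k}) has_sum 0) UNIV"
      by (rule has_sum_SigmaD) (use sub in \<open>auto intro: has_sum_infsum\<close>)
    then have "((\<lambda>k. u ^ k * a k) has_sum 0) UNIV"
      using slice by (simp add: f_def[abs_def] z2_def)
    then show ?thesis by (rule has_sum_imp_sums)
  qed
  then have "a k = 0" by (rule powser_unique_zero)
  then show ?thesis using slice[of "z j / of_real (r j)" k] r[of j] by simp
qed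

text \<open>Positive radii in every variable suffice. Applied to a polydisc inside the domain, this
  identifies power series that agree there as functions.\<close>

lemma series_unique_zero:
  assumes r: "\<And>j. r j > 0" and conv: "conv_at (\<lambda>j. of_real (r j)) x"
    and zero: "\<And>z. (\<And>i. cmod (z i) \<le> r i) \<Longrightarrow> series (cf x) z = 0"
  shows "x = 0"
proof (rule mser_eqI)
  fix \<beta>
  define S where "S m = {\<alpha>. \<forall>j<m. lookup \<alpha> j = lookup \<beta> j}" for m
  have S: "infsum (\<lambda>\<alpha>. cf x \<alpha> * monomial_at z \<alpha>) (S m) = 0" if "\<And>i. cmod (z i) \<le> r i" for z m
    using that
  proof (induction m arbitrary: z)
    case 0
    then show ?case using zero[of z] by (simp add: S_def series_def)
  next
    case (Suc m)
    have "S (Suc m) = {\<alpha> \<in> S m. lookup \<alpha> m = lookup \<beta> m}" by (auto simp: S_def less_Suc_eq)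
    then show ?case using series_split_variable[OF r conv Suc.IH Suc.prems] by simp
  qed
  obtain m where m: "\<And>j. j \<in> keys \<beta> \<Longrightarrow> j < m"
    using finite_keys[of \<beta>] by (meson finite_nat_set_iff_bounded)
  \<comment> \<open>With the variables from \<open>m\<close> on set to 0, every element of
    \<open>S m\<close> other than \<open>\<beta>\<close> has a positive exponent at a vanishing
    variable.\<close>
  define z where "z j = (if j < m then complex_of_real (r j) else 0)" for j
  have "0 = infsum (\<lambda>\<alpha>. cf x \<alpha> * monomial_at z \<alpha>) (S m)"
    using S[of z m] r by (auto simp: z_def less_imp_le)
  also have "\<dots> = infsum (\<lambda>\<alpha>. cf x \<alpha> * monomial_at z \<alpha>) {\<beta>}"
  proof (rule infsum_cong_neutral)
    fix \<alpha> assume a: "\<alpha> \<in> S m - {\<beta>}"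
    have "\<exists>j\<in>keys \<alpha>. j \<ge> m"
    proof (rule ccontr)
      assume "\<not> ?thesis"
      then have *: "\<And>j. j \<in> keys \<alpha> \<Longrightarrow> j < m" by force
      have "\<alpha> = \<beta>"
      proof (rule poly_mapping_eqI)
        fix j
        show "lookup \<alpha> j = lookup \<beta> j"
        proof (cases "j < m")
          case False
          then have "j \<notin> keys \<alpha>" "j \<notin> keys \<beta>" using * m by blast+
          then show ?thesis by (simp add: in_keys_iff)
        qed (use a in \<open>auto simp: S_def\<close>)
      qed
      then show False using a by simp
    qed
    then obtain j where j: "j \<in> keys \<alpha>" "z j = 0" by (auto simp: z_def)
    then have "z j ^ lookup \<alpha> j = 0" by (simp add: in_keys_iff)
    then have "monomial_at z \<alpha> = 0" unfolding monomial_at_def using j(1) by (intro prod_zero) auto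
    then show "cf x \<alpha> * monomial_at z \<alpha> = 0" by simp
  qed (auto simp: S_def)
  also have "\<dots> = cf x \<beta> * monomial_at z \<beta>" by simp
  finally have "cf x \<beta> * monomial_at z \<beta> = 0" by simp
  moreover have "monomial_at z \<beta> \<noteq> 0"
    unfolding monomial_at_def using r by (auto simp: z_def m less_imp_neq[symmetric])
  ultimately show "cf x \<beta> = cf 0 \<beta>" by simp
qed

section \<open>Sums over multi-indices of a given degree\<close>

lemma (in weighted_space) lin_X:
  assumes "(\<lambda>k. (cmod (b k) * w (unit_index k)) powr p) summable_on UNIV"
  shows "lin b \<in> X" "nrm (lin b) powr p = (\<Sum>\<^sub>\<infinity>k. (cmod (b k) * w (unit_index k)) powr p)"
proof -
  let ?f = "\<lambda>\<alpha>. (cmod (cf (lin b) \<alpha>) * w \<alpha>) powr p"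
  have inj: "inj unit_index" by (auto simp: inj_on_def)
  have zero: "?f \<alpha> = 0" if "\<alpha> \<notin> range unit_index" for \<alpha>
    using that degree_one[of \<alpha>] by (auto simp: cf_lin)
  have eq: "?f \<circ> unit_index = (\<lambda>k. (cmod (b k) * w (unit_index k)) powr p)" by auto
  have "?f summable_on range unit_index"
    using assms inj by (subst summable_on_reindex) (auto simp: eq)
  then have "?f summable_on UNIV"
    by (rule summable_on_cong_neutral[THEN iffD1, rotated -1]) (use zero in auto)
  then show "lin b \<in> X" by (rule X_I)
  have "infsum ?f UNIV = infsum ?f (range unit_index)"
    by (rule infsum_cong_neutral) (use zero in auto)
  also have "\<dots> = (\<Sum>\<^sub>\<infinity>k. (cmod (b k) * w (unit_index k)) powr p)"
    using inj by (subst infsum_reindex) (auto simp: eq)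
  finally show "nrm (lin b) powr p = (\<Sum>\<^sub>\<infinity>k. (cmod (b k) * w (unit_index k)) powr p)"
    by (simp add: nrm_powr)
qed

text \<open>A finite part of the l1-norm of \<open>lin z ^ n\<close>, which is submultiplicative;
  \<open>weight 0 0\<close> is constantly 1.\<close>

lemma multinomial_sum_le:
  assumes z: "(\<lambda>k. cmod (z k)) summable_on UNIV" "(\<Sum>\<^sub>\<infinity>k. cmod (z k)) \<le> V" and S: "finite S"
  shows "(\<Sum>\<alpha>\<in>S. if mdeg \<alpha> = n then multinomial \<alpha> * cmod (monomial_at z \<alpha>) else 0) \<le> V ^ n"
proof -
  interpret weighted_algebra 1 "weight 0 0" 1 by (rule weighted_algebra_weight_1) auto
  have w: "weight 0 0 \<alpha> = 1" for \<alpha> by (simp add: weight_eq)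
  have lin: "lin z \<in> X" "nrm (lin z) \<le> V"
    using lin_X[of z] z by (auto simp: w)
  have pow: "nrm (lin z ^ n) \<le> V ^ n"
  proof (induction n)
    case 0
    then show ?case using nrm_one[OF weight_0] by simp
  next
    case (Suc n)
    have "nrm (lin z ^ Suc n) \<le> nrm (lin z) * nrm (lin z ^ n)"
      using mult_bound[of "lin z" "lin z ^ n"] lin by simp
    also have "\<dots> \<le> V * V ^ n"
    proof (rule mult_mono)
      show "0 \<le> V" using lin(2) nrm_nonneg[of "lin z"] by linarith
    qed (use Suc lin in auto)
    finally show ?case by simp
  qed
  have "(\<Sum>\<alpha>\<in>S. if mdeg \<alpha> = n then multinomial \<alpha> * cmod (monomial_at z \<alpha>) else 0) =
    (\<Sum>\<alpha>\<in>S. (cmod (cf (lin z ^ n) \<alpha>) * weight 0 0 \<alpha>) powr 1)"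
    by (intro sum.cong refl) (auto simp: cf_lin_power w norm_mult)
  also have "\<dots> \<le> nrm (lin z ^ n) powr 1" using lin S by (intro finite_sum_le_nrm) auto
  finally show ?thesis using pow by simp
qed

text \<open>Grouped by degree, the terms of degree \<open>n\<close> contribute at most
  \<open>c n * V ^ n\<close>.\<close>

lemma graded_multinomial_summable:
  fixes c :: "nat \<Rightarrow> real"
  assumes z: "(\<lambda>k. cmod (z k)) summable_on UNIV" "(\<Sum>\<^sub>\<infinity>k. cmod (z k)) \<le> V"
    and c: "\<And>n. c n \<ge> 0" "summable (\<lambda>n. c n * V ^ n)"
  shows "(\<lambda>\<alpha>. c (mdeg \<alpha>) * (multinomial \<alpha> * cmod (monomial_at z \<alpha>))) summable_on UNIV"
proof (rule nonneg_bdd_above_summable_on)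
  show "bdd_above (sum (\<lambda>\<alpha>. c (mdeg \<alpha>) * (multinomial \<alpha> * cmod (monomial_at z \<alpha>))) ` {F. F \<subseteq> UNIV \<and> finite F})"
  proof (rule bdd_aboveI2)
    fix S :: "multiindex set" assume "S \<in> {F. F \<subseteq> UNIV \<and> finite F}"
    then have S: "finite S" by simp
    define m where "m = Max (insert 0 (mdeg ` S))"
    have m: "mdeg \<alpha> \<le> m" if "\<alpha> \<in> S" for \<alpha> using that S by (auto simp: m_def)
    have V: "V \<ge> 0" using z(2) infsum_nonneg[of UNIV "\<lambda>k. cmod (z k)"] by simp
    have "(\<Sum>\<alpha>\<in>S. c (mdeg \<alpha>) * (multinomial \<alpha> * cmod (monomial_at z \<alpha>))) =
      (\<Sum>\<alpha>\<in>S. \<Sum>n\<le>m. c n * (if mdeg \<alpha> = n then multinomial \<alpha> * cmod (monomial_at z \<alpha>) else 0))"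
    proof (intro sum.cong refl)
      fix \<alpha> assume a: "\<alpha> \<in> S"
      have "(\<Sum>n\<le>m. c n * (if mdeg \<alpha> = n then multinomial \<alpha> * cmod (monomial_at z \<alpha>) else 0)) =
        (\<Sum>n\<le>m. if n = mdeg \<alpha> then c n * (multinomial \<alpha> * cmod (monomial_at z \<alpha>)) else 0)"
        by (intro sum.cong refl) auto
      then show "c (mdeg \<alpha>) * (multinomial \<alpha> * cmod (monomial_at z \<alpha>)) =
        (\<Sum>n\<le>m. c n * (if mdeg \<alpha> = n then multinomial \<alpha> * cmod (monomial_at z \<alpha>) else 0))"
        using m[OF a] by (simp add: sum.delta)
    qed
    also have "\<dots> = (\<Sum>n\<le>m. c n * (\<Sum>\<alpha>\<in>S. if mdeg \<alpha> = n then multinomial \<alpha> * cmod (monomial_at z \<alpha>) else 0))"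
      by (subst sum.swap) (simp add: sum_distrib_left)
    also have "\<dots> \<le> (\<Sum>n\<le>m. c n * V ^ n)"
      using c(1) by (intro sum_mono mult_left_mono multinomial_sum_le z S)
    also have "\<dots> \<le> suminf (\<lambda>n. c n * V ^ n)" using c V by (intro sum_le_suminf) auto
    finally show "(\<Sum>\<alpha>\<in>S. c (mdeg \<alpha>) * (multinomial \<alpha> * cmod (monomial_at z \<alpha>))) \<le> suminf (\<lambda>n. c n * V ^ n)" .
  qed
qed (use c in auto)

lemma monomial_at_powr:
  assumes "q > 0"
  shows "cmod (monomial_at z \<alpha>) powr q = cmod (monomial_at (\<lambda>j. of_real (cmod (z j) powr q)) \<alpha>)"
proof -
  have "cmod (z j ^ n) powr q = cmod (of_real (cmod (z j) powr q) ^ n)" for j n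
  proof (cases "z j = 0")
    case True
    then show ?thesis using assms by (cases n) auto
  next
    case False
    then have "cmod (z j ^ n) powr q = (cmod (z j) powr real n) powr q" by (simp add: norm_power powr_realpow)
    also have "\<dots> = (cmod (z j) powr q) powr real n" by (simp add: powr_powr mult.commute)
    also have "\<dots> = cmod (of_real (cmod (z j) powr q) ^ n)" using False by (simp add: norm_power powr_realpow)
    finally show ?thesis .
  qed
  then show ?thesis
    unfolding monomial_at_def prod_norm[symmetric] by (subst prod_powr_distrib) auto
qed

text \<open>Provides a polydisc with all radii positive inside the domain, as uniqueness of
  coefficients requires. Radii at most 1 also keep it inside the domain of the multiplier
  algebra.\<close>

lemma small_polydisc:
  assumes s: "s \<ge> 0" and "t \<ge> 0"
  shows "\<exists>r::nat \<Rightarrow> real. (\<forall>j. r j > 0 \<and> r j \<le> 1) \<and>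
    (\<lambda>\<alpha>. cmod (monomial_at (\<lambda>j. of_real (r j)) \<alpha>) / weight s t \<alpha>) summable_on UNIV"
proof -
  \<comment> \<open>A \<open>k\<close>-th power with \<open>k \<ge> t\<close> absorbs
    \<open>multinomial \<alpha> powr t\<close>, and \<open>k \<ge> 1\<close> gives
    \<open>u ^ k \<le> u\<close> for \<open>u\<close> in the unit interval.\<close>
  define k :: nat where "k = Suc (nat \<lceil>t\<rceil>)"
  have k: "k \<ge> 1" "t \<le> real k" unfolding k_def using assms by linarith+
  \<comment> \<open>These terms sum to 1/2, so the geometric series over the degree
    converges.\<close>
  define y :: "nat \<Rightarrow> real" where "y j = (1/2) ^ Suc (Suc j)" for j
  define zy where "zy j = complex_of_real (y j)" for j
  define r where "r j = y j ^ k" for j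
  have y: "y j > 0" for j by (simp add: y_def)
  have "y sums (1/2)"
    using sums_mult[OF power_half_series, of "1/2"] by (simp add: y_def[abs_def])
  then have "(y has_sum (1/2)) UNIV"
    using y by (intro sums_nonneg_imp_has_sum) (auto simp: less_imp_le)
  then have zy: "(\<lambda>j. cmod (zy j)) summable_on UNIV" "(\<Sum>\<^sub>\<infinity>j. cmod (zy j)) \<le> 1/2"
    using y by (auto simp: zy_def less_imp_le has_sum_imp_summable infsumI)
  have sm: "(\<lambda>\<alpha>. 1 * (multinomial \<alpha> * cmod (monomial_at zy \<alpha>))) summable_on UNIV"
    by (rule graded_multinomial_summable[OF zy, where c = "\<lambda>_. 1"]) (auto intro: summable_geometric)
  have r: "r j > 0 \<and> r j \<le> 1" for j
    using y by (simp add: r_def) (simp add: y_def power_le_one flip: power_mult power_Suc)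
  have le: "cmod (monomial_at (\<lambda>j. of_real (r j)) \<alpha>) / weight s t \<alpha> \<le> 1 * (multinomial \<alpha> * cmod (monomial_at zy \<alpha>))" for \<alpha>
  proof -
    define u where "u = multinomial \<alpha> * cmod (monomial_at zy \<alpha>)"
    have u: "0 \<le> u" by (simp add: u_def)
    have "u \<le> 1"
    proof -
      have "u = (\<Sum>\<beta>\<in>{\<alpha>}. if mdeg \<beta> = mdeg \<alpha> then multinomial \<beta> * cmod (monomial_at zy \<beta>) else 0)"
        by (simp add: u_def)
      also have "\<dots> \<le> (1/2) ^ mdeg \<alpha>" by (rule multinomial_sum_le[OF zy]) simp
      also have "\<dots> \<le> 1" by (simp add: power_le_one)
      finally show ?thesis .
    qed
    have "monomial_at (\<lambda>j. of_real (r j)) \<alpha> = monomial_at zy \<alpha> ^ k"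
      by (simp add: monomial_at_def r_def zy_def prod_power_distrib mult.commute flip: power_mult)
    then have 1: "cmod (monomial_at (\<lambda>j. of_real (r j)) \<alpha>) = cmod (monomial_at zy \<alpha>) ^ k"
      by (simp add: norm_power)
    have "1 / weight s t \<alpha> = multinomial \<alpha> powr t * (real (mdeg \<alpha>) + 1) powr - s"
      by (simp add: weight_eq powr_minus divide_simps)
    also have "\<dots> \<le> multinomial \<alpha> ^ k * 1"
    proof (rule mult_mono)
      have "multinomial \<alpha> powr t \<le> multinomial \<alpha> powr real k"
        using k multinomial_ge_1 by (intro powr_mono) auto
      then show "multinomial \<alpha> powr t \<le> multinomial \<alpha> ^ k" by (simp add: powr_realpow)
      have "(real (mdeg \<alpha>) + 1) powr - s \<le> (real (mdeg \<alpha>) + 1) powr 0"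
        using s by (intro powr_mono) auto
      then show "(real (mdeg \<alpha>) + 1) powr - s \<le> 1" by simp
    qed auto
    finally have "cmod (monomial_at zy \<alpha>) ^ k * (1 / weight s t \<alpha>) \<le> cmod (monomial_at zy \<alpha>) ^ k * multinomial \<alpha> ^ k"
      by (intro mult_left_mono) auto
    also have "\<dots> = u ^ k" by (simp add: u_def power_mult_distrib mult.commute)
    also have "\<dots> \<le> u ^ 1" using u \<open>u \<le> 1\<close> k by (intro power_decreasing) auto
    finally show ?thesis by (simp add: 1 u_def)
  qed
  have "(\<lambda>\<alpha>. cmod (monomial_at (\<lambda>j. of_real (r j)) \<alpha>) / weight s t \<alpha>) summable_on UNIV"
    by (rule summable_on_comparison_test[OF sm le]) (simp add: less_imp_le)
  then show ?thesis using r by blast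
qed

text \<open>Only boundedness of the weighted coefficients enters, so this serves every exponent,
  \<open>p = \<infinity>\<close> included.\<close>

lemma conv_at_if_bounded:
  assumes "(\<lambda>\<alpha>. cmod (monomial_at z \<alpha>) / w \<alpha>) summable_on UNIV" "\<And>\<alpha>. cmod (cf x \<alpha>) * w \<alpha> \<le> B"
    and w: "\<And>\<alpha>. w \<alpha> > (0::real)"
  shows "conv_at z x"
  unfolding conv_at_def
proof (rule summable_on_comparison_test[OF summable_on_cmult_right[OF assms(1), of B]])
  fix \<alpha>
  have "cmod (cf x \<alpha> * monomial_at z \<alpha>) = (cmod (cf x \<alpha>) * w \<alpha>) * (cmod (monomial_at z \<alpha>) / w \<alpha>)"
    using w[of \<alpha>] by (simp add: norm_mult)
  also have "\<dots> \<le> B * (cmod (monomial_at z \<alpha>) / w \<alpha>)"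
    using assms(2) w[of \<alpha>] by (intro mult_right_mono) (auto simp: less_imp_le)
  finally show "cmod (cf x \<alpha> * monomial_at z \<alpha>) \<le> B * (cmod (monomial_at z \<alpha>) / w \<alpha>)" .
qed simp

lemma (in weighted_space) conv_at_Holder:
  assumes pq: "p > 1" "q > 1" "1 / p + 1 / q = 1" and x: "x \<in> X"
    and z: "(\<lambda>\<alpha>. (cmod (monomial_at z \<alpha>) / w \<alpha>) powr q) summable_on UNIV"
  shows "conv_at z x"
  unfolding conv_at_def
proof (rule summable_on_comparison_test)
  show "(\<lambda>\<alpha>. (cmod (cf x \<alpha>) * w \<alpha>) powr p * (1 / p) + (cmod (monomial_at z \<alpha>) / w \<alpha>) powr q * (1 / q)) summable_on UNIV"
    by (intro summable_on_add summable_on_cmult_left X_D x z)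
  fix \<alpha>
  have "cmod (cf x \<alpha> * monomial_at z \<alpha>) = (cmod (cf x \<alpha>) * w \<alpha>) * (cmod (monomial_at z \<alpha>) / w \<alpha>)"
    using w_pos[of \<alpha>] by (simp add: norm_mult)
  also have "\<dots> \<le> (cmod (cf x \<alpha>) * w \<alpha>) powr p / p + (cmod (monomial_at z \<alpha>) / w \<alpha>) powr q / q"
    by (intro Youngs_inequality pq) auto
  finally show "cmod (cf x \<alpha> * monomial_at z \<alpha>) \<le>
    (cmod (cf x \<alpha>) * w \<alpha>) powr p * (1 / p) + (cmod (monomial_at z \<alpha>) / w \<alpha>) powr q * (1 / q)" by simp
qed simp

text \<open>At \<open>t = 1 / q\<close> the \<open>q\<close>-th power of the weight contributes
  exactly one multinomial coefficient, so the terms of degree \<open>n\<close> are dominated by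
  \<open>(n + 1) powr - (s * q) * V ^ n\<close>. This is summable up to the sphere
  \<open>V = 1\<close> if \<open>s * q > 1\<close>, and inside the open ball for every
  \<open>s \<ge> 0\<close>.\<close>

lemma critical_weight_summable:
  assumes q: "q > 0" and z: "(\<lambda>k. cmod (z k) powr q) summable_on UNIV" "(\<Sum>\<^sub>\<infinity>k. cmod (z k) powr q) = V"
    and sV: "s * q > 1 \<and> V \<le> 1 \<or> s \<ge> 0 \<and> V < 1"
  shows "(\<lambda>\<alpha>. (cmod (monomial_at z \<alpha>) / weight s (1 / q) \<alpha>) powr q) summable_on UNIV"
proof -
  define zq where "zq j = complex_of_real (cmod (z j) powr q)" for j
  define c where "c n = (real n + 1) powr - (s * q)" for n
  have zq: "(\<lambda>j. cmod (zq j)) summable_on UNIV" "(\<Sum>\<^sub>\<infinity>j. cmod (zq j)) \<le> V"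
    using z by (auto simp: zq_def)
  have V: "V \<ge> 0" using z(2) infsum_nonneg[of UNIV "\<lambda>k. cmod (z k) powr q"] by simp
  have "summable (\<lambda>n. c n * V ^ n)"
    using sV
  proof
    assume a: "s * q > 1 \<and> V \<le> 1"
    have sm: "summable c" using summable_Suc_powr[of "s * q"] a by (simp add: c_def[abs_def] powr_divide powr_minus inverse_eq_divide)
    have le: "norm (c n * V ^ n) \<le> c n" for n
      using V a power_le_one[of V n] by (simp add: c_def abs_mult mult_left_le)
    show ?thesis by (rule summable_comparison_test'[OF sm, of 0]) (rule le)
  next
    assume a: "s \<ge> 0 \<and> V < 1"
    have "c n \<le> 1" for n
    proof -
      have "c n \<le> (real n + 1) powr 0" unfolding c_def using a q by (intro powr_mono) auto
      then show ?thesis by simp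
    qed
    then have le: "norm (c n * V ^ n) \<le> V ^ n" for n
      using V by (simp add: c_def abs_mult mult_left_le_one_le)
    have sm: "summable (\<lambda>n. V ^ n)" using a V by (intro summable_geometric) auto
    show ?thesis by (rule summable_comparison_test'[OF sm, of 0]) (rule le)
  qed
  then have "(\<lambda>\<alpha>. c (mdeg \<alpha>) * (multinomial \<alpha> * cmod (monomial_at zq \<alpha>))) summable_on UNIV"
    by (intro graded_multinomial_summable[OF zq]) (auto simp: c_def)
  moreover have "(cmod (monomial_at z \<alpha>) / weight s (1 / q) \<alpha>) powr q =
    c (mdeg \<alpha>) * (multinomial \<alpha> * cmod (monomial_at zq \<alpha>))" for \<alpha>
  proof -
    have "weight s (1 / q) \<alpha> powr q = (real (mdeg \<alpha>) + 1) powr (s * q) / multinomial \<alpha>"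
      using q by (simp add: weight_eq powr_mult powr_divide powr_powr powr_minus_divide)
    moreover have "cmod (monomial_at z \<alpha>) powr q = cmod (monomial_at zq \<alpha>)"
      unfolding zq_def[abs_def] by (rule monomial_at_powr[OF q])
    moreover have "(cmod (monomial_at z \<alpha>) / weight s (1 / q) \<alpha>) powr q =
      cmod (monomial_at z \<alpha>) powr q / weight s (1 / q) \<alpha> powr q"
      by (rule powr_divide)
    ultimately show ?thesis by (simp add: c_def powr_minus_divide mult.commute)
  qed
  ultimately show ?thesis by simp
qed

section \<open>Weak approximation and cyclicity\<close>

text \<open>Induction over the generation of the topology turns the subbasis into the usual
  neighbourhoods, given by finitely many functionals and one tolerance.\<close>

lemma generated_topology_nhd:
  assumes "generate_topology_on {{x \<in> X. pairing x y \<in> U} | y U. y \<in> D \<and> open U} T" "v \<in> T" "v \<in> X"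
  shows "\<exists>Y e. finite Y \<and> Y \<subseteq> D \<and> e > 0 \<and> {x \<in> X. \<forall>y\<in>Y. cmod (pairing x y - pairing v y) < e} \<subseteq> T"
  using assms(1,2)
proof (induction T rule: generate_topology_on.induct)
  case (Int a b)
  obtain Y e where 1: "finite Y" "Y \<subseteq> D" "e > 0" "{x \<in> X. \<forall>y\<in>Y. cmod (pairing x y - pairing v y) < e} \<subseteq> a"
    using Int by auto
  obtain Y' e' where 2: "finite Y'" "Y' \<subseteq> D" "e' > 0" "{x \<in> X. \<forall>y\<in>Y'. cmod (pairing x y - pairing v y) < e'} \<subseteq> b"
    using Int by auto
  show ?case
    using 1 2 by (intro exI[of _ "Y \<union> Y'"] exI[of _ "min e e'"]) auto
next
  case (UN K)
  then obtain k where k: "k \<in> K" "v \<in> k" by blast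
  then show ?case using UN.IH[OF k] by blast
next
  case (Basis s)
  then obtain y U where s: "s = {x \<in> X. pairing x y \<in> U}" "y \<in> D" "open U" by blast
  then obtain e where e: "e > 0" "ball (pairing v y) e \<subseteq> U" using Basis(2) open_contains_ball by blast
  have "{x \<in> X. \<forall>y\<in>{y}. cmod (pairing x y - pairing v y) < e} \<subseteq> s"
    using e(2) by (auto simp: s dist_norm norm_minus_commute)
  then show ?case using s(2) e(1) by (intro exI[of _ "{y}"] exI[of _ e]) auto
qed auto

lemma topspace_sigma: "topspace (sigma_topology X) = X"
proof -
  let ?B = "{{x \<in> X. pairing x y \<in> U} | y U. y \<in> koethe_dual X \<and> open U}"
  have "{x \<in> X. pairing x (\<lambda>_. 0) \<in> UNIV} \<in> ?B"
    by (intro CollectI exI[of _ "\<lambda>_. 0"] exI[of _ UNIV] conjI refl open_UNIV) (simp add: koethe_dual_def)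
  then have "X \<subseteq> \<Union>?B" by auto
  moreover have "\<Union>?B \<subseteq> X" by auto
  ultimately show ?thesis unfolding sigma_topology_def topology_generated_by_topspace by (rule antisym[rotated])
qed

lemma sigma_closure_I:
  assumes "v \<in> X" "\<And>Y e. finite Y \<Longrightarrow> Y \<subseteq> koethe_dual X \<Longrightarrow> e > 0 \<Longrightarrow>
    \<exists>x\<in>S. \<forall>y\<in>Y. cmod (pairing x y - pairing v y) < e" "S \<subseteq> X"
  shows "v \<in> sigma_topology X closure_of S"
  unfolding in_closure_of topspace_sigma
proof (intro conjI allI impI assms(1))
  fix T assume T: "v \<in> T \<and> openin (sigma_topology X) T"
  then have "generate_topology_on {{x \<in> X. pairing x y \<in> U} | y U. y \<in> koethe_dual X \<and> open U} T"
    unfolding sigma_topology_def by (simp add: openin_topology_generated_by_iff)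
  from generated_topology_nhd[OF this _ assms(1)] T obtain Y e where
    Y: "finite Y" "Y \<subseteq> koethe_dual X" "e > 0" "{x \<in> X. \<forall>y\<in>Y. cmod (pairing x y - pairing v y) < e} \<subseteq> T"
    by blast
  with assms(2)[of Y e] obtain x where "x \<in> S" "\<forall>y\<in>Y. cmod (pairing x y - pairing v y) < e" by blast
  then show "\<exists>x. x \<in> S \<and> x \<in> T" using Y(4) assms(3) by blast
qed

text \<open>Evaluation at a point of \<open>D_infty X\<close> is weakly continuous.\<close>

lemma cyclic_imp_nonzero:
  assumes cyc: "cyclic (cf ` X) (cf f)" and one: "1 \<in> X" and z: "z \<in> D_infty (cf ` X)"
  shows "series (cf f) z \<noteq> 0"
proof
  assume f: "series (cf f) z = 0"
  let ?X = "cf ` X"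
  let ?S = "{y \<in> ?X. \<exists>q. polynomial q \<and> (\<forall>z\<in>D_infty ?X. series y z = series q z * series (cf f) z)}"
  let ?T = "{x \<in> ?X. pairing x (monomial_at z) \<in> ball 1 1}"
  have z': "monomial_at z \<in> koethe_dual ?X" using z by (simp add: D_infty_def)
  have pair: "pairing x (monomial_at z) = series x z" for x by (simp add: pairing_def series_def)
  have opn: "openin (sigma_topology ?X) ?T"
    unfolding sigma_topology_def
    by (intro topology_generated_by_Basis CollectI exI[of _ "monomial_at z"] exI[of _ "ball 1 1"] conjI refl z' open_ball)
  have one_T: "cf 1 \<in> ?T" using one by (auto simp: pair)
  have "cf 1 \<in> ?X" using one by (rule imageI)
  then have "cf 1 \<in> sigma_topology ?X closure_of ?S" using cyc unfolding cyclic_def by (rule ssubst[rotated])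
  then have "\<forall>T. cf 1 \<in> T \<and> openin (sigma_topology ?X) T \<longrightarrow> (\<exists>y. y \<in> ?S \<and> y \<in> T)"
    unfolding in_closure_of by (rule conjunct2)
  then have "\<exists>y. y \<in> ?S \<and> y \<in> ?T" using one_T opn by (elim allE[of _ ?T]) (rule mp, assumption, rule conjI)
  then obtain y where y: "y \<in> ?S" "y \<in> ?T" by (elim exE conjE)
  obtain q where "\<forall>z\<in>D_infty ?X. series y z = series q z * series (cf f) z" using y(1) by auto
  then have "series y z = 0" using z f by simp
  then show False using y(2) by (simp add: pair)
qed

section \<open>Transposes of multiplications and weak approximation by multiples\<close>

definition absm :: "mser \<Rightarrow> mser" where
  "absm x = Ser (\<lambda>\<alpha>. of_real (cmod (cf x \<alpha>)))"

lemma cf_absm [simp]: "cf (absm x) \<alpha> = of_real (cmod (cf x \<alpha>))"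
  by (simp add: absm_def)

lemma cf_absm_mult: "cf (absm h * absm x) \<gamma> = of_real (\<Sum>(\<alpha>, \<beta>)\<in>antidiag \<gamma>. cmod (cf h \<alpha>) * cmod (cf x \<beta>))"
  by (simp add: cf_mult split_beta)

text \<open>The transpose of multiplication by \<open>h\<close> with respect to
  \<open>pairing\<close>.\<close>

definition adj :: "mser \<Rightarrow> (multiindex \<Rightarrow> complex) \<Rightarrow> multiindex \<Rightarrow> complex" where
  "adj h y \<beta> = (\<Sum>\<^sub>\<infinity>\<alpha>. cf h \<alpha> * y (\<alpha> + \<beta>))"

text \<open>Taking absolute values of the coefficients of both factors excludes cancellation inside
  an antidiagonal sum, so summability of the product gives absolute summability over all
  pairs.\<close>

lemma adj_summable:
  assumes "(\<lambda>\<gamma>. cmod (cf (absm h * absm x) \<gamma> * y \<gamma>)) summable_on UNIV"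
  shows "(\<lambda>(\<alpha>, \<beta>). cmod (cf h \<alpha> * cf x \<beta> * y (\<alpha> + \<beta>))) summable_on UNIV"
proof -
  define f where "f p = cmod (cf h (fst p) * cf x (snd p) * y (fst p + snd p))" for p
  define g where "g \<gamma> = sum f (antidiag \<gamma>)" for \<gamma>
  have "g \<gamma> = cmod (cf (absm h * absm x) \<gamma> * y \<gamma>)" for \<gamma>
  proof -
    have "g \<gamma> = (\<Sum>(\<alpha>, \<beta>)\<in>antidiag \<gamma>. cmod (cf h \<alpha>) * cmod (cf x \<beta>)) * cmod (y \<gamma>)"
      unfolding g_def sum_distrib_right by (intro sum.cong refl) (auto simp: f_def norm_mult)
    also have "\<dots> = cmod (cf (absm h * absm x) \<gamma> * y \<gamma>)"
      unfolding cf_absm_mult norm_mult norm_of_real by (simp add: split_beta sum_nonneg)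
    finally show ?thesis .
  qed
  then have "g summable_on UNIV" using assms by (simp add: g_def[abs_def])
  then have "(\<lambda>(\<gamma>, p). f p) summable_on Sigma UNIV antidiag"
    by (rule summable_on_SigmaI[rotated]) (auto simp: g_def f_def intro: has_sum_finite)
  then have "f summable_on UNIV"
    by (subst (asm) summable_on_reindex_bij_witness[of _ "\<lambda>(\<alpha>, \<beta>). (\<alpha> + \<beta>, \<alpha>, \<beta>)" snd UNIV f]) auto
  then show ?thesis by (simp add: f_def[abs_def] case_prod_unfold)
qed

text \<open>Fubini for one absolutely summable double family, grouped in three ways: along
  antidiagonals, with \<open>\<beta>\<close> outside (the transpose), and with
  \<open>\<alpha>\<close> outside (a series in the coefficients of \<open>h\<close>).\<close>

lemma pairing_mult:
  assumes "(\<lambda>\<gamma>. cmod (cf (absm h * absm x) \<gamma> * y \<gamma>)) summable_on UNIV"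
  shows "pairing (cf (h * x)) y = pairing (cf x) (adj h y)"
    and "(\<lambda>\<beta>. cmod (cf x \<beta> * adj h y \<beta>)) summable_on UNIV"
    and "((\<lambda>\<alpha>. cf h \<alpha> * (\<Sum>\<^sub>\<infinity>\<beta>. cf x \<beta> * y (\<alpha> + \<beta>))) has_sum pairing (cf (h * x)) y) UNIV"
proof -
  define F where "F = (\<lambda>(\<alpha>, \<beta>). cf h \<alpha> * cf x \<beta> * y (\<alpha> + \<beta>))"
  have abs: "(\<lambda>p. norm (F p)) summable_on UNIV \<times> UNIV"
    using adj_summable[OF assms] by (simp add: F_def case_prod_unfold)
  then have sm: "F summable_on UNIV \<times> UNIV" by (rule abs_summable_summable)
  define I where "I = infsum F (UNIV \<times> UNIV)"
  have hs: "(F has_sum I) (UNIV \<times> UNIV)" unfolding I_def by (rule has_sum_infsum[OF sm])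
  have I: "pairing (cf (h * x)) y = I"
  proof -
    have "((\<lambda>\<gamma>. sum F (antidiag \<gamma>)) has_sum I) UNIV" by (rule cauchy_product_aux[OF hs])
    moreover have "sum F (antidiag \<gamma>) = cf (h * x) \<gamma> * y \<gamma>" for \<gamma>
      unfolding cf_mult sum_distrib_right by (intro sum.cong refl) (auto simp: F_def)
    ultimately show ?thesis unfolding pairing_def by (simp add: infsumI)
  qed
  have swap: "(\<lambda>(\<beta>, \<alpha>). norm (F (\<alpha>, \<beta>))) summable_on UNIV \<times> UNIV"
    using abs by (subst summable_on_reindex_bij_witness[of _ prod.swap prod.swap "UNIV \<times> UNIV" "\<lambda>p. norm (F p)"]) auto
  define G where "G = (\<lambda>(\<beta>, \<alpha>). F (\<alpha>, \<beta>))"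
  have Gabs: "(\<lambda>p. norm (G p)) summable_on UNIV \<times> UNIV"
    using swap by (simp add: G_def case_prod_unfold)
  have G: "(G has_sum I) (UNIV \<times> UNIV)"
    using hs unfolding G_def by (subst has_sum_reindex_bij_witness[of _ prod.swap prod.swap "UNIV \<times> UNIV" F]) auto
  have Gx: "G (\<beta>, \<alpha>) = cf x \<beta> * (cf h \<alpha> * y (\<alpha> + \<beta>))" for \<alpha> \<beta> by (simp add: G_def F_def mult_ac)
  have inner: "(\<Sum>\<^sub>\<infinity>\<alpha>. G (\<beta>, \<alpha>)) = cf x \<beta> * adj h y \<beta>" for \<beta>
    unfolding Gx adj_def by (rule infsum_cmult_right')
  have "infsum G (UNIV \<times> UNIV) = (\<Sum>\<^sub>\<infinity>\<beta>. \<Sum>\<^sub>\<infinity>\<alpha>. G (\<beta>, \<alpha>))"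
    using infsum_Sigma_banach[OF has_sum_imp_summable[OF G]] by simp
  then show "pairing (cf (h * x)) y = pairing (cf x) (adj h y)"
    using I infsumI[OF G] by (simp add: inner pairing_def)
  note GS = iffD1[OF Infinite_Sum.abs_summable_on_Sigma_iff[where A = UNIV and B = "\<lambda>_. UNIV" and f = G] Gabs]
  have bound: "cmod (cf x \<beta> * adj h y \<beta>) \<le> norm (\<Sum>\<^sub>\<infinity>\<alpha>. norm (G (\<beta>, \<alpha>)))" for \<beta>
  proof -
    have "norm (\<Sum>\<^sub>\<infinity>\<alpha>. G (\<beta>, \<alpha>)) \<le> (\<Sum>\<^sub>\<infinity>\<alpha>. norm (G (\<beta>, \<alpha>)))"
      by (rule norm_infsum_bound) (rule bspec[OF conjunct1[OF GS] UNIV_I])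
    also have "\<dots> \<le> norm (\<Sum>\<^sub>\<infinity>\<alpha>. norm (G (\<beta>, \<alpha>)))" by simp
    finally show ?thesis unfolding inner .
  qed
  show "(\<lambda>\<beta>. cmod (cf x \<beta> * adj h y \<beta>)) summable_on UNIV"
    by (rule summable_on_comparison_test[OF conjunct2[OF GS] bound]) simp
  note FS = iffD1[OF Infinite_Sum.abs_summable_on_Sigma_iff[where A = UNIV and B = "\<lambda>_. UNIV" and f = F] abs]
  have Fx: "F (\<alpha>, \<beta>) = cf h \<alpha> * (cf x \<beta> * y (\<alpha> + \<beta>))" for \<alpha> \<beta> by (simp add: F_def mult_ac)
  have "(\<lambda>\<beta>. F (\<alpha>, \<beta>)) summable_on UNIV" for \<alpha>
    by (rule abs_summable_summable) (rule bspec[OF conjunct1[OF FS] UNIV_I])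
  then have Fs: "((\<lambda>\<beta>. F (\<alpha>, \<beta>)) has_sum (cf h \<alpha> * (\<Sum>\<^sub>\<infinity>\<beta>. cf x \<beta> * y (\<alpha> + \<beta>)))) UNIV" for \<alpha>
    unfolding infsum_cmult_right'[symmetric] Fx[symmetric] by (rule has_sum_infsum)
  show "((\<lambda>\<alpha>. cf h \<alpha> * (\<Sum>\<^sub>\<infinity>\<beta>. cf x \<beta> * y (\<alpha> + \<beta>))) has_sum pairing (cf (h * x)) y) UNIV"
    unfolding I by (rule has_sum_SigmaD[OF hs Fs])
qed

lemma eventually_finite_subsetD: "eventually P (finite_subsets_at_top UNIV) \<Longrightarrow> \<exists>S. finite S \<and> P S"
  unfolding eventually_finite_subsets_at_top by blast

text \<open>Used with \<open>M = X\<close> when \<open>X\<close> is an algebra and with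
  \<open>M = W\<close> in the critical case. \<open>absm_act\<close> asks for the product of the
  absolute values because the exchange of sums needs absolute convergence.\<close>

locale multiplier_module =
  fixes X M :: "mser set"
  assumes one_X: "1 \<in> X"
    and solid: "y \<in> X \<Longrightarrow> (\<And>\<alpha>. cmod (cf x \<alpha>) \<le> cmod (cf y \<alpha>)) \<Longrightarrow> x \<in> X"
    and M_mult: "g \<in> M \<Longrightarrow> h \<in> M \<Longrightarrow> g * h \<in> M"
    and poly_M: "finite {\<alpha>. cf q \<alpha> \<noteq> 0} \<Longrightarrow> q \<in> M"
    and absm_act: "h \<in> M \<Longrightarrow> x \<in> X \<Longrightarrow> absm h * absm x \<in> X"
begin

lemma act: assumes "h \<in> M" "x \<in> X" shows "h * x \<in> X"
proof (rule solid[OF absm_act[OF assms]])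
  fix \<gamma>
  show "cmod (cf (h * x) \<gamma>) \<le> cmod (cf (absm h * absm x) \<gamma>)"
    unfolding cf_absm_mult norm_of_real using norm_cf_mult_le[of h x \<gamma>] by linarith
qed

abbreviation dual :: "(multiindex \<Rightarrow> complex) set" where
  "dual \<equiv> koethe_dual (cf ` X)"

lemma act_summable: "h \<in> M \<Longrightarrow> x \<in> X \<Longrightarrow> y \<in> dual \<Longrightarrow>
    (\<lambda>\<gamma>. cmod (cf (absm h * absm x) \<gamma> * y \<gamma>)) summable_on UNIV"
  using absm_act by (auto simp: koethe_dual_def)

lemma adj_dual: "h \<in> M \<Longrightarrow> y \<in> dual \<Longrightarrow> adj h y \<in> dual"
proof -
  assume hy: "h \<in> M" "y \<in> dual"
  have "(\<lambda>\<beta>. cmod (cf x \<beta> * adj h y \<beta>)) summable_on UNIV" if "x \<in> X" for x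
    by (rule pairing_mult(2)[OF act_summable[OF hy(1) that hy(2)]])
  then show ?thesis by (simp add: koethe_dual_def)
qed

lemma pairing_act: "h \<in> M \<Longrightarrow> x \<in> X \<Longrightarrow> y \<in> dual \<Longrightarrow> pairing (cf (h * x)) y = pairing (cf x) (adj h y)"
  using pairing_mult(1)[OF act_summable] .

text \<open>The pairing is a convergent series in the coefficients of \<open>h\<close>, and
  truncating \<open>h\<close> gives its partial sums; finitely many functionals are treated at
  once.\<close>

lemma pairing_trunc:
  assumes h: "h \<in> M" and x: "x \<in> X" and Y: "finite Y" "Y \<subseteq> dual" and e: "e > 0"
  shows "\<exists>S. finite S \<and> (\<forall>y\<in>Y. cmod (pairing (cf (trunc_coeffs S h * x)) y - pairing (cf (h * x)) y) < e)"
proof -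
  have "eventually (\<lambda>S. dist (\<Sum>\<alpha>\<in>S. cf h \<alpha> * (\<Sum>\<^sub>\<infinity>\<beta>. cf x \<beta> * y (\<alpha> + \<beta>))) (pairing (cf (h * x)) y) < e)
    (finite_subsets_at_top UNIV)" if "y \<in> Y" for y
    using pairing_mult(3)[OF act_summable[OF h x]] that Y(2) e unfolding has_sum_def
    by (intro tendstoD) auto
  then have "eventually (\<lambda>S. \<forall>y\<in>Y. dist (\<Sum>\<alpha>\<in>S. cf h \<alpha> * (\<Sum>\<^sub>\<infinity>\<beta>. cf x \<beta> * y (\<alpha> + \<beta>))) (pairing (cf (h * x)) y) < e)
    (finite_subsets_at_top UNIV)"
    using Y(1) by (simp add: eventually_ball_finite)
  then obtain S where S: "finite S"
    "\<forall>y\<in>Y. dist (\<Sum>\<alpha>\<in>S. cf h \<alpha> * (\<Sum>\<^sub>\<infinity>\<beta>. cf x \<beta> * y (\<alpha> + \<beta>))) (pairing (cf (h * x)) y) < e"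
    using eventually_finite_subsetD by blast
  have "pairing (cf (trunc_coeffs S h * x)) y = (\<Sum>\<alpha>\<in>S. cf h \<alpha> * (\<Sum>\<^sub>\<infinity>\<beta>. cf x \<beta> * y (\<alpha> + \<beta>)))" if "y \<in> Y" for y
  proof -
    have "{\<alpha>. cf (trunc_coeffs S h) \<alpha> \<noteq> 0} \<subseteq> S" by auto
    then have "trunc_coeffs S h \<in> M" using S(1) by (intro poly_M) (rule finite_subset)
    then have "((\<lambda>\<alpha>. cf (trunc_coeffs S h) \<alpha> * (\<Sum>\<^sub>\<infinity>\<beta>. cf x \<beta> * y (\<alpha> + \<beta>))) has_sum
      pairing (cf (trunc_coeffs S h * x)) y) UNIV"
      using that Y(2) by (intro pairing_mult(3) act_summable x) auto
    moreover have "((\<lambda>\<alpha>. cf (trunc_coeffs S h) \<alpha> * (\<Sum>\<^sub>\<infinity>\<beta>. cf x \<beta> * y (\<alpha> + \<beta>))) has_sum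
      (\<Sum>\<alpha>\<in>S. cf h \<alpha> * (\<Sum>\<^sub>\<infinity>\<beta>. cf x \<beta> * y (\<alpha> + \<beta>)))) UNIV"
      by (rule has_sum_finite_neutralI) (use S(1) in auto)
    ultimately show ?thesis by (rule has_sum_unique)
  qed
  then show ?thesis using S by (auto simp: dist_norm)
qed

text \<open>Weak approximation of \<open>v\<close> by multiples of \<open>f\<close> with factors
  from \<open>M\<close> instead of polynomials, so that inverses and infinite products may be used;
  polynomials return in \<open>appr_imp_cyclic\<close>.\<close>

definition appr :: "mser \<Rightarrow> mser \<Rightarrow> bool" where
  "appr f v \<longleftrightarrow> (\<forall>Y e. finite Y \<and> Y \<subseteq> dual \<and> e > 0 \<longrightarrow>
     (\<exists>q\<in>M. \<forall>y\<in>Y. cmod (pairing (cf (q * f)) y - pairing (cf v) y) < e))"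

lemma apprD: "appr f v \<Longrightarrow> finite Y \<Longrightarrow> Y \<subseteq> dual \<Longrightarrow> e > 0 \<Longrightarrow>
    \<exists>q\<in>M. \<forall>y\<in>Y. cmod (pairing (cf (q * f)) y - pairing (cf v) y) < e"
  by (simp add: appr_def)

lemma appr_eq: "q \<in> M \<Longrightarrow> q * f = v \<Longrightarrow> appr f v"
  unfolding appr_def by (intro allI impI bexI[of _ q]) auto

text \<open>The factor \<open>h\<close> is moved to the finitely many test functionals by
  transposition, which keeps them in the dual.\<close>

lemma appr_mult:
  assumes "appr f v" "h \<in> M" "f \<in> X" "v \<in> X"
  shows "appr (h * f) (h * v)"
  unfolding appr_def
proof (intro allI impI)
  fix Y and e :: real assume Y: "finite Y \<and> Y \<subseteq> dual \<and> e > 0"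
  have "adj h ` Y \<subseteq> dual" using Y assms(2) adj_dual by blast
  then obtain q where q: "q \<in> M" "\<forall>y\<in>Y. cmod (pairing (cf (q * f)) (adj h y) - pairing (cf v) (adj h y)) < e"
    using apprD[OF assms(1), of "adj h ` Y" e] Y by auto
  have "cmod (pairing (cf (q * (h * f))) y - pairing (cf (h * v)) y) < e" if y: "y \<in> Y" for y
  proof -
    have eq: "q * (h * f) = h * (q * f)" by (simp add: mult.left_commute)
    have "y \<in> dual" using y Y by blast
    then show ?thesis
      unfolding eq using q y pairing_act[OF assms(2) act[OF q(1) assms(3)], of y] pairing_act[OF assms(2,4), of y] by simp
  qed
  then show "\<exists>q\<in>M. \<forall>y\<in>Y. cmod (pairing (cf (q * (h * f))) y - pairing (cf (h * v)) y) < e"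
    using q(1) by blast
qed

lemma appr_trans:
  assumes fv: "appr f v" and vu: "appr v u" and X: "f \<in> X" "v \<in> X"
  shows "appr f u"
  unfolding appr_def
proof (intro allI impI)
  fix Y and e :: real assume Y: "finite Y \<and> Y \<subseteq> dual \<and> e > 0"
  then obtain q where q: "q \<in> M" "\<forall>y\<in>Y. cmod (pairing (cf (q * v)) y - pairing (cf u) y) < e / 2"
    using apprD[OF vu, of Y "e/2"] by auto
  have "adj q ` Y \<subseteq> dual" using Y q(1) adj_dual by blast
  then obtain r where r: "r \<in> M" "\<forall>y\<in>Y. cmod (pairing (cf (r * f)) (adj q y) - pairing (cf v) (adj q y)) < e / 2"
    using apprD[OF fv, of "adj q ` Y" "e/2"] Y by auto
  have "cmod (pairing (cf (q * r * f)) y - pairing (cf u) y) < e" if y: "y \<in> Y" for y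
  proof -
    have 1: "cmod (pairing (cf (q * (r * f))) y - pairing (cf (q * v)) y) < e / 2"
      using r y Y pairing_act[OF q(1) act[OF r(1) X(1)], of y] pairing_act[OF q(1) X(2), of y] by auto
    have 2: "cmod (pairing (cf (q * v)) y - pairing (cf u) y) < e / 2" using q y by blast
    show ?thesis using norm_diff_triangle_less[OF 1 2] by (simp add: mult.assoc)
  qed
  then show "\<exists>q\<in>M. \<forall>y\<in>Y. cmod (pairing (cf (q * f)) y - pairing (cf u) y) < e"
    using M_mult[OF q(1) r(1)] by blast
qed

text \<open>Multiplying an approximation of 1 by \<open>h n\<close> with the product
  \<open>P\<close> of the earlier factors gives \<open>P * h n\<close> approximating
  \<open>P\<close>, which approximates 1.\<close>

lemma appr_prod:
  fixes n :: nat
  assumes "\<And>i. i < n \<Longrightarrow> h i \<in> M \<and> h i \<in> X \<and> appr (h i) 1"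
  shows "prod h {..<n} \<in> M \<and> prod h {..<n} \<in> X \<and> appr (prod h {..<n}) 1"
  using assms
proof (induction n)
  case 0
  have "finite {\<alpha>. cf 1 \<alpha> \<noteq> 0}" by (rule finite_subset[of _ "{0}"]) (auto simp: cf_1)
  then have "1 \<in> M" by (rule poly_M)
  then show ?case using one_X by (auto intro: appr_eq[of 1])
next
  case (Suc n)
  let ?P = "prod h {..<n}"
  have P: "?P \<in> M" "?P \<in> X" "appr ?P 1" using Suc by auto
  have h: "h n \<in> M" "h n \<in> X" "appr (h n) 1" using Suc by auto
  have "appr (?P * h n) ?P" using appr_mult[OF h(3) P(1) h(2) one_X] by simp
  then have "appr (?P * h n) 1" using appr_trans[OF _ P(3)] act[OF P(1) h(2)] P(2) by blast
  then show ?case using M_mult[OF P(1) h(1)] act[OF P(1) h(2)] by simp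
qed

lemma appr_imp_cyclic:
  assumes f: "f \<in> X" and a: "appr f 1"
  shows "cyclic (cf ` X) (cf f)"
proof -
  let ?S = "{y \<in> cf ` X. \<exists>q. polynomial q \<and> (\<forall>z\<in>D_infty (cf ` X). series y z = series q z * series (cf f) z)}"
  have S: "cf (q * f) \<in> ?S" if q: "finite {\<alpha>. cf q \<alpha> \<noteq> 0}" for q
  proof -
    have "series (cf (q * f)) z = series (cf q) z * series (cf f) z" if "z \<in> D_infty (cf ` X)" for z
      using that f finite_support_has_sum(1)[OF q] by (intro conv_at_mult(2)) (auto simp: D_infty_iff)
    moreover have "polynomial (cf q)" using q by (simp add: polynomial_def)
    ultimately show ?thesis using act[OF poly_M[OF q] f] by blast
  qed
  have "cf x \<in> sigma_topology (cf ` X) closure_of ?S" if x: "x \<in> X" for x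
  proof (rule sigma_closure_I)
    \<comment> \<open>Three errors of \<open>e/3\<close>: \<open>x\<close> is truncated to a
      polynomial \<open>q\<close>, then \<open>q\<close> is approximated by \<open>q * r * f\<close>
      with a multiplier \<open>r\<close>, and finally \<open>q * r\<close> is truncated to a
      polynomial.\<close>
    fix Y and e :: real assume Y: "finite Y" "Y \<subseteq> dual" "e > 0"
    have "eventually (\<lambda>S. dist (\<Sum>\<alpha>\<in>S. cf x \<alpha> * y \<alpha>) (pairing (cf x) y) < e/3) (finite_subsets_at_top UNIV)"
      if "y \<in> Y" for y
    proof -
      have "(\<lambda>\<alpha>. cmod (cf x \<alpha> * y \<alpha>)) summable_on UNIV"
        using that Y(2) x by (auto simp: koethe_dual_def)
      then have "((\<lambda>\<alpha>. cf x \<alpha> * y \<alpha>) has_sum pairing (cf x) y) UNIV"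
        unfolding pairing_def by (rule has_sum_infsum[OF abs_summable_summable])
      then show ?thesis using Y(3) unfolding has_sum_def by (intro tendstoD) auto
    qed
    then have "eventually (\<lambda>S. \<forall>y\<in>Y. dist (\<Sum>\<alpha>\<in>S. cf x \<alpha> * y \<alpha>) (pairing (cf x) y) < e/3) (finite_subsets_at_top UNIV)"
      using Y(1) by (simp add: eventually_ball_finite)
    then obtain S where S0: "finite S" "\<forall>y\<in>Y. dist (\<Sum>\<alpha>\<in>S. cf x \<alpha> * y \<alpha>) (pairing (cf x) y) < e/3"
      using eventually_finite_subsetD by blast
    define q where "q = trunc_coeffs S x"
    have "{\<alpha>. cf q \<alpha> \<noteq> 0} \<subseteq> S" by (auto simp: q_def)
    then have q: "q \<in> M" using S0(1) by (intro poly_M) (rule finite_subset)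
    have 1: "cmod (pairing (cf q) y - pairing (cf x) y) < e/3" if "y \<in> Y" for y
    proof -
      have "((\<lambda>\<alpha>. cf q \<alpha> * y \<alpha>) has_sum (\<Sum>\<alpha>\<in>S. cf x \<alpha> * y \<alpha>)) UNIV"
        by (rule has_sum_finite_neutralI) (use S0(1) in \<open>auto simp: q_def\<close>)
      then have "pairing (cf q) y = (\<Sum>\<alpha>\<in>S. cf x \<alpha> * y \<alpha>)" unfolding pairing_def by (rule infsumI)
      then show ?thesis using S0(2) that by (simp add: dist_norm)
    qed
    have "adj q ` Y \<subseteq> dual" using Y q adj_dual by blast
    then obtain r where r: "r \<in> M" "\<forall>y\<in>Y. cmod (pairing (cf (r * f)) (adj q y) - pairing (cf 1) (adj q y)) < e/3"
      using apprD[OF a, of "adj q ` Y" "e/3"] Y by auto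
    have 2: "cmod (pairing (cf (q * r * f)) y - pairing (cf q) y) < e/3" if y: "y \<in> Y" for y
      using r y Y pairing_act[OF q act[OF r(1) f], of y] pairing_act[OF q one_X, of y] by (auto simp: mult.assoc)
    obtain T where T: "finite T"
      "\<forall>y\<in>Y. cmod (pairing (cf (trunc_coeffs T (q * r) * f)) y - pairing (cf (q * r * f)) y) < e/3"
      using pairing_trunc[OF M_mult[OF q r(1)] f Y(1,2), of "e/3"] Y(3) by auto
    have "finite {\<alpha>. cf (trunc_coeffs T (q * r)) \<alpha> \<noteq> 0}"
      by (rule finite_subset[OF _ T(1)]) auto
    from S[OF this] have "cf (trunc_coeffs T (q * r) * f) \<in> ?S" .
    moreover have "cmod (pairing (cf (trunc_coeffs T (q * r) * f)) y - pairing (cf x) y) < e" if y: "y \<in> Y" for y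
    proof -
      have "cmod (pairing (cf (trunc_coeffs T (q * r) * f)) y - pairing (cf q) y) < e/3 + e/3"
        using T(2) 2 y by (intro norm_diff_triangle_less[of _ "pairing (cf (q * r * f)) y"]) auto
      then have "cmod (pairing (cf (trunc_coeffs T (q * r) * f)) y - pairing (cf x) y) < (e/3 + e/3) + e/3"
        using 1[OF y] by (rule norm_diff_triangle_less)
      then show ?thesis by simp
    qed
    ultimately show "\<exists>v\<in>?S. \<forall>y\<in>Y. cmod (pairing v y - pairing (cf x) y) < e" by blast
  qed (use x in auto)
  moreover have "sigma_topology (cf ` X) closure_of ?S \<subseteq> cf ` X"
    using closure_of_subset_topspace[of "sigma_topology (cf ` X)" ?S] by (simp only: topspace_sigma)
  ultimately show ?thesis unfolding cyclic_def by blast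
qed

end

section \<open>The maximal ideal space\<close>

lemma multiindex_induct:
  assumes "P 0" "\<And>\<alpha> k. P \<alpha> \<Longrightarrow> P (\<alpha> + unit_index k)"
  shows "P \<alpha>"
proof (induction "mdeg \<alpha>" arbitrary: \<alpha>)
  case 0
  then have "\<alpha> = 0" by (metis mdeg_eq_0_iff)
  then show ?case using assms(1) by simp
next
  case (Suc n)
  then have "keys \<alpha> \<noteq> {}" by auto
  then obtain k where "k \<in> keys \<alpha>" by blast
  then obtain \<beta> where \<beta>: "\<alpha> = \<beta> + unit_index k" using diff_unit_add by metis
  then have "P \<beta>" using Suc by simp
  then show ?case unfolding \<beta> by (rule assms(2))
qed

lemma trunc_coeffs_eq_sum:
  assumes "finite S"
  shows "trunc_coeffs S x = (\<Sum>\<alpha>\<in>S. const (cf x \<alpha>) * monom \<alpha>)"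
  by (rule mser_eqI) (use assms in \<open>simp add: cf_monom if_distrib cong: if_cong\<close>)

text \<open>Modulo \<open>J\<close> the element \<open>y\<close> is the scalar \<open>k\<close>, so
  \<open>1 - c (1 / k) * y\<close> lies in \<open>J\<close> and \<open>proper_ideal_dist\<close>
  applies.\<close>

lemma (in banach_algebra) proper_ideal_scalar_bound:
  assumes J: "proper_ideal J" and y: "y \<in> A" and yk: "y - c k \<in> J"
  shows "cmod k \<le> N y"
proof (cases "k = 0")
  case False
  have "c (- 1 / k) * (y - c k) \<in> J" using proper_idealD(5)[OF J c_in yk] .
  moreover have "c (- 1 / k) * (y - c k) = 1 - c (1 / k) * y"
  proof -
    have "c (1 / k) * c k = 1" using False by (simp flip: c_mult)
    moreover have "c (- 1 / k) = - c (1 / k)" using c_minus[of "1 / k"] by simp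
    ultimately show ?thesis by (simp add: algebra_simps)
  qed
  ultimately have "1 \<le> N (1 - (1 - c (1 / k) * y))" using proper_ideal_dist[OF J] by metis
  also have "1 - (1 - c (1 / k) * y) = c (1 / k) * y" by simp
  also have "N \<dots> \<le> cmod (1 / k) * N y" by (rule N_scale_le[OF y])
  finally show ?thesis using False by (simp add: norm_divide field_simps)
qed (use y in auto)

locale series_algebra = weighted_algebra +
  fixes r :: "nat \<Rightarrow> real"
  assumes r_pos: "r j > 0"
    and r_dom: "(\<lambda>j. of_real (r j)) \<in> D_infty (cf ` X)"
begin

abbreviation \<Omega> :: "(nat \<Rightarrow> complex) set" where
  "\<Omega> \<equiv> D_infty (cf ` X)"

lemma conv: "z \<in> \<Omega> \<Longrightarrow> x \<in> X \<Longrightarrow> conv_at z x"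
  by (simp add: D_infty_iff)

lemma trunc_X: "x \<in> X \<Longrightarrow> trunc_coeffs S x \<in> X" "x \<in> X \<Longrightarrow> nrm (trunc_coeffs S x) \<le> nrm x"
  using X_mono[of x "trunc_coeffs S x"] by auto

lemma monom_X: "monom \<alpha> \<in> X"
  by (rule finite_support_X) (auto simp: cf_monom)

lemma trunc_approx_opnorm:
  assumes "x \<in> X" "e > 0"
  shows "\<exists>S. finite S \<and> qa.opnorm (x - trunc_coeffs S x) \<le> e"
proof -
  obtain S where S: "finite S" "x - trunc_coeffs S x \<in> X" "nrm (x - trunc_coeffs S x) \<le> e / K"
    using trunc_approx[of x "e / K"] assms qa.K_pos by auto
  have "qa.opnorm (x - trunc_coeffs S x) \<le> K * nrm (x - trunc_coeffs S x)" by (rule qa.opnorm_le[OF S(2)])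
  also have "\<dots> \<le> e" using S(3) qa.K_pos by (simp add: field_simps)
  finally show ?thesis using S(1) by blast
qed

lemma series_trunc:
  "finite S \<Longrightarrow> series (cf (trunc_coeffs S x)) z = (\<Sum>\<alpha>\<in>S. cf x \<alpha> * monomial_at z \<alpha>)"
  using finite_support_has_sum(2)[of S "trunc_coeffs S x" z] by auto

text \<open>Evaluation at a point of the domain is a character, hence bounded by the algebra norm
  with constant 1.\<close>

lemma eval_bound:
  assumes z: "z \<in> \<Omega>" and x: "x \<in> X"
  shows "cmod (series (cf x) z) \<le> qa.opnorm x"
proof (rule ba.character_bound[where \<phi> = "\<lambda>x. series (cf x) z"])
  show "\<exists>x\<in>X. series (cf x) z \<noteq> 0" by (intro bexI[of _ 1]) auto
qed (use z x in \<open>auto simp: series_add conv series_const_mult conv_at_mult(2)\<close>)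

text \<open>Adjusting the phases of the coefficients turns boundedness on truncations into absolute
  convergence.\<close>

lemma in_domain_if_bounded:
  assumes bd: "\<And>x S. x \<in> X \<Longrightarrow> finite S \<Longrightarrow>
    cmod (\<Sum>\<alpha>\<in>S. cf x \<alpha> * monomial_at l \<alpha>) \<le> qa.opnorm (trunc_coeffs S x)"
  shows "l \<in> \<Omega>"
  unfolding D_infty_iff conv_at_def
proof
  fix x assume x: "x \<in> X"
  define u where "u \<alpha> = cf x \<alpha> * monomial_at l \<alpha>" for \<alpha>
  \<comment> \<open>Where the monomial vanishes at \<open>l\<close>, the division yields 0 by
    convention and \<open>u \<alpha>\<close> is 0 as well, so \<open>yu\<close> holds there
    too.\<close>
  define y where "y = Ser (\<lambda>\<alpha>. of_real (cmod (u \<alpha>)) / monomial_at l \<alpha>)"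
  have yx: "cmod (cf y \<alpha>) \<le> cmod (cf x \<alpha>)" for \<alpha>
    by (cases "monomial_at l \<alpha> = 0") (auto simp: y_def u_def norm_divide norm_mult)
  have y: "y \<in> X" "nrm y \<le> nrm x" using X_mono[OF x yx] by auto
  have yu: "cf y \<alpha> * monomial_at l \<alpha> = of_real (cmod (u \<alpha>))" for \<alpha>
    by (cases "monomial_at l \<alpha> = 0") (auto simp: y_def u_def)
  have "(\<Sum>\<alpha>\<in>S. cmod (u \<alpha>)) \<le> K * nrm x" if S: "finite S" for S
  proof -
    have "(\<Sum>\<alpha>\<in>S. cmod (u \<alpha>)) = cmod (\<Sum>\<alpha>\<in>S. cf y \<alpha> * monomial_at l \<alpha>)"
      unfolding yu of_real_sum[symmetric] norm_of_real by (simp add: sum_nonneg)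
    also have "\<dots> \<le> qa.opnorm (trunc_coeffs S y)" by (rule bd[OF y(1) S])
    also have "\<dots> \<le> K * nrm (trunc_coeffs S y)" by (intro qa.opnorm_le trunc_X y)
    also have "\<dots> \<le> K * nrm x"
      using trunc_X(2)[OF y(1), of S] y(2) qa.K_pos by (intro mult_left_mono) auto
    finally show ?thesis .
  qed
  then show "(\<lambda>\<alpha>. cmod (cf x \<alpha> * monomial_at l \<alpha>)) summable_on UNIV"
    unfolding u_def by (intro nonneg_bdd_above_summable_on) (auto intro!: bdd_aboveI2)
qed

text \<open>The point consists of the values of \<open>\<phi>\<close> at the variables. Boundedness
  of \<open>\<phi>\<close> on truncations puts it into the domain, and then \<open>\<phi>\<close>
  and the evaluation agree on polynomials, hence by density everywhere.\<close>

lemma character_is_evaluation: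
  assumes add: "\<And>x y. x \<in> X \<Longrightarrow> y \<in> X \<Longrightarrow> \<phi> (x + y) = \<phi> x + \<phi> y"
    and mult: "\<And>x y. x \<in> X \<Longrightarrow> y \<in> X \<Longrightarrow> \<phi> (x * y) = \<phi> x * \<phi> y"
    and scale: "\<And>k x. x \<in> X \<Longrightarrow> \<phi> (const k * x) = k * \<phi> x"
    and nz: "\<exists>x\<in>X. \<phi> x \<noteq> 0"
  shows "\<exists>z\<in>\<Omega>. \<forall>x\<in>X. \<phi> x = series (cf x) z"
proof -
  have bound: "cmod (\<phi> x) \<le> qa.opnorm x" if "x \<in> X" for x
    by (rule ba.character_bound[OF add mult scale nz that])
  obtain y where y: "y \<in> X" "\<phi> y \<noteq> 0" using nz by blast
  have phi1: "\<phi> 1 = 1" using mult[OF y(1), of 1] y(2) by simp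
  define l where "l k = \<phi> (monom (unit_index k))" for k
  have mon: "\<phi> (monom \<alpha>) = monomial_at l \<alpha>" for \<alpha>
  proof (induction \<alpha> rule: multiindex_induct)
    case 1
    then show ?case by (simp add: phi1)
  next
    case (2 \<alpha> k)
    then show ?case by (simp add: monomial_at_add l_def mult monom_X flip: monom_mult)
  qed
  have phi_sum: "\<phi> (sum f S) = (\<Sum>i\<in>S. \<phi> (f i))" if "finite S" "\<And>i. i \<in> S \<Longrightarrow> f i \<in> X" for f and S :: "multiindex set"
    using that
  proof (induction S)
    case empty
    then show ?case using scale[of 1 0] by simp
  next
    case (insert i S)
    then have "sum f S \<in> X" by (intro qa.sum_in) auto
    then show ?case using insert add by simp
  qed
  have trunc: "\<phi> (trunc_coeffs S x) = (\<Sum>\<alpha>\<in>S. cf x \<alpha> * monomial_at l \<alpha>)" if "finite S" for S x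
  proof -
    have "\<phi> (trunc_coeffs S x) = (\<Sum>\<alpha>\<in>S. \<phi> (const (cf x \<alpha>) * monom \<alpha>))"
      unfolding trunc_coeffs_eq_sum[OF that] by (intro phi_sum that nrm_scale monom_X)
    then show ?thesis by (simp add: scale monom_X mon)
  qed
  have l: "l \<in> \<Omega>"
    by (rule in_domain_if_bounded) (use trunc bound trunc_X in metis)
  have "\<phi> x = series (cf x) l" if x: "x \<in> X" for x
  proof -
    have "cmod (\<phi> x - series (cf x) l) \<le> 0 + e" if e: "e > 0" for e
    proof -
      obtain S where S: "finite S" "qa.opnorm (x - trunc_coeffs S x) \<le> e / 2"
        using trunc_approx_opnorm[OF x, of "e/2"] e by auto
      define t where "t = trunc_coeffs S x"
      have tX: "t \<in> X" "x - t \<in> X" using x trunc_X by (auto simp: t_def)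
      have "\<phi> x = \<phi> (x - t) + \<phi> t" using add[OF tX(2,1)] by simp
      moreover have "series (cf x) l = series (cf (x - t)) l + series (cf t) l"
        using series_add[OF conv[OF l tX(2)] conv[OF l tX(1)]] by simp
      moreover have "\<phi> t = series (cf t) l" using trunc[OF S(1)] series_trunc[OF S(1)] by (simp add: t_def)
      ultimately have "\<phi> x - series (cf x) l = \<phi> (x - t) - series (cf (x - t)) l" by simp
      also have "cmod \<dots> \<le> cmod (\<phi> (x - t)) + cmod (series (cf (x - t)) l)" by (rule norm_triangle_ineq4)
      also have "\<dots> \<le> e / 2 + e / 2"
        using bound[OF tX(2)] eval_bound[OF l tX(2)] S(2) by (intro add_mono) (auto simp: t_def)
      finally show ?thesis by simp
    qed
    then have "cmod (\<phi> x - series (cf x) l) \<le> 0" by (rule field_le_epsilon)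
    then show ?thesis by simp
  qed
  with l show ?thesis by blast
qed

lemma invertible_if_nonzero:
  assumes x: "x \<in> X" and nz: "\<And>z. z \<in> \<Omega> \<Longrightarrow> series (cf x) z \<noteq> 0"
  shows "\<exists>b\<in>X. x * b = 1"
proof (rule ccontr)
  assume "\<not> ?thesis"
  then have "\<exists>J l. ba.proper_ideal J \<and> x \<in> J \<and> (\<forall>n. monom (unit_index n) - const (l n) \<in> J)"
    by (intro ba.proper_ideal_sequence[OF x _ monom_X]) blast
  then obtain J l where J: "ba.proper_ideal J" "x \<in> J" "\<And>n. monom (unit_index n) - const (l n) \<in> J" by blast
  note JD = ba.proper_idealD[OF J(1)]
  \<comment> \<open>Modulo \<open>J\<close> every polynomial is congruent to its value at
    \<open>l\<close>.\<close>
  have mon: "monom \<alpha> - const (monomial_at l \<alpha>) \<in> J" for \<alpha>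
  proof (induction \<alpha> rule: multiindex_induct)
    case 1
    then show ?case using JD(2) by simp
  next
    case (2 \<alpha> k)
    have "monom (\<alpha> + unit_index k) - const (monomial_at l (\<alpha> + unit_index k)) =
      monom \<alpha> * (monom (unit_index k) - const (l k)) + const (l k) * (monom \<alpha> - const (monomial_at l \<alpha>))"
      by (simp add: monomial_at_add const_mult algebra_simps flip: monom_mult)
    then show ?case using JD(4,5) 2 J(3) monom_X const_X by simp
  qed
  have trunc: "trunc_coeffs S y - const (\<Sum>\<alpha>\<in>S. cf y \<alpha> * monomial_at l \<alpha>) \<in> J" if "finite S" for S y
  proof -
    have "trunc_coeffs S y - const (\<Sum>\<alpha>\<in>S. cf y \<alpha> * monomial_at l \<alpha>) =
      (\<Sum>\<alpha>\<in>S. const (cf y \<alpha>) * (monom \<alpha> - const (monomial_at l \<alpha>)))"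
      using trunc_coeffs_eq_sum[OF that, of y]
      by (simp add: qa.c_sum const_mult right_diff_distrib sum_subtractf)
    also have "\<dots> \<in> J"
      using that by (induction S) (use JD(2,4,5) mon const_X in auto)
    finally show ?thesis .
  qed
  have l: "l \<in> \<Omega>"
  proof (rule in_domain_if_bounded)
    fix y and S :: "multiindex set" assume "y \<in> X" "finite S"
    then show "cmod (\<Sum>\<alpha>\<in>S. cf y \<alpha> * monomial_at l \<alpha>) \<le> qa.opnorm (trunc_coeffs S y)"
      by (intro ba.proper_ideal_scalar_bound[OF J(1)] trunc_X trunc)
  qed
  \<comment> \<open>\<open>J\<close> need not be closed, so a truncation \<open>t\<close> of
    \<open>x\<close> is used: \<open>t - x\<close> is congruent to the scalar \<open>t(l)\<close>
    modulo \<open>J\<close>, which bounds this scalar by the distance of \<open>t\<close> from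
    \<open>x\<close>.\<close>
  have "cmod (series (cf x) l) \<le> 0 + e" if e: "e > 0" for e
  proof -
    obtain S where S: "finite S" "qa.opnorm (x - trunc_coeffs S x) \<le> e / 2"
      using trunc_approx_opnorm[OF x, of "e/2"] e by auto
    define t where "t = trunc_coeffs S x"
    define k where "k = series (cf t) l"
    have tX: "t \<in> X" "x - t \<in> X" using x trunc_X by (auto simp: t_def)
    have "t - const k \<in> J" using trunc[OF S(1), of x] by (simp add: t_def k_def series_trunc[OF S(1)])
    then have "(t - const k) - x \<in> J" using J(2) JD(7) by blast
    then have "(t - x) - const k \<in> J" by (simp add: algebra_simps)
    then have "cmod k \<le> qa.opnorm (t - x)"
      using ba.proper_ideal_scalar_bound[OF J(1)] tX x by simp
    also have "\<dots> = qa.opnorm (x - t)" using ba.N_diff_commute[OF tX(1) x] .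
    finally have k: "cmod k \<le> e / 2" using S(2) by (simp add: t_def)
    have "series (cf x) l = series (cf (x - t)) l + k"
      using series_add[OF conv[OF l tX(2)] conv[OF l tX(1)]] by (simp add: k_def)
    also have "cmod \<dots> \<le> cmod (series (cf (x - t)) l) + cmod k" by (rule norm_triangle_ineq)
    also have "\<dots> \<le> e / 2 + e / 2"
      using eval_bound[OF l tX(2)] S(2) k by (intro add_mono) (auto simp: t_def)
    finally show ?thesis by simp
  qed
  then have "cmod (series (cf x) l) \<le> 0" by (rule field_le_epsilon)
  then show False using nz[OF l] by simp
qed

lemma absm_X: "x \<in> X \<Longrightarrow> absm x \<in> X"
  by (rule X_mono(1)) auto

sublocale module: multiplier_module X X
proof
  show "x \<in> X" if "y \<in> X" "\<And>\<alpha>. cmod (cf x \<alpha>) \<le> cmod (cf y \<alpha>)" for x y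
    using X_mono(1) that by blast
qed (auto simp: absm_X finite_support_X)

lemma cyclic_iff_nonzero:
  assumes x: "x \<in> X"
  shows "cyclic (cf ` X) (cf x) \<longleftrightarrow> (\<forall>z\<in>\<Omega>. series (cf x) z \<noteq> 0)"
proof
  assume "cyclic (cf ` X) (cf x)"
  then show "\<forall>z\<in>\<Omega>. series (cf x) z \<noteq> 0" using cyclic_imp_nonzero[of X x] by auto
next
  assume "\<forall>z\<in>\<Omega>. series (cf x) z \<noteq> 0"
  then obtain b where b: "b \<in> X" "x * b = 1" using invertible_if_nonzero[OF x] by blast
  then have "module.appr x 1" by (intro module.appr_eq[of b]) (auto simp: mult.commute)
  then show "cyclic (cf ` X) (cf x)" by (rule module.appr_imp_cyclic[OF x])
qed

section \<open>Power series as functions on the domain\<close>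

definition fn :: "mser \<Rightarrow> (nat \<Rightarrow> complex) \<Rightarrow> complex" where
  "fn x = realize (cf ` X) (cf x)"

lemma fn_eq: "fn x z = (if z \<in> \<Omega> then series (cf x) z else 0)"
  by (simp add: fn_def realize_def)

lemma series_space_eq: "series_space (cf ` X) = fn ` X"
  by (simp add: series_space_def image_image fn_def)

lemma fn_add: "x \<in> X \<Longrightarrow> y \<in> X \<Longrightarrow> fn (x + y) = (\<lambda>z. fn x z + fn y z)"
  by (auto simp: fn_eq series_add conv)

lemma fn_diff: "x \<in> X \<Longrightarrow> y \<in> X \<Longrightarrow> fn (x - y) = (\<lambda>z. fn x z - fn y z)"
  by (auto simp: fn_eq series_diff conv)

lemma fn_mult: "x \<in> X \<Longrightarrow> y \<in> X \<Longrightarrow> fn (x * y) = (\<lambda>z. fn x z * fn y z)"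
  by (auto simp: fn_eq conv_at_mult(2) conv)

lemma fn_scale: "fn (const k * x) = (\<lambda>z. k * fn x z)"
  by (auto simp: fn_eq series_const_mult)

lemma fn_one: "fn 1 = indicator \<Omega>"
  by (auto simp: fn_eq indicator_def)

lemma fn_zero_iff: assumes "x \<in> X" shows "fn x = (\<lambda>_. 0) \<longleftrightarrow> x = 0"
proof
  assume *: "fn x = (\<lambda>_. 0)"
  show "x = 0"
  proof (rule series_unique_zero[OF r_pos conv[OF r_dom assms]])
    fix z assume "\<And>i. cmod (z i) \<le> r i"
    then have "z \<in> \<Omega>" using r_pos by (intro D_infty_mono[OF r_dom]) (auto simp: less_imp_le)
    then show "series (cf x) z = 0" using fun_cong[OF *, of z] by (simp add: fn_eq)
  qed
next
  assume "x = 0"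
  then show "fn x = (\<lambda>_. 0)" using fn_scale[of 0 x] by simp
qed

lemma inj_fn: "inj_on fn X"
proof (rule inj_onI)
  fix x y assume xy: "x \<in> X" "y \<in> X" "fn x = fn y"
  then have "fn (x - y) = (\<lambda>_. 0)" by (simp add: fn_diff)
  then show "x = y" using fn_zero_iff[of "x - y"] xy by simp
qed

definition fn_norm :: "((nat \<Rightarrow> complex) \<Rightarrow> complex) \<Rightarrow> real" where
  "fn_norm f = qa.opnorm (the_inv_into X fn f)"

lemma fn_norm [simp]: "x \<in> X \<Longrightarrow> fn_norm (fn x) = qa.opnorm x"
  by (simp add: fn_norm_def the_inv_into_f_f[OF inj_fn])

lemma banach_algebra_on_fn: "banach_algebra_on \<Omega> (fn ` X) fn_norm"
proof -
  have "\<forall>F :: nat \<Rightarrow> (nat \<Rightarrow> complex) \<Rightarrow> complex. range F \<subseteq> fn ` X \<and>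
        (\<forall>e>0. \<exists>M. \<forall>m\<ge>M. \<forall>n\<ge>M. fn_norm (\<lambda>z. F m z - F n z) < e) \<longrightarrow>
        (\<exists>f\<in>fn ` X. (\<lambda>n. fn_norm (\<lambda>z. F n z - f z)) \<longlonglongrightarrow> 0)"
  proof (intro allI impI, elim conjE)
    fix F :: "nat \<Rightarrow> (nat \<Rightarrow> complex) \<Rightarrow> complex"
    assume F: "range F \<subseteq> fn ` X" and C: "\<forall>e>0. \<exists>M. \<forall>m\<ge>M. \<forall>n\<ge>M. fn_norm (\<lambda>z. F m z - F n z) < e"
    have "\<forall>n. \<exists>x. x \<in> X \<and> F n = fn x" using F by blast
    then obtain G where G: "\<And>n. G n \<in> X" "\<And>n. F n = fn (G n)" by metis
    have eq: "fn_norm (\<lambda>z. F m z - fn x z) = qa.opnorm (G m - x)" if "x \<in> X" for m x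
      using G that by (simp flip: fn_diff)
    have "\<exists>f\<in>X. (\<lambda>n. qa.opnorm (G n - f)) \<longlonglongrightarrow> 0"
    proof (rule ba.complete[OF G(1)])
      fix e :: real assume "e > 0"
      then show "\<exists>M. \<forall>m\<ge>M. \<forall>n\<ge>M. qa.opnorm (G m - G n) < e"
        using C eq[OF G(1)] by (simp flip: G(2))
    qed
    then obtain f where f: "f \<in> X" "(\<lambda>n. qa.opnorm (G n - f)) \<longlonglongrightarrow> 0" by blast
    then show "\<exists>f\<in>fn ` X. (\<lambda>n. fn_norm (\<lambda>z. F n z - f z)) \<longlonglongrightarrow> 0"
      by (intro bexI[of _ "fn f"]) (simp_all add: eq)
  qed
  moreover have "indicator \<Omega> \<in> fn ` X" "fn_norm (indicator \<Omega>) = 1"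
    using qa.one_in ba.N_one unfolding fn_one[symmetric] by auto
  moreover have "\<forall>f\<in>fn ` X. \<forall>c. (\<lambda>z. c * f z) \<in> fn ` X \<and> fn_norm (\<lambda>z. c * f z) = cmod c * fn_norm f"
  proof -
    \<comment> \<open>Exact homogeneity follows from the inequality \<open>N_scale_le\<close>
      applied with \<open>k\<close> and with \<open>1 / k\<close>.\<close>
    have "qa.opnorm (const k * x) = cmod k * qa.opnorm x" if x: "x \<in> X" for k x
    proof (rule antisym[OF ba.N_scale_le[OF x]])
      show "cmod k * qa.opnorm x \<le> qa.opnorm (const k * x)"
      proof (cases "k = 0")
        case False
        have "const (1 / k) * (const k * x) = x"
          using False by (simp flip: mult.assoc const_mult)
        then have "qa.opnorm x \<le> cmod (1 / k) * qa.opnorm (const k * x)"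
          using ba.N_scale_le[of "const k * x" "1 / k"] x const_X by simp
        then show ?thesis using False by (simp add: norm_divide field_simps)
      qed (use x in auto)
    qed
    then show ?thesis using const_X by (auto simp flip: fn_scale)
  qed
  moreover have "\<forall>f\<in>fn ` X. \<forall>g\<in>fn ` X. (\<lambda>z. f z + g z) \<in> fn ` X \<and> (\<lambda>z. f z * g z) \<in> fn ` X \<and>
    fn_norm (\<lambda>z. f z + g z) \<le> fn_norm f + fn_norm g \<and> fn_norm (\<lambda>z. f z * g z) \<le> fn_norm f * fn_norm g"
    using ba.N_triangle ba.N_mult by (auto simp flip: fn_add fn_mult)
  moreover have "\<forall>f\<in>fn ` X. fn_norm f \<ge> 0 \<and> (fn_norm f = 0 \<longleftrightarrow> f = (\<lambda>_. 0))"
    using ba.N_definite fn_zero_iff by auto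
  moreover have "\<forall>f\<in>fn ` X. \<forall>z. z \<notin> \<Omega> \<longrightarrow> f z = 0" by (auto simp: fn_eq)
  ultimately show ?thesis unfolding banach_algebra_on_def by simp
qed

lemma function_algebra:
  assumes "\<And>x. x \<in> X \<Longrightarrow> nrm' (cf x) = nrm x"
  shows "function_algebra_on_max_ideal_space (cf ` X) nrm'"
  unfolding function_algebra_on_max_ideal_space_def series_space_eq
proof (intro conjI allI)
  show "\<exists>N. banach_algebra_on \<Omega> (fn ` X) N \<and>
    (\<exists>c>0. \<exists>C>0. \<forall>x\<in>cf ` X. c * nrm' x \<le> N (realize (cf ` X) x) \<and> N (realize (cf ` X) x) \<le> C * nrm' x)"
    using banach_algebra_on_fn qa.K_pos qa.opnorm_le qa.M_le_opnorm
    by (intro exI[of _ fn_norm] conjI exI[of _ 1] exI[of _ K]) (auto simp: assms simp flip: fn_def)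
  fix \<phi> :: "((nat \<Rightarrow> complex) \<Rightarrow> complex) \<Rightarrow> complex"
  show "(complex_hom (fn ` X) \<phi> \<and> (\<exists>f\<in>fn ` X. \<phi> f \<noteq> 0)) = (\<exists>z\<in>\<Omega>. \<forall>f\<in>fn ` X. \<phi> f = f z)"
  proof
    assume *: "complex_hom (fn ` X) \<phi> \<and> (\<exists>f\<in>fn ` X. \<phi> f \<noteq> 0)"
    have "\<exists>z\<in>\<Omega>. \<forall>x\<in>X. \<phi> (fn x) = series (cf x) z"
    proof (rule character_is_evaluation)
      show "\<exists>x\<in>X. \<phi> (fn x) \<noteq> 0" using * by blast
    qed (use * in \<open>auto simp: complex_hom_def fn_add fn_mult fn_scale\<close>)
    then show "\<exists>z\<in>\<Omega>. \<forall>f\<in>fn ` X. \<phi> f = f z" by (auto simp: fn_eq)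
  next
    assume "\<exists>z\<in>\<Omega>. \<forall>f\<in>fn ` X. \<phi> f = f z"
    then obtain z where z: "z \<in> \<Omega>" "\<And>x. x \<in> X \<Longrightarrow> \<phi> (fn x) = fn x z" by blast
    have "\<phi> (fn 1) \<noteq> 0" using z by (simp add: fn_eq)
    then have "\<exists>f\<in>fn ` X. \<phi> f \<noteq> 0" using qa.one_in by blast
    moreover have "\<phi> (\<lambda>w. fn x w + fn y w) = fn x z + fn y z" "\<phi> (\<lambda>w. fn x w * fn y w) = fn x z * fn y z"
      if "x \<in> X" "y \<in> X" for x y
      using z(2)[of "x + y"] z(2)[of "x * y"] that by (simp_all add: fn_add fn_mult)
    moreover have "\<phi> (\<lambda>w. k * fn x w) = k * fn x z" if "x \<in> X" for x k
      using z(2)[of "const k * x"] that const_X by (simp add: fn_scale)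
    ultimately show "complex_hom (fn ` X) \<phi> \<and> (\<exists>f\<in>fn ` X. \<phi> f \<noteq> 0)"
      using z by (auto simp: complex_hom_def)
  qed
qed

end

section \<open>The domain of the critical spaces\<close>

lemma eq_cf_imageI:
  assumes "\<And>x. x \<in> D \<longleftrightarrow> Ser x \<in> A"
  shows "D = cf ` A"
proof (intro set_eqI iffI)
  fix x assume "x \<in> D"
  then have "Ser x \<in> A" by (simp only: assms)
  from imageI[OF this, of cf] show "x \<in> cf ` A" by simp
next
  fix x assume "x \<in> cf ` A"
  then obtain y where "x = cf y" "y \<in> A" by (rule imageE)
  then have "Ser x \<in> A" by (simp add: cf_inverse)
  then show "x \<in> D" by (simp only: assms)
qed

lemma D_space_eq:
  assumes "1 \<le> P"
  shows "D_space (ennreal P) s t = cf ` weighted_space.X P (weight s t)"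
proof (rule eq_cf_imageI)
  interpret weighted_space P "weight s t" by (rule weighted_space_weight[OF assms])
  show "x \<in> D_space (ennreal P) s t \<longleftrightarrow> Ser x \<in> X" for x
    using assms by (simp add: D_space_def lp_def X_def norm_mult less_imp_le)
qed

lemma D_norm_eq:
  assumes "1 \<le> P"
  shows "D_norm (ennreal P) s t (cf x) = weighted_space.nrm P (weight s t) x"
proof -
  interpret weighted_space P "weight s t" by (rule weighted_space_weight[OF assms])
  show ?thesis
    using assms by (simp add: D_norm_def lp_norm_def nrm_def norm_mult less_imp_le)
qed

lemma series_algebra_weight:
  assumes "weighted_algebra P (weight s t) K" "s \<ge> 0" "t \<ge> 0"
  shows "\<exists>r. series_algebra P (weight s t) K r"
proof -
  interpret weighted_algebra P "weight s t" K by (rule assms(1))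
  obtain r :: "nat \<Rightarrow> real" where r: "\<And>j. r j > 0"
    "(\<lambda>\<alpha>. cmod (monomial_at (\<lambda>j. of_real (r j)) \<alpha>) / weight s t \<alpha>) summable_on UNIV"
    using small_polydisc[OF assms(2,3)] by blast
  have "(\<lambda>j. of_real (r j)) \<in> D_infty (cf ` X)"
    unfolding D_infty_iff using conv_at_if_bounded[OF r(2) cf_le_nrm] by auto
  then have "series_algebra P (weight s t) K r" using r(1) by unfold_locales auto
  then show ?thesis by blast
qed

lemma series_lin:
  assumes "(\<lambda>k. cmod (b k * z k)) summable_on UNIV"
  shows "conv_at z (lin b)" "series (cf (lin b)) z = (\<Sum>\<^sub>\<infinity>k. b k * z k)"
proof -
  have inj: "inj unit_index" by (auto simp: inj_on_def)
  have zero: "cf (lin b) \<alpha> = 0" if "\<alpha> \<notin> range unit_index" for \<alpha>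
    using that degree_one[of \<alpha>] by (auto simp: cf_lin)
  have "(\<lambda>\<alpha>. cmod (cf (lin b) \<alpha> * monomial_at z \<alpha>)) summable_on range unit_index"
    using assms inj by (subst summable_on_reindex) (auto simp: o_def)
  then show "conv_at z (lin b)"
    unfolding conv_at_def by (rule summable_on_cong_neutral[THEN iffD1, rotated -1]) (use zero in auto)
  have "series (cf (lin b)) z = infsum (\<lambda>\<alpha>. cf (lin b) \<alpha> * monomial_at z \<alpha>) (range unit_index)"
    unfolding series_def by (rule infsum_cong_neutral) (use zero in auto)
  also have "\<dots> = (\<Sum>\<^sub>\<infinity>k. b k * z k)"
    using inj by (subst infsum_reindex) (auto simp: o_def)
  finally show "series (cf (lin b)) z = (\<Sum>\<^sub>\<infinity>k. b k * z k)" .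
qed

lemma series_lin_finite:
  assumes "\<And>k. k \<ge> m \<Longrightarrow> b k * z k = 0"
  shows "conv_at z (lin b)" "series (cf (lin b)) z = (\<Sum>k<m. b k * z k)"
proof -
  have "{k \<in> UNIV. cmod (b k * z k) \<noteq> 0} \<subseteq> {..<m}" proof
    fix k assume "k \<in> {k \<in> UNIV. cmod (b k * z k) \<noteq> 0}"
    then have "b k * z k \<noteq> 0" by simp
    then have "\<not> m \<le> k" using assms[of k] by blast
    then show "k \<in> {..<m}" by simp
  qed
  then have "finite {k \<in> UNIV. cmod (b k * z k) \<noteq> 0}" by (rule finite_subset) simp
  then have sm: "(\<lambda>k. cmod (b k * z k)) summable_on UNIV" by (rule finite_nonzero_values_imp_summable_on)
  show "conv_at z (lin b)" by (rule series_lin(1)[OF sm])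
  have "(\<Sum>\<^sub>\<infinity>k. b k * z k) = infsum (\<lambda>k. b k * z k) {..<m}"
    by (rule infsum_cong_neutral) (use assms in auto)
  then show "series (cf (lin b)) z = (\<Sum>k<m. b k * z k)" using series_lin(2)[OF sm] by simp
qed

lemma conv_at_power:
  assumes "conv_at z x"
  shows "conv_at z (x ^ n)" "series (cf (x ^ n)) z = series (cf x) z ^ n"
proof -
  have "conv_at z (x ^ n) \<and> series (cf (x ^ n)) z = series (cf x) z ^ n"
    by (induction n) (use assms in \<open>auto simp: conv_at_mult\<close>)
  then show "conv_at z (x ^ n)" "series (cf (x ^ n)) z = series (cf x) z ^ n" by auto
qed

text \<open>Since \<open>1 - 1 / q = 1 / P\<close>, the weight leaves
  \<open>multinomial \<alpha> powr (1 / P)\<close>, whose \<open>P\<close>-th power is a single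
  multinomial coefficient.\<close>

lemma multinomial_weight:
  assumes pq: "P > 1" "1 / P + 1 / q = 1"
  shows "(multinomial \<alpha> * cmod (monomial_at b \<alpha>) * weight s (1 / q) \<alpha>) powr P =
    (real (mdeg \<alpha>) + 1) powr (s * P) *
    (multinomial \<alpha> * cmod (monomial_at (\<lambda>j. of_real (cmod (b j) powr P)) \<alpha>))"
proof -
  have e: "1 - 1 / q = 1 / P" using pq by simp
  have "multinomial \<alpha> * cmod (monomial_at b \<alpha>) * weight s (1 / q) \<alpha> =
    (multinomial \<alpha> powr 1 * multinomial \<alpha> powr - (1 / q)) * cmod (monomial_at b \<alpha>) * (real (mdeg \<alpha>) + 1) powr s"
    by (simp add: weight_eq)
  also have "multinomial \<alpha> powr 1 * multinomial \<alpha> powr - (1 / q) = multinomial \<alpha> powr (1 / P)"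
    unfolding powr_add[symmetric] using e by simp
  also have "(multinomial \<alpha> powr (1 / P) * cmod (monomial_at b \<alpha>) * (real (mdeg \<alpha>) + 1) powr s) powr P =
    multinomial \<alpha> * cmod (monomial_at b \<alpha>) powr P * (real (mdeg \<alpha>) + 1) powr (s * P)"
    using pq by (simp add: powr_mult powr_powr)
  also have "cmod (monomial_at b \<alpha>) powr P = cmod (monomial_at (\<lambda>j. of_real (cmod (b j) powr P)) \<alpha>)"
    using pq by (intro monomial_at_powr) simp
  finally show ?thesis by (simp only: mult_ac)
qed

text \<open>By \<open>multinomial_weight\<close> the sum of the weighted \<open>P\<close>-th powers
  is the expansion of the \<open>n\<close>-th power of \<open>\<Sum> cmod (b k) powr P\<close>,
  times a factor depending only on the degree.\<close>

lemma nrm_lin_power_le: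
  assumes pq: "P > 1" "1 / P + 1 / q = 1" and V: "V \<ge> 0"
    and b: "(\<lambda>k. cmod (b k) powr P) summable_on UNIV" "(\<Sum>\<^sub>\<infinity>k. cmod (b k) powr P) \<le> V powr P"
  shows "lin b ^ n \<in> weighted_space.X P (weight s (1 / q))"
    "weighted_space.nrm P (weight s (1 / q)) (lin b ^ n) \<le> (real n + 1) powr s * V ^ n"
proof -
  interpret weighted_space P "weight s (1 / q)" by (rule weighted_space_weight) (use pq in simp)
  define bP where "bP j = complex_of_real (cmod (b j) powr P)" for j
  have bP: "(\<lambda>k. cmod (bP k)) summable_on UNIV" "(\<Sum>\<^sub>\<infinity>k. cmod (bP k)) \<le> V powr P"
    using b by (auto simp: bP_def)
  have "(\<Sum>\<alpha>\<in>S. (cmod (cf (lin b ^ n) \<alpha>) * weight s (1 / q) \<alpha>) powr P) \<le> ((real n + 1) powr s * V ^ n) powr P"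
    if S: "finite S" for S
  proof -
    have "(\<Sum>\<alpha>\<in>S. (cmod (cf (lin b ^ n) \<alpha>) * weight s (1 / q) \<alpha>) powr P) =
      (\<Sum>\<alpha>\<in>S. (real n + 1) powr (s * P) * (if mdeg \<alpha> = n then multinomial \<alpha> * cmod (monomial_at bP \<alpha>) else 0))"
      by (intro sum.cong refl)
        (auto simp: cf_lin_power norm_mult multinomial_weight[OF pq] bP_def[abs_def])
    also have "\<dots> \<le> (real n + 1) powr (s * P) * (V powr P) ^ n"
      unfolding sum_distrib_left[symmetric] by (intro mult_left_mono multinomial_sum_le bP S) simp
    also have "\<dots> = ((real n + 1) powr s * V ^ n) powr P"
    proof -
      have "(V powr P) ^ n = (V ^ n) powr P"
        using V by (induction n) (auto simp: powr_mult)
      then show ?thesis using V by (simp add: powr_mult powr_powr)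
    qed
    finally show ?thesis .
  qed
  from nrm_leI[OF this] V show "lin b ^ n \<in> X" "nrm (lin b ^ n) \<le> (real n + 1) powr s * V ^ n" by auto
qed

lemma exponential_not_polynomially_bounded:
  fixes a B s :: real
  assumes le: "\<And>n::nat. a ^ n \<le> B * (real n + 1) powr s"
  shows "a \<le> 1"
proof (rule ccontr)
  assume "\<not> a \<le> 1"
  then have a: "a > 1" by simp
  define u where "u = max s 1"
  have u: "u \<ge> 1" "s \<le> u" by (auto simp: u_def)
  have B: "B \<ge> 1" using le[of 0] by simp
  \<comment> \<open>Chosen with \<open>(x ^ n) powr u = 1 / a ^ n\<close>, so that
    \<open>(n + 1) * x ^ n\<close> tending to 0 contradicts the bound after raising to the power
    \<open>u\<close>. Taking \<open>u \<ge> 1\<close> only weakens the polynomial bound and gives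
    \<open>y powr u \<le> y\<close> on the unit interval.\<close>
  define x where "x = a powr - (1 / u)"
  have x: "0 < x" "x < 1" using a u by (auto simp: x_def powr_less_one)
  have "(\<lambda>n. real n * x ^ n) \<longlonglongrightarrow> 0" using powser_times_n_limit_0[of x] x by simp
  then have "(\<lambda>n. real (Suc n) * x ^ Suc n) \<longlonglongrightarrow> 0" by (rule LIMSEQ_Suc)
  moreover have "0 < x / (B + 1)" using x B by simp
  ultimately have "eventually (\<lambda>n. real (Suc n) * x ^ Suc n < x / (B + 1)) sequentially" by (rule order_tendstoD)
  then obtain n where n: "real (Suc n) * x ^ Suc n < x / (B + 1)" by (auto dest: eventually_happens)
  have "x * ((real n + 1) * x ^ n) < x * (1 / (B + 1))"
    using n by (simp add: algebra_simps)
  then have "(real n + 1) * x ^ n < 1 / (B + 1)"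
    using x(1) by (simp only: mult_less_cancel_left_pos)
  then have "((real n + 1) * x ^ n) powr u < (1 / (B + 1)) powr u"
    using u x by (intro powr_less_mono2) auto
  also have "\<dots> \<le> (1 / (B + 1)) powr 1" using powr_mono'[of 1 u "1 / (B + 1)"] u B by simp
  finally have "((real n + 1) * x ^ n) powr u < 1 / (B + 1)" using B by simp
  moreover have "((real n + 1) * x ^ n) powr u = (real n + 1) powr u / a ^ n"
  proof -
    have "(x ^ n) powr u = a powr (- (1 / u) * (real n * u))"
      using x a by (simp add: x_def powr_powr flip: powr_realpow)
    also have "\<dots> = inverse (a ^ n)" using u a by (simp add: powr_minus powr_realpow)
    finally show ?thesis using x by (simp add: powr_mult divide_inverse)
  qed
  ultimately have "(real n + 1) powr u / a ^ n < 1 / (B + 1)" by simp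
  then have "(B + 1) * (real n + 1) powr u < a ^ n" using a B by (simp add: divide_simps mult.commute)
  moreover have "B * (real n + 1) powr s \<le> (B + 1) * (real n + 1) powr u"
    using u B by (intro mult_mono powr_mono) auto
  ultimately show False using le[of n] by simp
qed

lemma nonneg_partial_sums_le:
  fixes f :: "nat \<Rightarrow> real"
  assumes f: "\<And>k. f k \<ge> 0" and le: "\<And>m. (\<Sum>k<m. f k) \<le> C"
  shows "f summable_on UNIV" "infsum f UNIV \<le> C"
proof -
  have "summable f" by (rule summableI_nonneg_bounded[OF f le])
  then have "(f has_sum suminf f) UNIV" using f by (intro sums_nonneg_imp_has_sum summable_sums) auto
  then show "f summable_on UNIV" "infsum f UNIV \<le> C"
    using suminf_le_const[OF \<open>summable f\<close> le] by (auto simp: has_sum_imp_summable infsumI)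
qed

lemma lp_finite: "q > 0 \<Longrightarrow> z \<in> lp (ennreal q) \<longleftrightarrow> (\<lambda>j. cmod (z j) powr q) summable_on UNIV"
  by (simp add: lp_def)

text \<open>The ball is contained in the domain by \<open>critical_weight_summable\<close>.
  Conversely, evaluation is bounded, and the powers of a linear form extremal for Hoelder's
  inequality at \<open>z\<close> have norms growing only polynomially beyond their geometric
  factor.\<close>

lemma D_infty_eq_closed_ball:
  assumes alg: "weighted_algebra P (weight s (1 / q)) K"
    and pq: "P > 1" "q > 1" "1 / P + 1 / q = 1" and s: "s > 1 / q"
  shows "D_infty (cf ` weighted_space.X P (weight s (1 / q))) = lp_closed_ball (ennreal q)"
proof -
  obtain r where "series_algebra P (weight s (1 / q)) K r"
    using series_algebra_weight[OF alg] s pq by (auto intro: less_imp_le less_trans[of 0 "1/q"])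
  then interpret series_algebra P "weight s (1 / q)" K r .
  show ?thesis
  proof (intro set_eqI iffI)
    fix z :: "nat \<Rightarrow> complex" assume "z \<in> lp_closed_ball (ennreal q)"
    then have z: "(\<lambda>j. cmod (z j) powr q) summable_on UNIV" "(\<Sum>\<^sub>\<infinity>j. cmod (z j) powr q) \<le> 1"
      using pq by (auto simp: lp_closed_ball_def lp_finite)
    have "s * q > 1" using s pq by (simp add: field_simps)
    then have "(\<lambda>\<alpha>. (cmod (monomial_at z \<alpha>) / weight s (1 / q) \<alpha>) powr q) summable_on UNIV"
      using z pq by (intro critical_weight_summable[OF _ z(1) refl]) auto
    then show "z \<in> \<Omega>" unfolding D_infty_iff using conv_at_Holder[OF pq] by blast
  next
    fix z :: "nat \<Rightarrow> complex" assume z: "z \<in> \<Omega>"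
    \<comment> \<open>The domain depends only on moduli; with nonnegative coordinates the extremal
      linear form has the real value \<open>S\<close>.\<close>
    define y where "y j = complex_of_real (cmod (z j))" for j
    have y: "y \<in> \<Omega>" by (rule D_infty_mono[OF z]) (simp add: y_def)
    have part: "(\<Sum>j<m. cmod (z j) powr q) \<le> 1" for m
    proof -
      define S where "S = (\<Sum>j<m. cmod (z j) powr q)"
      have S0: "S \<ge> 0" by (simp add: S_def sum_nonneg)
      \<comment> \<open>The equality case of Hoelder's inequality: the value at \<open>y\<close> is
        \<open>S\<close>, while the \<open>P\<close>-norm is \<open>S powr (1 / P)\<close>.\<close>
      define c where "c j = (if j < m then complex_of_real (cmod (z j) powr (q - 1)) else 0)" for j
      have Pq: "(q - 1) * P = q" using pq by (simp add: field_simps)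
      have cP: "cmod (c j) powr P = (if j < m then cmod (z j) powr q else 0)" for j
        using pq Pq by (simp add: c_def powr_powr)
      have "finite {j \<in> UNIV. cmod (c j) powr P \<noteq> 0}"
        by (rule finite_subset[of _ "{..<m}"]) (auto simp: cP)
      then have c1: "(\<lambda>j. cmod (c j) powr P) summable_on UNIV" by (rule finite_nonzero_values_imp_summable_on)
      have "(\<Sum>\<^sub>\<infinity>j. cmod (c j) powr P) = infsum (\<lambda>j. cmod (c j) powr P) {..<m}"
        by (rule infsum_cong_neutral) (auto simp: cP)
      also have "\<dots> = S" by (simp add: cP S_def)
      also have "S = (S powr (1 / P)) powr P" using S0 pq by (simp add: powr_powr)
      finally have c2: "(\<Sum>\<^sub>\<infinity>j. cmod (c j) powr P) \<le> (S powr (1 / P)) powr P" by simp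
      have ser: "series (cf (lin c)) y = S" "conv_at y (lin c)"
      proof -
        have "\<And>k. k \<ge> m \<Longrightarrow> c k * y k = 0" by (simp add: c_def)
        from series_lin_finite[of m c y, OF this] have ser_lin: "series (cf (lin c)) y = (\<Sum>k<m. c k * y k)"
          and "conv_at y (lin c)" by blast+
        then show "conv_at y (lin c)" by blast
        have "cmod (z j) powr (q - 1) * cmod (z j) = cmod (z j) powr q" for j
          using pq powr_mult_base[of "cmod (z j)" "q - 1"] by (simp add: mult.commute)
        then have "c j * y j = of_real (cmod (z j) powr q)" if "j < m" for j
          using that by (simp add: c_def y_def flip: of_real_mult)
        then show "series (cf (lin c)) y = S" unfolding ser_lin S_def of_real_sum by (intro sum.cong) auto
      qed
      have growth: "S ^ n \<le> K * (real n + 1) powr s * (S powr (1 / P)) ^ n" for n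
      proof -
        note np = nrm_lin_power_le[OF pq(1,3) _ c1 c2, where n = n and s = s]
        have L: "lin c ^ n \<in> X" "nrm (lin c ^ n) \<le> (real n + 1) powr s * (S powr (1 / P)) ^ n"
          using np by auto
        have "S ^ n = cmod (series (cf (lin c ^ n)) y)"
          using conv_at_power(2)[OF ser(2)] ser(1) S0 by (simp add: norm_power)
        also have "\<dots> \<le> qa.opnorm (lin c ^ n)" by (rule eval_bound[OF y L(1)])
        also have "\<dots> \<le> K * nrm (lin c ^ n)" by (rule qa.opnorm_le[OF L(1)])
        also have "\<dots> \<le> K * ((real n + 1) powr s * (S powr (1 / P)) ^ n)"
          using L(2) qa.K_pos by (intro mult_left_mono) auto
        finally show ?thesis by (simp add: mult.assoc)
      qed
      show "S \<le> 1" 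
      proof (cases "S = 0")
        case False
        then have S: "S > 0" using S0 by simp
        \<comment> \<open>Dividing the growth estimate by \<open>(S powr (1 / P)) ^ n\<close> leaves
          a geometric sequence bounded by a polynomial.\<close>
        have "S powr (1 / q) \<le> 1"
        proof (rule exponential_not_polynomially_bounded)
          fix n
          have "S = S powr (1 / q) * S powr (1 / P)"
            using S pq by (simp add: add.commute flip: powr_add)
          then have "(S powr (1 / q)) ^ n * (S powr (1 / P)) ^ n = S ^ n" by (metis power_mult_distrib)
          then have "(S powr (1 / q)) ^ n * (S powr (1 / P)) ^ n \<le> K * (real n + 1) powr s * (S powr (1 / P)) ^ n"
            using growth[of n] by simp
          then show "(S powr (1 / q)) ^ n \<le> K * (real n + 1) powr s" using S by simp
        qed
        moreover have "1 < S powr (1 / q)" if "S > 1" using powr_less_mono2[of "1 / q" 1 S] that pq by simp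
        ultimately show ?thesis by (meson not_le)
      qed simp
    qed
    show "z \<in> lp_closed_ball (ennreal q)"
      using nonneg_partial_sums_le[OF powr_ge_zero part] pq by (auto simp: lp_closed_ball_def lp_finite)
  qed
qed

lemma in_closed_ball_infinity: "z \<in> lp_closed_ball \<infinity> \<longleftrightarrow> (\<forall>j. cmod (z j) \<le> 1)"
proof
  assume "z \<in> lp_closed_ball \<infinity>"
  then have z: "bounded (range z)" "(SUP j. cmod (z j)) \<le> 1" by (auto simp: lp_closed_ball_def lp_def)
  obtain a where "\<And>j. cmod (z j) \<le> a" using z(1) by (auto simp: bounded_iff)
  then have "bdd_above (range (\<lambda>j. cmod (z j)))" by (intro bdd_aboveI2)
  then have "cmod (z j) \<le> (SUP j. cmod (z j))" for j by (rule cSUP_upper2) auto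
  then show "\<forall>j. cmod (z j) \<le> 1" using z(2) order_trans by blast
next
  assume z: "\<forall>j. cmod (z j) \<le> 1"
  then have "bounded (range z)" by (auto simp: bounded_iff)
  moreover have "(SUP j. cmod (z j)) \<le> 1" using z by (intro cSUP_least) auto
  ultimately show "z \<in> lp_closed_ball \<infinity>" by (simp add: lp_closed_ball_def lp_def)
qed

text \<open>For the converse inclusion, evaluation is tested on the monomials in one variable of
  exponent \<open>n\<close>, whose norms grow only like \<open>(n + 1) powr s\<close>.\<close>

lemma D_infty_eq_closed_polydisc:
  assumes s: "s \<ge> 0"
  shows "D_infty (cf ` weighted_space.X 1 (weight s 0)) = lp_closed_ball \<infinity>"
proof -
  obtain r where "series_algebra 1 (weight s 0) 1 r"
    using series_algebra_weight[OF weighted_algebra_weight_1[OF s order_refl] s order_refl] by blast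
  then interpret series_algebra 1 "weight s 0" 1 r .
  have w: "weight s 0 \<alpha> = (real (mdeg \<alpha>) + 1) powr s" for \<alpha> by (simp add: weight_eq)
  show ?thesis
  proof (intro set_eqI iffI)
    fix z :: "nat \<Rightarrow> complex" assume "z \<in> lp_closed_ball \<infinity>"
    then have z: "cmod (z j) \<le> 1" for j unfolding in_closed_ball_infinity by blast
    have mon: "cmod (monomial_at z \<alpha>) \<le> 1" for \<alpha>
      using monomial_at_mono[of z "\<lambda>_. 1" \<alpha>] z by (simp add: monomial_at_def)
    have "conv_at z x" if x: "x \<in> X" for x
      unfolding conv_at_def
    proof (rule summable_on_comparison_test[OF X_D[OF x]])
      fix \<alpha>
      have "(1::real) \<le> weight s 0 \<alpha>" unfolding w using s by (intro ge_one_powr_ge_zero) auto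
      then have "cmod (monomial_at z \<alpha>) \<le> weight s 0 \<alpha>" using mon[of \<alpha>] by simp
      then show "cmod (cf x \<alpha> * monomial_at z \<alpha>) \<le> (cmod (cf x \<alpha>) * weight s 0 \<alpha>) powr 1"
        by (simp add: norm_mult mult_left_mono)
    qed simp
    then show "z \<in> \<Omega>" by (simp add: D_infty_iff)
  next
    fix z :: "nat \<Rightarrow> complex" assume z: "z \<in> \<Omega>"
    have "cmod (z j) \<le> 1" for j
    proof (rule exponential_not_polynomially_bounded)
      fix n :: nat
      define \<alpha> where "\<alpha> = Poly_Mapping.single j n"
      have \<alpha>: "mdeg \<alpha> = n" "monomial_at z \<alpha> = z j ^ n"
        using mdeg_superset[of "{j}" \<alpha>] monomial_at_superset[of "{j}" \<alpha> z] by (auto simp: \<alpha>_def)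
      have "nrm (monom \<alpha>) \<le> weight s 0 \<alpha>"
      proof (rule nrm_leI)
        fix S :: "multiindex set" assume S: "finite S"
        have "(\<Sum>\<beta>\<in>S. (cmod (cf (monom \<alpha>) \<beta>) * weight s 0 \<beta>) powr 1) = (\<Sum>\<beta>\<in>S. if \<beta> = \<alpha> then weight s 0 \<beta> else 0)"
          by (intro sum.cong refl) (auto simp: cf_monom less_imp_le)
        also have "\<dots> \<le> weight s 0 \<alpha> powr 1" using S by (simp add: less_imp_le)
        finally show "(\<Sum>\<beta>\<in>S. (cmod (cf (monom \<alpha>) \<beta>) * weight s 0 \<beta>) powr 1) \<le> weight s 0 \<alpha> powr 1" .
      qed (simp add: less_imp_le)
      moreover have "cmod (z j) ^ n \<le> qa.opnorm (monom \<alpha>)"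
        using eval_bound[OF z monom_X[of \<alpha>]] by (simp add: \<alpha> norm_power)
      moreover have "qa.opnorm (monom \<alpha>) \<le> 1 * nrm (monom \<alpha>)" by (rule qa.opnorm_le[OF monom_X])
      ultimately show "cmod (z j) ^ n \<le> 1 * (real n + 1) powr s" by (simp add: w \<alpha>)
    qed
    then show "z \<in> lp_closed_ball \<infinity>" unfolding in_closed_ball_infinity by blast
  qed
qed

section \<open>Infinite products\<close>

text \<open>Finitely many factors may be non-invertible; beyond an index \<open>m\<close> where the
  remaining norms sum to less than 1/4, all partial products stay within 1/2 of 1, and so does the
  limit.\<close>

lemma (in banach_algebra) infinite_product:
  assumes a: "\<And>j. a j \<in> A" and sm: "summable (\<lambda>j::nat. N (a j))"
  shows "\<exists>m. \<exists>F\<in>A. (\<exists>b\<in>A. F * b = 1) \<and> (\<lambda>n. N ((\<Prod>j<n. 1 - a (j + m)) - F)) \<longlonglongrightarrow> 0"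
proof -
  obtain m where m: "\<And>n. norm (suminf (\<lambda>i. N (a (i + n)))) < 1/4 \<or> n < m"
    using suminf_exist_split[OF _ sm, of "1/4"] by (metis not_less zero_less_divide_1_iff zero_less_numeral)
  define u where "u j = N (a (j + m))" for j
  have u0: "u j \<ge> 0" for j using a by (simp add: u_def)
  have us: "summable u" unfolding u_def using sm by (rule summable_ignore_initial_segment)
  have "suminf u < 1/4" using m[of m] by (simp add: u_def[abs_def])
  then have part: "(\<Sum>j<n. u j) \<le> 1/4" for n
    using sum_le_suminf[OF us, of "{..<n}"] u0 by fastforce
  define Q where "Q n = (\<Prod>j<n. 1 - a (j + m))" for n
  have Q: "Q n \<in> A" for n using a by (simp add: Q_def)
  have step: "Q (Suc n) - Q n = - (Q n * a (n + m))" for n by (simp add: Q_def algebra_simps)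
  have Qu: "N (Q n * a (n + m)) \<le> N (Q n) * u n" for n unfolding u_def using Q a by (intro N_mult)
  \<comment> \<open>The induction hypothesis gives \<open>N (Q n) \<le> 2\<close>, which is where
    the factor 2 comes from.\<close>
  have near: "N (1 - Q n) \<le> 2 * (\<Sum>j<n. u j)" for n
  proof (induction n)
    case (Suc n)
    have "N (1 - Q n) \<le> 1" using Suc part[of n] by simp
    moreover have "N (1 - (1 - Q n)) \<le> N 1 + N (1 - Q n)" using Q by (intro N_diff_le) auto
    ultimately have "N (Q n) \<le> 2" by simp
    then have "N (Q n) * u n \<le> 2 * u n" using u0 by (intro mult_right_mono)
    then have "N (Q n * a (n + m)) \<le> 2 * u n" using Qu[of n] by linarith
    moreover have "N ((1 - Q n) + Q n * a (n + m)) \<le> N (1 - Q n) + N (Q n * a (n + m))"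
      using Q a by (intro N_triangle) auto
    moreover have "(1 - Q n) + Q n * a (n + m) = 1 - Q (Suc n)" using step[of n] by (simp add: algebra_simps)
    ultimately show ?case using Suc by simp
  qed (simp add: Q_def)
  have half: "N (1 - Q n) \<le> 1/2" for n using near[of n] part[of n] by linarith
  have "N (Q n) \<le> 2" for n
  proof -
    have "N (1 - (1 - Q n)) \<le> N 1 + N (1 - Q n)" using Q by (intro N_diff_le) auto
    then show ?thesis using half[of n] by simp
  qed
  then have "N (Q n) * u n \<le> 2 * u n" for n using u0 by (intro mult_right_mono)
  then have diff: "N (Q (Suc n) - Q n) \<le> 2 * u n" for n
    unfolding step using Qu[of n] Q a by (simp del: N_nonneg) (meson order_trans)
  have "\<exists>F\<in>A. (\<lambda>n. N (Q n - F)) \<longlonglongrightarrow> 0"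
    by (rule complete_summable[of Q "\<lambda>n. 2 * u n", OF Q diff]) (intro summable_mult us)
  then obtain F where F: "F \<in> A" "(\<lambda>n. N (Q n - F)) \<longlonglongrightarrow> 0" by blast
  have "N (1 - F) \<le> 1/2"
  proof (rule LIMSEQ_le_const)
    show "(\<lambda>n. 1/2 + N (Q n - F)) \<longlonglongrightarrow> 1/2" using tendsto_add[OF tendsto_const F(2), of "1/2"] by simp
    have "N (1 - F) \<le> 1/2 + N (Q n - F)" for n
    proof -
      have "N ((1 - Q n) + (Q n - F)) \<le> N (1 - Q n) + N (Q n - F)" using Q F by (intro N_triangle) auto
      then show ?thesis using half[of n] by simp
    qed
    then show "\<exists>n0. \<forall>n\<ge>n0. N (1 - F) \<le> 1/2 + N (Q n - F)" by blast
  qed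
  then have "\<exists>b\<in>A. F * b = 1" using F by (intro invertible_near_one) auto
  then show ?thesis using F unfolding Q_def by blast
qed

lemma sum_le_prod_one_plus:
  fixes u :: "nat \<Rightarrow> real"
  assumes "\<And>j. u j \<ge> 0"
  shows "1 + (\<Sum>j<n. u j) \<le> (\<Prod>j<n. 1 + u j)"
proof (induction n)
  case (Suc n)
  have "1 \<le> (\<Prod>j<n. 1 + u j)" using assms by (intro prod_ge_1) auto
  then have "1 * u n \<le> (\<Prod>j<n. 1 + u j) * u n" using assms by (intro mult_right_mono)
  then show ?case using Suc by (simp add: distrib_left)
qed simp

section \<open>Cyclicity of factorable functions\<close>

definition W :: "mser set" where
  "W = weighted_space.X 1 (weight 1 0)"

lemma weight_1_0: "weight 1 0 \<alpha> = real (mdeg \<alpha>) + 1"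
  by (simp add: weight_eq)

lemma W_iff: "x \<in> W \<longleftrightarrow> (\<lambda>\<alpha>. cmod (cf x \<alpha>) * (real (mdeg \<alpha>) + 1)) summable_on UNIV"
proof -
  interpret weighted_space 1 "weight 1 0" by (rule weighted_space_weight) simp
  show ?thesis by (simp add: W_def X_def weight_1_0)
qed

lemma W_mult: "g \<in> W \<Longrightarrow> h \<in> W \<Longrightarrow> g * h \<in> W"
proof -
  interpret weighted_algebra 1 "weight 1 0" 1 by (rule weighted_algebra_weight_1) auto
  show "g \<in> W \<Longrightarrow> h \<in> W \<Longrightarrow> g * h \<in> W" by (simp add: W_def mult_closed)
qed

lemma W_finite: "finite {\<alpha>. cf q \<alpha> \<noteq> 0} \<Longrightarrow> q \<in> W"
proof -
  interpret weighted_algebra 1 "weight 1 0" 1 by (rule weighted_algebra_weight_1) auto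
  show "finite {\<alpha>. cf q \<alpha> \<noteq> 0} \<Longrightarrow> q \<in> W" by (simp add: W_def finite_support_X)
qed

lemma W_absm: "h \<in> W \<Longrightarrow> absm h \<in> W"
  by (simp add: W_iff)

lemma W_complex_subalgebra: "complex_subalgebra W const"
proof -
  interpret weighted_algebra 1 "weight 1 0" 1 by (rule weighted_algebra_weight_1) auto
  show ?thesis unfolding W_def by (rule qa.complex_subalgebra_axioms)
qed

interpretation Walg: complex_subalgebra W const
  by (rule W_complex_subalgebra)

locale W_module = multiplier_module X W for X
begin

lemma W_subset: "h \<in> W \<Longrightarrow> h \<in> X"
  using act[OF _ one_X, of h] by simp

lemma pairing_diff:
  assumes "x \<in> X" "x' \<in> X" "y \<in> dual"
  shows "pairing (cf (x - x')) y = pairing (cf x) y - pairing (cf x') y"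
proof -
  have hs: "((\<lambda>\<alpha>. cf v \<alpha> * y \<alpha>) has_sum pairing (cf v) y) UNIV" if "v \<in> X" for v
  proof -
    have "(\<lambda>\<alpha>. cmod (cf v \<alpha> * y \<alpha>)) summable_on UNIV"
      using that assms(3) by (auto simp: koethe_dual_def)
    then show ?thesis unfolding pairing_def by (rule has_sum_infsum[OF abs_summable_summable])
  qed
  have "((\<lambda>\<alpha>. cf x \<alpha> * y \<alpha> + - (cf x' \<alpha> * y \<alpha>)) has_sum (pairing (cf x) y + - pairing (cf x') y)) UNIV"
    by (intro has_sum_add has_sum_uminusI hs assms)
  then have "((\<lambda>\<alpha>. cf (x - x') \<alpha> * y \<alpha>) has_sum (pairing (cf x) y - pairing (cf x') y)) UNIV"
    by (simp add: left_diff_distrib)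
  then show ?thesis unfolding pairing_def[of "cf (x - x')"] by (rule infsumI)
qed

text \<open>Since \<open>1 - l^m\<close> is a multiple of \<open>1 - l\<close>, it suffices that \<open>0\<close> is a weak cluster point of the
  powers \<open>l^m\<close>; otherwise testing on the series with coefficients \<open>c\<close> gives \<open>\<Sum> c < \<infinity>\<close>.\<close>

lemma appr_one_minus_lin:
  assumes b: "lin b \<in> W" and c: "\<And>n. c n \<ge> (0::real)" "\<not> summable c"
    and v: "Ser (\<lambda>\<alpha>. of_real (c (mdeg \<alpha>) * (multinomial \<alpha> * cmod (monomial_at b \<alpha>)))) \<in> X"
  shows "appr (1 - lin b) 1"
  unfolding appr_def
proof (intro allI impI, elim conjE)
  fix Y and e :: real assume Y: "finite Y" "Y \<subseteq> dual" "e > 0"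
  define D where "D m = {\<alpha>. mdeg \<alpha> = m}" for m
  \<comment> \<open>A bound for the modulus of the pairing of \<open>lin b ^ m\<close> with
    \<open>y\<close>, with absolute values inside so that it can be summed against
    \<open>c\<close>.\<close>
  define B where "B y m = infsum (\<lambda>\<alpha>. multinomial \<alpha> * cmod (monomial_at b \<alpha>) * cmod (y \<alpha>)) (D m)" for y m
  have powW: "lin b ^ m \<in> W" for m using b by simp
  have B0: "B y m \<ge> 0" for y m unfolding B_def by (intro infsum_nonneg) simp
  have cB: "summable (\<lambda>m. c m * B y m)" if y: "y \<in> Y" for y
  proof -
    define f where "f \<alpha> = c (mdeg \<alpha>) * (multinomial \<alpha> * cmod (monomial_at b \<alpha>) * cmod (y \<alpha>))" for \<alpha>
    have "(\<lambda>\<alpha>. cmod (of_real (c (mdeg \<alpha>) * (multinomial \<alpha> * cmod (monomial_at b \<alpha>))) * y \<alpha>)) summable_on UNIV"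
      using v y Y(2) unfolding koethe_dual_def by fastforce
    then have f: "f summable_on UNIV"
      using c(1) by (simp add: f_def[abs_def] norm_mult abs_mult mult.assoc)
    have fs: "f summable_on T" for T by (rule summable_on_subset_banach[OF f]) simp
    have "((\<lambda>(m, \<alpha>). f \<alpha>) has_sum infsum f UNIV) (Sigma UNIV D)"
      using has_sum_infsum[OF f]
      by (subst has_sum_reindex_bij_witness[of _ "\<lambda>\<alpha>. (mdeg \<alpha>, \<alpha>)" snd UNIV f]) (auto simp: D_def)
    then have "((\<lambda>m. infsum f (D m)) has_sum infsum f UNIV) UNIV"
      by (rule has_sum_SigmaD) (use fs in \<open>auto intro: has_sum_infsum\<close>)
    moreover have "infsum f (D m) = c m * B y m" for m
    proof -
      have "infsum f (D m) = infsum (\<lambda>\<alpha>. c m * (multinomial \<alpha> * cmod (monomial_at b \<alpha>) * cmod (y \<alpha>))) (D m)"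
        by (rule infsum_cong) (simp add: f_def D_def)
      then show ?thesis by (simp add: B_def infsum_cmult_right')
    qed
    ultimately have "((\<lambda>m. c m * B y m) has_sum infsum f UNIV) UNIV" by simp
    then show ?thesis using has_sum_imp_sums sums_summable by blast
  qed
  \<comment> \<open>One \<open>m\<close> must serve all functionals of \<open>Y\<close>, so their
    bounds are added before comparing with the divergent series of \<open>c\<close>.\<close>
  have "\<exists>m. (\<Sum>y\<in>Y. B y m) < e"
  proof (rule ccontr)
    assume "\<not> ?thesis"
    then have ge: "e \<le> (\<Sum>y\<in>Y. B y m)" for m by (simp add: not_less)
    have sm: "summable (\<lambda>m. (\<Sum>y\<in>Y. c m * B y m) / e)"
      by (intro summable_divide summable_sum cB)
    have le: "norm (c m) \<le> (\<Sum>y\<in>Y. c m * B y m) / e" for m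
    proof -
      have "c m * e \<le> c m * (\<Sum>y\<in>Y. B y m)" using ge c by (intro mult_left_mono) auto
      then have "c m \<le> (\<Sum>y\<in>Y. c m * B y m) / e"
        unfolding sum_distrib_left by (simp only: pos_le_divide_eq[OF Y(3)])
      then show ?thesis using c(1)[of m] by simp
    qed
    have "summable c" by (rule summable_comparison_test'[OF sm, of 0]) (rule le)
    then show False using c(2) by simp
  qed
  then obtain m where m: "(\<Sum>y\<in>Y. B y m) < e" by blast
  define q where "q = (\<Sum>i<m. lin b ^ i)"
  have q: "q \<in> W" unfolding q_def by (intro Walg.sum_in powW)
  have eq: "q * (1 - lin b) = 1 - lin b ^ m"
    using one_diff_power_eq[of "lin b" m] by (simp add: q_def mult.commute)
  have "cmod (pairing (cf (q * (1 - lin b))) y - pairing (cf 1) y) < e" if y: "y \<in> Y" for y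
  proof -
    have pX: "lin b ^ m \<in> X" by (rule W_subset[OF powW])
    have sm: "(\<lambda>\<alpha>. cmod (cf (lin b ^ m) \<alpha> * y \<alpha>)) summable_on UNIV"
      using pX y Y(2) by (auto simp: koethe_dual_def)
    have "pairing (cf (1 - lin b ^ m)) y - pairing (cf 1) y = - pairing (cf (lin b ^ m)) y"
      using pairing_diff[OF one_X pX] y Y(2) by auto
    also have "cmod \<dots> = cmod (\<Sum>\<^sub>\<infinity>\<alpha>. cf (lin b ^ m) \<alpha> * y \<alpha>)" by (simp add: pairing_def)
    also have "\<dots> \<le> (\<Sum>\<^sub>\<infinity>\<alpha>. cmod (cf (lin b ^ m) \<alpha> * y \<alpha>))"
      by (rule norm_infsum_bound[OF sm])
    also have "\<dots> = B y m"
      unfolding B_def by (rule infsum_cong_neutral) (auto simp: D_def cf_lin_power norm_mult)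
    also have "\<dots> \<le> (\<Sum>y\<in>Y. B y m)" using Y(1) y B0 by (intro member_le_sum) auto
    also have "\<dots> < e" by (rule m)
    finally show ?thesis unfolding eq .
  qed
  then show "\<exists>q\<in>W. \<forall>y\<in>Y. cmod (pairing (cf (q * (1 - lin b))) y - pairing (cf 1) y) < e" using q by blast
qed

end

text \<open>The factor 2 is the weight of degree 1.\<close>

lemma lin_in_W:
  assumes "(\<lambda>k. cmod (b k)) summable_on UNIV"
  shows "lin b \<in> W" "weighted_space.nrm 1 (weight 1 0) (lin b) = 2 * (\<Sum>\<^sub>\<infinity>k. cmod (b k))"
proof -
  interpret weighted_space 1 "weight 1 0" by (rule weighted_space_weight) simp
  have eq: "(\<lambda>k. (cmod (b k) * weight 1 0 (unit_index k)) powr 1) = (\<lambda>k. 2 * cmod (b k))"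
    by (simp add: weight_1_0 fun_eq_iff)
  have sm: "(\<lambda>k. (cmod (b k) * weight 1 0 (unit_index k)) powr 1) summable_on UNIV"
    unfolding eq by (intro summable_on_cmult_right assms)
  show "lin b \<in> W" unfolding W_def by (rule lin_X(1)[OF sm])
  show "nrm (lin b) = 2 * (\<Sum>\<^sub>\<infinity>k. cmod (b k))"
    using lin_X(2)[OF sm] unfolding eq by (simp add: infsum_cmult_right')
qed

text \<open>\<open>Bl\<close> stands for the open ball of the nonvanishing condition, and \<open>test_series\<close> provides the
  coefficients for the preceding argument.\<close>

locale critical_module = W_module X for X +
  fixes Bl :: "(nat \<Rightarrow> complex) set" and r :: "nat \<Rightarrow> real"
  assumes r_pos: "r j > 0" and r_le: "r j \<le> 1"
    and r_dom: "(\<lambda>j. of_real (r j)) \<in> D_infty (cf ` X)"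
    and zero_Bl: "(\<lambda>_. 0) \<in> Bl"
    and test_series: "(\<And>z m. z \<in> Bl \<Longrightarrow> z \<in> D_infty (cf ` X) \<Longrightarrow> (\<And>k. k \<ge> m \<Longrightarrow> z k = 0) \<Longrightarrow> (\<Sum>k<m. b k * z k) \<noteq> 1) \<Longrightarrow>
      \<exists>c. (\<forall>n. c n \<ge> 0) \<and> \<not> summable c \<and>
        Ser (\<lambda>\<alpha>. of_real (c (mdeg \<alpha>) * (multinomial \<alpha> * cmod (monomial_at b \<alpha>)))) \<in> X"
begin

lemma D_inftyI: "(\<And>i. cmod (z i) \<le> r i) \<Longrightarrow> z \<in> D_infty (cf ` X)"
  using r_pos by (intro D_infty_mono[OF r_dom]) (auto simp: less_imp_le)

theorem factorable_cyclic:
  assumes x: "x \<in> X" and fac: "factorable (cf ` X) (cf x)"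
    and nz: "\<And>z. z \<in> Bl \<Longrightarrow> series (cf x) z \<noteq> 0"
  shows "cyclic (cf ` X) (cf x)"
proof -
  obtain g P where aff: "\<And>j. affine_linear (g j)" and l1: "\<And>j. g j \<in> lp 1"
    and P: "P > 0" "(\<lambda>j. l1_norm (g j)) has_prod P"
    and lim: "\<And>z. z \<in> D_infty (cf ` X) \<Longrightarrow> (\<lambda>n. \<Prod>j<n. series (g j) z) \<longlonglongrightarrow> series (cf x) z"
    using fac unfolding factorable_def by blast
  have gsum: "(\<lambda>\<alpha>. cmod (g j \<alpha>)) summable_on UNIV" for j using l1[of j] by (simp add: lp_def)
  define a where "a j = g j 0" for j
  have at0: "series y (\<lambda>_. 0) = y 0" for y
  proof -
    have "monomial_at (\<lambda>_. 0) \<alpha> = 0" if \<alpha>: "\<alpha> \<noteq> 0" for \<alpha>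
    proof -
      have "keys \<alpha> \<noteq> {}" using \<alpha> by simp
      then obtain k where "k \<in> keys \<alpha>" by blast
      then show ?thesis unfolding monomial_at_def by (intro prod_zero) (auto simp: in_keys_iff)
    qed
    then have "series y (\<lambda>_. 0) = infsum (\<lambda>\<alpha>. y \<alpha> * monomial_at (\<lambda>_. 0) \<alpha>) {0}"
      unfolding series_def by (intro infsum_cong_neutral) auto
    then show ?thesis by simp
  qed
  have x0: "cf x 0 \<noteq> 0" using nz[OF zero_Bl] by (simp add: at0)
  have zero_dom: "(\<lambda>_. 0) \<in> D_infty (cf ` X)" using r_pos by (intro D_inftyI) (simp add: less_imp_le)
  have alim: "(\<lambda>n. \<Prod>j<n. a j) \<longlonglongrightarrow> cf x 0" using lim[OF zero_dom] by (simp add: at0 a_def)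
  \<comment> \<open>A vanishing factor makes all later partial products 0. This is used at the
    origin for the constant terms and on \<open>Bl\<close> for the single factors.\<close>
  have factor_nz: "f j \<noteq> 0" if l: "(\<lambda>n. \<Prod>j<n. f j) \<longlonglongrightarrow> L" "L \<noteq> 0" for f :: "nat \<Rightarrow> complex" and L j
  proof
    assume fj: "f j = 0"
    have "eventually (\<lambda>n. (\<Prod>j<n. f j) = 0) sequentially"
      by (rule eventually_mono[OF eventually_gt_at_top[of j]]) (use fj in \<open>auto intro!: prod_zero\<close>)
    then have "(\<lambda>n. \<Prod>j<n. f j) \<longlonglongrightarrow> 0" by (rule tendsto_eventually)
    then show False using l LIMSEQ_unique by blast
  qed
  have a_nz: "a j \<noteq> 0" for j using factor_nz[OF alim x0] .
  \<comment> \<open>The normalization \<open>g j = a j * (1 - lin (b j))\<close>.\<close>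
  define b where "b j k = - g j (unit_index k) / a j" for j k
  have gj: "g j = cf (const (a j) * (1 - lin (b j)))" for j
  proof
    fix \<alpha>
    show "g j \<alpha> = cf (const (a j) * (1 - lin (b j))) \<alpha>"
    proof (cases "mdeg \<alpha> = 0 \<or> mdeg \<alpha> = 1")
      case True
      then show ?thesis
      proof
        assume "mdeg \<alpha> = 1"
        then obtain k where "\<alpha> = unit_index k" using degree_one by blast
        moreover have "unit_index k \<noteq> 0" by (metis mdeg_0 mdeg_unit zero_neq_one)
        ultimately show ?thesis using a_nz[of j] by (simp add: cf_1 b_def)
      qed (simp add: a_def cf_1 cf_lin)
    next
      case False
      then have "mdeg \<alpha> > 1" by linarith
      then show ?thesis using aff[of j] by (auto simp: affine_linear_def cf_1 cf_lin)
    qed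
  qed
  have inj: "inj unit_index" by (auto simp: inj_on_def)
  have bsum: "(\<lambda>k. cmod (b j k)) summable_on UNIV" for j
  proof -
    have "(\<lambda>\<alpha>. cmod (g j \<alpha>)) summable_on range unit_index"
      by (rule summable_on_subset_banach[OF gsum]) simp
    then have "(\<lambda>k. cmod (g j (unit_index k))) summable_on UNIV"
      using inj by (subst (asm) summable_on_reindex) (auto simp: o_def)
    then have "(\<lambda>k. inverse (cmod (a j)) * cmod (g j (unit_index k))) summable_on UNIV"
      by (rule summable_on_cmult_right)
    then show ?thesis by (simp add: b_def norm_divide inverse_eq_divide)
  qed
  define u where "u j = (\<Sum>\<^sub>\<infinity>k. cmod (b j k))" for j
  have u0: "u j \<ge> 0" for j unfolding u_def by (intro infsum_nonneg) simp
  have l1_ge: "cmod (a j) * (1 + u j) \<le> l1_norm (g j)" for j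
  proof -
    have "infsum (\<lambda>\<alpha>. cmod (g j \<alpha>)) (range unit_index) = (\<Sum>\<^sub>\<infinity>k. cmod (a j) * cmod (b j k))"
      using inj a_nz[of j] by (subst infsum_reindex) (auto simp: o_def b_def norm_divide)
    also have "\<dots> = cmod (a j) * u j" by (simp add: u_def infsum_cmult_right')
    finally have 1: "infsum (\<lambda>\<alpha>. cmod (g j \<alpha>)) (range unit_index) = cmod (a j) * u j" .
    have z: "0 \<notin> range unit_index" by (metis imageE mdeg_0 mdeg_unit zero_neq_one)
    have sub: "(\<lambda>\<alpha>. cmod (g j \<alpha>)) summable_on T" for T
      by (rule summable_on_subset_banach[OF gsum]) simp
    have "infsum (\<lambda>\<alpha>. cmod (g j \<alpha>)) (insert 0 (range unit_index)) = cmod (a j) + cmod (a j) * u j"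
      using infsum_insert[OF sub z] by (simp add: 1 a_def)
    moreover have "infsum (\<lambda>\<alpha>. cmod (g j \<alpha>)) (insert 0 (range unit_index)) \<le> l1_norm (g j)"
      unfolding l1_norm_def by (intro infsum_mono2 sub) auto
    ultimately show ?thesis by (simp add: distrib_left)
  qed
  \<comment> \<open>The quotients \<open>l1_norm (g j) / cmod (a j)\<close> dominate
    \<open>1 + u j\<close>, and their partial products converge to \<open>P / cmod (cf x 0)\<close>;
    bounded products of \<open>1 + u j\<close> bound the partial sums of \<open>u\<close>.\<close>
  have usum: "summable u"
  proof -
    have "raw_has_prod (\<lambda>j. l1_norm (g j)) 0 P" using P by (auto simp: has_prod_def)
    then have "(\<lambda>n. \<Prod>j\<le>n. l1_norm (g j)) \<longlonglongrightarrow> P" by (simp add: raw_has_prod_def)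
    then have "(\<lambda>n. (\<Prod>j\<le>n. l1_norm (g j)) / cmod (\<Prod>j\<le>n. a j)) \<longlonglongrightarrow> P / cmod (cf x 0)"
      using LIMSEQ_Suc[OF alim] x0 by (intro tendsto_divide tendsto_norm) (auto simp: lessThan_Suc_atMost)
    then have "Bseq (\<lambda>n. (\<Prod>j\<le>n. l1_norm (g j)) / cmod (\<Prod>j\<le>n. a j))" by (rule convergentI[THEN convergent_imp_Bseq])
    then obtain C where C: "\<And>n. norm ((\<Prod>j\<le>n. l1_norm (g j)) / cmod (\<Prod>j\<le>n. a j)) \<le> C" by (auto simp: Bseq_def)
    have bd: "(\<Sum>j<n. u j) \<le> C" for n
    proof -
      have "(\<Sum>j<n. u j) \<le> (\<Sum>j<Suc n. u j)" using u0 by simp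
      also have "\<dots> \<le> (\<Prod>j<Suc n. 1 + u j)" using sum_le_prod_one_plus[of u "Suc n"] u0 by simp
      also have "\<dots> \<le> (\<Prod>j<Suc n. l1_norm (g j) / cmod (a j))"
        using l1_ge a_nz u0 by (intro prod_mono) (auto simp: field_simps)
      also have "\<dots> = (\<Prod>j\<le>n. l1_norm (g j)) / cmod (\<Prod>j\<le>n. a j)"
        by (simp add: prod_dividef prod_norm lessThan_Suc_atMost)
      also have "\<dots> \<le> C" using order_trans[OF abs_ge_self C[of n, unfolded real_norm_def]] .
      finally show ?thesis .
    qed
    show ?thesis by (rule summableI_nonneg_bounded[OF u0 bd])
  qed
  obtain rW where "series_algebra 1 (weight 1 0) 1 rW"
    using series_algebra_weight[OF weighted_algebra_weight_1[of 1 0]] by auto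
  then interpret V: series_algebra 1 "weight 1 0" 1 rW .
  have VW: "V.X = W" by (simp add: W_def)
  have linW: "lin (b j) \<in> W" for j by (rule lin_in_W(1)[OF bsum])
  have "summable (\<lambda>j. V.qa.opnorm (lin (b j)))"
  proof (rule summable_comparison_test')
    show "summable (\<lambda>j. 2 * u j)" by (intro summable_mult usum)
    show "norm (V.qa.opnorm (lin (b j))) \<le> 2 * u j" for j
      using V.qa.opnorm_le[of "lin (b j)"] V.qa.opnorm_nonneg[of "lin (b j)"] linW[of j] lin_in_W(2)[OF bsum[of j]]
      by (simp add: VW u_def)
  qed
  then obtain m F G where F: "F \<in> W" "G \<in> W" "F * G = 1"
    "(\<lambda>n. V.qa.opnorm ((\<Prod>j<n. 1 - lin (b (j + m))) - F)) \<longlonglongrightarrow> 0"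
    using V.ba.infinite_product[of "\<lambda>j. lin (b j)"] linW unfolding VW by blast
  define h where "h j = 1 - lin (b j)" for j
  have hW: "h j \<in> W" for j using linW by (simp add: h_def)
  define H where "H = prod h {..<m}"
  have HW: "H \<in> W" unfolding H_def using hW by (intro Walg.prod_in)
  \<comment> \<open>The factorization is known only pointwise on the domain. \<open>T\<close> is the
    element of \<open>W\<close> that it suggests: constant term, finitely many factors, and the
    invertible tail \<open>F\<close>. Equality with \<open>x\<close> follows by uniqueness of
    coefficients.\<close>
  define T where "T = const (cf x 0) * (H * F)"
  have TW: "T \<in> W" using HW F by (simp add: T_def)
  have inV: "z \<in> D_infty (cf ` W)" if "\<And>i. cmod (z i) \<le> 1" for z
  proof -
    have "z \<in> lp_closed_ball \<infinity>" unfolding in_closed_ball_infinity using that by blast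
    then show ?thesis using D_infty_eq_closed_polydisc[of 1] by (simp add: W_def)
  qed
  have convW: "conv_at z y" if "\<And>i. cmod (z i) \<le> 1" "y \<in> W" for z y
    using inV[OF that(1)] that(2) by (simp add: D_infty_iff)
  have prod_series: "series (cf (prod f S)) z = (\<Prod>i\<in>S. series (cf (f i)) z) \<and> conv_at z (prod f S)"
    if "\<And>i. conv_at z (f i)" "finite S" for f z and S :: "nat set"
    using that(2) by (induction S) (use that(1) in \<open>auto simp: conv_at_mult\<close>)
  \<comment> \<open>On this polydisc the hypothesis applies because it lies in the domain of
    \<open>X\<close>, and the series of \<open>W\<close> converge because the radii are at most
    1.\<close>
  have eq_on: "series (cf T) z = series (cf x) z" if z: "\<And>i. cmod (z i) \<le> r i" for z
  proof -
    have z1: "cmod (z i) \<le> 1" for i using z[of i] r_le[of i] by simp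
    have zD: "z \<in> D_infty (cf ` X)" using z by (rule D_inftyI)
    have cv: "conv_at z y" if "y \<in> W" for y by (rule convW[OF z1 that])
    have zW: "z \<in> D_infty (cf ` W)" by (rule inV) (rule z1)
    define s where "s j = series (cf (h j)) z" for j
    have gs: "series (g j) z = a j * s j" for j
      unfolding gj series_const_mult by (simp add: s_def h_def)
    define Q where "Q n = (\<Prod>j<n. h (j + m))" for n
    have QW: "Q n \<in> W" for n unfolding Q_def using hW by (intro Walg.prod_in)
    have "(\<lambda>n. series (cf (Q n)) z - series (cf F) z) \<longlonglongrightarrow> 0"
    proof (rule Lim_null_comparison[OF _ F(4)])
      have "norm (series (cf (Q n)) z - series (cf F) z) \<le> V.qa.opnorm ((\<Prod>j<n. 1 - lin (b (j + m))) - F)" for n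
        using V.eval_bound[of z "Q n - F"] zW QW[of n] F(1) Walg.diff_in[OF QW F(1), of n]
          series_diff[OF cv[OF QW] cv[OF F(1)], of n]
        by (simp add: VW Q_def h_def)
      then show "eventually (\<lambda>n. norm (series (cf (Q n)) z - series (cf F) z) \<le>
        V.qa.opnorm ((\<Prod>j<n. 1 - lin (b (j + m))) - F)) sequentially" by simp
    qed
    then have Qlim: "(\<lambda>n. series (cf (Q n)) z) \<longlonglongrightarrow> series (cf F) z" by (simp add: LIM_zero_iff)
    have split: "(\<Prod>j<n + m. series (g j) z) = (\<Prod>j<n + m. a j) * (series (cf H) z * series (cf (Q n)) z)" for n
    proof -
      have "(\<Prod>j<n + m. s j) = (\<Prod>j<m. s j) * (\<Prod>j<n. s (j + m))"
        by (induction n) (auto simp: mult_ac)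
      moreover have "series (cf H) z = (\<Prod>j<m. s j)"
        unfolding H_def s_def using prod_series[of z h "{..<m}", OF cv[OF hW]] by simp
      moreover have "series (cf (Q n)) z = (\<Prod>j<n. s (j + m))"
        unfolding Q_def s_def using prod_series[of z "\<lambda>j. h (j + m)" "{..<n}", OF cv[OF hW]] by simp
      ultimately show ?thesis by (simp add: gs prod.distrib)
    qed
    have "(\<lambda>n. \<Prod>j<n + m. series (g j) z) \<longlonglongrightarrow> cf x 0 * (series (cf H) z * series (cf F) z)"
      unfolding split by (intro tendsto_mult LIMSEQ_ignore_initial_segment[OF alim] tendsto_const Qlim)
    moreover have "(\<lambda>n. \<Prod>j<n + m. series (g j) z) \<longlonglongrightarrow> series (cf x) z"
      by (rule LIMSEQ_ignore_initial_segment[OF lim[OF zD]])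
    ultimately have "series (cf x) z = cf x 0 * (series (cf H) z * series (cf F) z)" by (rule LIMSEQ_unique[rotated])
    also have "\<dots> = series (cf T) z"
      unfolding T_def series_const_mult using conv_at_mult(2)[OF cv[OF HW] cv[OF F(1)]] by simp
    finally show ?thesis by simp
  qed
  have TX: "T \<in> X" by (rule W_subset[OF TW])
  have rconv: "conv_at (\<lambda>j. of_real (r j)) y" if "y \<in> X" for y using r_dom that by (simp add: D_infty_iff)
  have "T - x = 0"
  proof (rule series_unique_zero[OF r_pos])
    have "conv_at (\<lambda>j. of_real (r j)) (T + const (- 1) * x)"
      unfolding conv_at_def
    proof (rule summable_on_comparison_test[OF summable_on_add])
      show "(\<lambda>\<alpha>. cmod (cf T \<alpha> * monomial_at (\<lambda>j. of_real (r j)) \<alpha>)) summable_on UNIV"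
        "(\<lambda>\<alpha>. cmod (cf x \<alpha> * monomial_at (\<lambda>j. of_real (r j)) \<alpha>)) summable_on UNIV"
        using rconv TX x by (simp_all add: conv_at_def)
      show "cmod (cf (T + const (- 1) * x) \<alpha> * monomial_at (\<lambda>j. of_real (r j)) \<alpha>)
        \<le> cmod (cf T \<alpha> * monomial_at (\<lambda>j. of_real (r j)) \<alpha>) + cmod (cf x \<alpha> * monomial_at (\<lambda>j. of_real (r j)) \<alpha>)" for \<alpha>
        using norm_triangle_ineq4[of "cf T \<alpha> * monomial_at (\<lambda>j. of_real (r j)) \<alpha>" "cf x \<alpha> * monomial_at (\<lambda>j. of_real (r j)) \<alpha>"]
        by (simp add: left_diff_distrib)
    qed simp
    moreover have "T + const (- 1) * x = T - x" by (rule mser_eqI) simp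
    ultimately show "conv_at (\<lambda>j. of_real (r j)) (T - x)" by simp
    fix z assume z: "\<And>i. cmod (z i) \<le> r i"
    then have "z \<in> D_infty (cf ` X)" by (rule D_inftyI)
    then show "series (cf (T - x)) z = 0"
      using series_diff[of z T x] TX x eq_on[OF z] by (simp add: D_infty_iff)
  qed
  then have xT: "x = const (cf x 0) * (H * F)" by (simp add: T_def)
  \<comment> \<open>A zero of one factor at a finitely supported point of \<open>Bl\<close> in the
    domain would be a zero of the whole product by \<open>factor_nz\<close>, so the hypothesis of
    \<open>test_series\<close> holds.\<close>
  have appr_h: "appr (h j) 1" for j
  proof -
    have "(\<Sum>k<n. b j k * z k) \<noteq> 1" if z: "z \<in> Bl" "z \<in> D_infty (cf ` X)" "\<And>k. k \<ge> n \<Longrightarrow> z k = 0" for z n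
    proof
      assume one: "(\<Sum>k<n. b j k * z k) = 1"
      have "conv_at z (lin (b j))" "series (cf (lin (b j))) z = 1"
        using series_lin_finite[of n "b j" z] z(3) one by auto
      then have "series (g j) z = 0" unfolding gj series_const_mult by (simp add: series_diff)
      moreover have "series (g j) z \<noteq> 0" using factor_nz[OF lim[OF z(2)] nz[OF z(1)]] .
      ultimately show False by simp
    qed
    from test_series[OF this] obtain c where "\<forall>n. c n \<ge> 0" "\<not> summable c"
      "Ser (\<lambda>\<alpha>. of_real (c (mdeg \<alpha>) * (multinomial \<alpha> * cmod (monomial_at (b j) \<alpha>)))) \<in> X" by blast
    then show ?thesis unfolding h_def by (intro appr_one_minus_lin[OF linW]) auto
  qed
  have apprH: "appr H 1"
    unfolding H_def using appr_prod[of m h] hW W_subset appr_h by blast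
  \<comment> \<open>The multiplier \<open>G / cf x 0\<close> removes the constant and the invertible
    tail, leaving the finite product \<open>H\<close>.\<close>
  have "const (1 / cf x 0) * G * x = (const (1 / cf x 0) * const (cf x 0)) * H * (F * G)"
    by (subst xT) (simp only: mult_ac)
  also have "\<dots> = H" using F(3) x0 by (simp flip: const_mult)
  finally have "appr x H" using F(2) by (intro appr_eq[of "const (1 / cf x 0) * G"]) auto
  then have "appr x 1" using appr_trans[OF _ apprH x] W_subset[OF HW] by blast
  then show ?thesis by (rule appr_imp_cyclic[OF x])
qed

end

section \<open>The critical spaces\<close>

text \<open>Cauchy condensation leads to the harmonic series. The next lemma shows that a power
  \<open>P > 1\<close> on the logarithm alone restores convergence.\<close>

lemma log_series_diverges: "\<not> summable (\<lambda>n. 1 / (real (Suc n) * (log 2 (real (Suc n)) + 1)))"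
proof -
  define f where "f n = 1 / (real n * (log 2 (real n) + 1))" for n
  have "summable f \<longleftrightarrow> summable (\<lambda>k. 2 ^ k * f (2 ^ k))"
  proof (rule condensation_test)
    fix m :: nat assume m: "0 < m"
    have "real m * (log 2 (real m) + 1) \<le> real (Suc m) * (log 2 (real (Suc m)) + 1)"
      using m by (intro mult_mono add_mono) auto
    moreover have "0 < real m * (log 2 (real m) + 1)" using m by (intro mult_pos_pos add_nonneg_pos) auto
    ultimately show "f (Suc m) \<le> f m" unfolding f_def by (intro divide_left_mono) auto
  next
    show "f n \<ge> 0" for n by (cases "n = 0") (auto simp: f_def)
  qed
  also have "(\<lambda>k. 2 ^ k * f (2 ^ k)) = (\<lambda>k. real (Suc k) powr - 1)"
    by (auto simp: f_def log_nat_power powr_minus divide_simps)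
  also have "summable \<dots> \<longleftrightarrow> summable (\<lambda>k. real k powr - 1)" by (rule summable_Suc_iff)
  also have "\<not> \<dots>" by (subst summable_real_powr_iff) simp
  finally have "\<not> summable (\<lambda>n. f (Suc n))" by (simp add: summable_Suc_iff)
  then show ?thesis by (simp add: f_def)
qed

lemma log_series_powr_converges:
  assumes P: "P > 1"
  shows "summable (\<lambda>n. 1 / (real (Suc n) * (log 2 (real (Suc n)) + 1) powr P))"
proof -
  define f where "f n = 1 / (real n * (log 2 (real n) + 1) powr P)" for n
  have "summable f \<longleftrightarrow> summable (\<lambda>k. 2 ^ k * f (2 ^ k))"
  proof (rule condensation_test)
    fix m :: nat assume m: "0 < m"
    have "real m * (log 2 (real m) + 1) powr P \<le> real (Suc m) * (log 2 (real (Suc m)) + 1) powr P"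
      using m P by (intro mult_mono powr_mono2 add_mono) auto
    moreover have "0 < log 2 (real m) + 1" using m by (intro add_nonneg_pos) auto
    then have "0 < real m * (log 2 (real m) + 1) powr P" using m by simp
    ultimately show "f (Suc m) \<le> f m" unfolding f_def by (intro divide_left_mono) auto
  qed (simp add: f_def)
  also have "(\<lambda>k. 2 ^ k * f (2 ^ k)) = (\<lambda>k. (1 / (real k + 1)) powr P)"
    by (auto simp: f_def log_nat_power powr_divide)
  finally have "summable f" using summable_Suc_powr[OF P] by simp
  then have "summable (\<lambda>n. f (Suc n))" by (simp add: summable_Suc_iff)
  then show ?thesis by (simp add: f_def)
qed

lemma finite_support_powr_sum:
  fixes z :: "nat \<Rightarrow> complex"
  assumes "\<And>k. k \<ge> m \<Longrightarrow> z k = 0"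
  shows "(\<lambda>k. cmod (z k) powr q) summable_on UNIV"
    "(\<Sum>\<^sub>\<infinity>k. cmod (z k) powr q) = (\<Sum>k<m. cmod (z k) powr q)"
proof -
  have zero: "cmod (z k) powr q = 0" if "k \<notin> {..<m}" for k using assms[of k] that by simp
  have "((\<lambda>k. cmod (z k) powr q) has_sum (\<Sum>k<m. cmod (z k) powr q)) UNIV"
    by (rule has_sum_finite_neutralI[where B = "{..<m}"]) (use zero in auto)
  then show "(\<lambda>k. cmod (z k) powr q) summable_on UNIV"
    "(\<Sum>\<^sub>\<infinity>k. cmod (z k) powr q) = (\<Sum>k<m. cmod (z k) powr q)"
    by (auto simp: has_sum_imp_summable infsumI)
qed

lemma in_open_ball_finite:
  assumes "q > 0"
  shows "z \<in> lp_open_ball (ennreal q) \<longleftrightarrow>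
    (\<lambda>k. cmod (z k) powr q) summable_on UNIV \<and> (\<Sum>\<^sub>\<infinity>k. cmod (z k) powr q) < 1"
  using assms by (simp add: lp_open_ball_def lp_finite)

lemma critical_module_finite:
  assumes pq: "P > 1" "q > 1" "1 / P + 1 / q = 1" and s: "0 \<le> s" "s \<le> 1 / q"
  shows "\<exists>r. critical_module (weighted_space.X P (weight s (1 / q))) (lp_open_ball (ennreal q)) r"
proof -
  have s1: "s \<le> 1" using s pq by (simp add: order_trans[of s "1/q" 1])
  interpret weighted_space P "weight s (1 / q)" by (rule weighted_space_weight) (use pq in simp)
  obtain r :: "nat \<Rightarrow> real" where r: "\<And>j. r j > 0" "\<And>j. r j \<le> 1"
    "(\<lambda>\<alpha>. cmod (monomial_at (\<lambda>j. of_real (r j)) \<alpha>) / weight s (1 / q) \<alpha>) summable_on UNIV"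
    using small_polydisc[of s "1 / q"] s pq by auto
  have "critical_module X (lp_open_ball (ennreal q)) r"
  proof
    show "1 \<in> X" using const_X[of 1] by simp
    show "x \<in> X" if "y \<in> X" "\<And>\<alpha>. cmod (cf x \<alpha>) \<le> cmod (cf y \<alpha>)" for x y using X_mono(1) that by blast
    show "absm h * absm x \<in> X" if "h \<in> W" "x \<in> X" for h x
    proof (rule module_X)
      show "absm h \<in> weighted_space.X 1 (weight 1 0)" using W_absm[OF that(1)] by (simp add: W_def)
      show "absm x \<in> X" using that(2) by (rule X_mono(1)) simp
    qed (use pq s s1 in auto)
    show "(\<lambda>j. complex_of_real (r j)) \<in> D_infty (cf ` X)"
      unfolding D_infty_iff using conv_at_if_bounded[OF r(3) cf_le_nrm] by auto
    show "(\<lambda>_. 0) \<in> lp_open_ball (ennreal q)" using pq by (simp add: in_open_ball_finite)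
    fix b :: "nat \<Rightarrow> complex"
    assume ne: "\<And>z m. z \<in> lp_open_ball (ennreal q) \<Longrightarrow> z \<in> D_infty (cf ` X) \<Longrightarrow> (\<And>k. k \<ge> m \<Longrightarrow> z k = 0) \<Longrightarrow>
      (\<Sum>k<m. b k * z k) \<noteq> 1"
    have part: "(\<Sum>k<m. cmod (b k) powr P) \<le> 1" for m
    proof (rule ccontr)
      define B where "B = (\<Sum>k<m. cmod (b k) powr P)"
      assume "\<not> ?thesis"
      then have B1: "B > 1" by (simp add: B_def)
      \<comment> \<open>The extremal vector for Hoelder's inequality, scaled to
        \<open>\<Sum> b k * z k = 1\<close>; its \<open>q\<close>-sum is
        \<open>B powr (1 - q)\<close>, below 1. Where \<open>b k = 0\<close> the numerator is 0 as
        well.\<close>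
      define z where "z k = (if k < m then of_real (cmod (b k) powr P / B) / b k else 0)" for k
      have z0: "z k = 0" if "k \<ge> m" for k using that by (simp add: z_def)
      have Pq: "(P - 1) * q = P" using pq by (simp add: field_simps)
      have zq: "cmod (z k) powr q = cmod (b k) powr P / B powr q" if "k < m" for k
      proof (cases "b k = 0")
        case False
        have "cmod (z k) = cmod (b k) powr P / cmod (b k) / B"
          using that B1 by (simp add: z_def norm_divide norm_mult)
        also have "cmod (b k) powr P / cmod (b k) = cmod (b k) powr (P - 1)"
          using False by (simp add: powr_diff)
        finally show ?thesis using B1 Pq by (simp add: powr_divide powr_powr)
      qed (use that in \<open>simp add: z_def\<close>)
      have "(\<Sum>k<m. cmod (z k) powr q) = B / B powr q"
        using zq by (simp add: B_def flip: sum_divide_distrib)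
      also have "\<dots> < 1"
        using B1 pq powr_less_mono[of 1 q B] by (simp add: divide_less_eq_1)
      finally have V: "(\<Sum>\<^sub>\<infinity>k. cmod (z k) powr q) < 1" using finite_support_powr_sum(2)[of m z q] z0 by simp
      have sm: "(\<lambda>k. cmod (z k) powr q) summable_on UNIV" using finite_support_powr_sum(1)[of m z q] z0 by simp
      have ball: "z \<in> lp_open_ball (ennreal q)" using sm V pq by (simp add: in_open_ball_finite)
      have "(\<lambda>\<alpha>. (cmod (monomial_at z \<alpha>) / weight s (1 / q) \<alpha>) powr q) summable_on UNIV"
        using pq s V by (intro critical_weight_summable[OF _ sm refl]) auto
      then have "z \<in> D_infty (cf ` X)" unfolding D_infty_iff using conv_at_Holder[OF pq] by blast
      from ne[OF ball this z0] have "(\<Sum>k<m. b k * z k) \<noteq> 1" by simp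
      moreover have "(\<Sum>k<m. b k * z k) = (\<Sum>k<m. of_real (cmod (b k) powr P / B))"
        by (intro sum.cong refl) (use pq in \<open>auto simp: z_def\<close>)
      moreover have "\<dots> = of_real (B / B)" by (simp only: of_real_sum[symmetric] sum_divide_distrib[symmetric] B_def)
      ultimately show False using B1 by simp
    qed
    note sm = nonneg_partial_sums_le[OF powr_ge_zero part]
    define bP where "bP j = complex_of_real (cmod (b j) powr P)" for j
    have bP: "(\<lambda>k. cmod (bP k)) summable_on UNIV" "(\<Sum>\<^sub>\<infinity>k. cmod (bP k)) \<le> 1"
      using sm by (auto simp: bP_def)
    define L where "L n = log 2 (real (Suc n)) + 1" for n
    have L: "L n > 0" for n unfolding L_def by (intro add_nonneg_pos) auto
    \<comment> \<open>Without the logarithm \<open>c n powr P * (n + 1) powr (s * P)\<close> would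
      be harmonic at the endpoint \<open>s = 1 / q\<close>, where \<open>s * P = P - 1\<close>; the
      logarithm makes it summable while \<open>c\<close> itself still diverges.\<close>
    define c where "c n = 1 / (real (Suc n) * L n)" for n
    have c0: "c n > 0" for n using L by (simp add: c_def)
    have le: "c n powr P * (real n + 1) powr (s * P) \<le> 1 / (real (Suc n) * L n powr P)" for n
    proof -
      have sP: "s * P \<le> P - 1" 
      proof -
        have "s * P \<le> 1 / q * P" using s pq by (intro mult_right_mono) auto
        also have "1 / q = 1 - 1 / P" using pq by simp
        finally show ?thesis using pq by (simp add: left_diff_distrib)
      qed
      have "c n powr P * (real n + 1) powr (s * P) \<le> c n powr P * (real n + 1) powr (P - 1)"
        using sP by (intro mult_left_mono powr_mono) auto
      also have "c n powr P * (real n + 1) powr (P - 1) = 1 / (real (Suc n) * L n powr P)"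
      proof -
        have "c n powr P = 1 / ((real n + 1) powr P * L n powr P)"
          using L[of n] by (simp add: c_def powr_divide powr_mult add.commute)
        then show ?thesis using L[of n] by (simp add: powr_diff add.commute)
      qed
      finally show ?thesis .
    qed
    have "summable (\<lambda>n. (c n powr P * (real n + 1) powr (s * P)) * 1 ^ n)"
    proof (rule summable_comparison_test')
      show "summable (\<lambda>n. 1 / (real (Suc n) * L n powr P))"
        unfolding L_def by (rule log_series_powr_converges[OF pq(1)])
      show "norm (c n powr P * (real n + 1) powr (s * P) * 1 ^ n) \<le> 1 / (real (Suc n) * L n powr P)" for n
        using le[of n] by simp
    qed
    then have "(\<lambda>\<alpha>. (c (mdeg \<alpha>) powr P * (real (mdeg \<alpha>) + 1) powr (s * P)) *
      (multinomial \<alpha> * cmod (monomial_at bP \<alpha>))) summable_on UNIV"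
      by (intro graded_multinomial_summable[OF bP]) auto
    moreover have "(cmod (of_real (c (mdeg \<alpha>) * (multinomial \<alpha> * cmod (monomial_at b \<alpha>)))) * weight s (1 / q) \<alpha>) powr P =
      (c (mdeg \<alpha>) powr P * (real (mdeg \<alpha>) + 1) powr (s * P)) * (multinomial \<alpha> * cmod (monomial_at bP \<alpha>))" for \<alpha>
    proof -
      have "cmod (of_real (c (mdeg \<alpha>) * (multinomial \<alpha> * cmod (monomial_at b \<alpha>)))) * weight s (1 / q) \<alpha> =
        c (mdeg \<alpha>) * (multinomial \<alpha> * cmod (monomial_at b \<alpha>) * weight s (1 / q) \<alpha>)"
        unfolding norm_of_real using c0[of "mdeg \<alpha>"] by (simp add: abs_mult)
      also have "\<dots> powr P = c (mdeg \<alpha>) powr P * (multinomial \<alpha> * cmod (monomial_at b \<alpha>) * weight s (1 / q) \<alpha>) powr P"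
        using c0[of "mdeg \<alpha>"] by (intro powr_mult) 
      also note multinomial_weight[OF pq(1,3), of \<alpha> b s]
      finally show ?thesis by (simp only: bP_def[abs_def] mult.assoc)
    qed
    ultimately have "Ser (\<lambda>\<alpha>. of_real (c (mdeg \<alpha>) * (multinomial \<alpha> * cmod (monomial_at b \<alpha>)))) \<in> X"
      by (intro X_I) (simp only: cf_Ser)
    moreover have "\<not> summable c" unfolding c_def L_def by (rule log_series_diverges)
    ultimately show "\<exists>c. (\<forall>n. c n \<ge> 0) \<and> \<not> summable c \<and>
      Ser (\<lambda>\<alpha>. of_real (c (mdeg \<alpha>) * (multinomial \<alpha> * cmod (monomial_at b \<alpha>)))) \<in> X"
      using c0 less_imp_le by blast
  qed (use r W_mult W_finite in auto)
  then show ?thesis by blast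
qed

section \<open>The critical space for an infinite exponent\<close>

definition X_inf :: "real \<Rightarrow> mser set" where
  "X_inf s = {x. \<exists>B. \<forall>\<alpha>. cmod (cf x \<alpha>) * weight s 1 \<alpha> \<le> B}"

lemma D_space_infinity: "D_space \<infinity> s 1 = cf ` X_inf s"
  by (rule eq_cf_imageI)
    (simp add: D_space_def lp_def X_inf_def bounded_iff norm_mult less_imp_le)

lemma critical_module_infinity:
  assumes s: "0 \<le> s" "s \<le> 1"
  shows "\<exists>r. critical_module (X_inf s) (lp_open_ball 1) r"
proof -
  obtain r :: "nat \<Rightarrow> real" where r: "\<And>j. r j > 0" "\<And>j. r j \<le> 1"
    "(\<lambda>\<alpha>. cmod (monomial_at (\<lambda>j. of_real (r j)) \<alpha>) / weight s 1 \<alpha>) summable_on UNIV"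
    using small_polydisc[of s 1] s by auto
  have conv: "z \<in> D_infty (cf ` X_inf s)"
    if "(\<lambda>\<alpha>. cmod (monomial_at z \<alpha>) / weight s 1 \<alpha>) summable_on UNIV" for z
    unfolding D_infty_iff X_inf_def using conv_at_if_bounded[OF that] by auto
  have "critical_module (X_inf s) (lp_open_ball 1) r"
  proof
    have "cmod (cf 1 \<alpha>) * weight s 1 \<alpha> \<le> 1" for \<alpha> by (simp add: cf_1)
    then show "1 \<in> X_inf s" by (auto simp: X_inf_def)
    show "x \<in> X_inf s" if y: "y \<in> X_inf s" and le: "\<And>\<alpha>. cmod (cf x \<alpha>) \<le> cmod (cf y \<alpha>)" for x y
    proof -
      obtain B where "\<And>\<alpha>. cmod (cf y \<alpha>) * weight s 1 \<alpha> \<le> B" using y by (auto simp: X_inf_def)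
      then have "cmod (cf x \<alpha>) * weight s 1 \<alpha> \<le> B" for \<alpha>
        using mult_right_mono[OF le[of \<alpha>], of "weight s 1 \<alpha>"] order_trans less_imp_le[OF weight_pos] by blast
      then show ?thesis by (auto simp: X_inf_def)
    qed
    show "absm h * absm x \<in> X_inf s" if h: "h \<in> W" and x: "x \<in> X_inf s" for h x
    proof -
      obtain B where B: "\<And>\<alpha>. cmod (cf x \<alpha>) * weight s 1 \<alpha> \<le> B" using x by (auto simp: X_inf_def)
      have B0: "B \<ge> 0" using order_trans[OF _ B[of 0]] by simp
      define H where "H \<alpha> = cmod (cf h \<alpha>) * (real (mdeg \<alpha>) + 1)" for \<alpha>
      have H: "H summable_on UNIV" using h by (simp add: W_iff H_def[abs_def])
      have H0: "H \<alpha> \<ge> 0" for \<alpha> by (simp add: H_def)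
      have "cmod (cf (absm h * absm x) \<gamma>) * weight s 1 \<gamma> \<le> infsum H UNIV * B" for \<gamma>
      proof -
        have "cmod (cf (absm h * absm x) \<gamma>) = (\<Sum>i\<in>antidiag \<gamma>. cmod (cf h (fst i)) * cmod (cf x (snd i)))"
          unfolding cf_absm_mult norm_of_real by (simp add: split_beta sum_nonneg)
        then have "cmod (cf (absm h * absm x) \<gamma>) * weight s 1 \<gamma> =
          (\<Sum>i\<in>antidiag \<gamma>. cmod (cf h (fst i)) * cmod (cf x (snd i)) * weight s 1 \<gamma>)"
          by (simp add: sum_distrib_right)
        also have "\<dots> \<le> (\<Sum>i\<in>antidiag \<gamma>. H (fst i) * B)"
        proof (rule sum_mono)
          fix i assume "i \<in> antidiag \<gamma>"
          then obtain \<alpha> \<beta> where i: "i = (\<alpha>, \<beta>)" "\<gamma> = \<alpha> + \<beta>" by (cases i) auto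
          have "cmod (cf h \<alpha>) * cmod (cf x \<beta>) * weight s 1 \<gamma> \<le>
            cmod (cf h \<alpha>) * cmod (cf x \<beta>) * ((real (mdeg \<alpha>) + 1) * weight s 1 \<beta>)"
            unfolding i using s by (intro mult_left_mono weight_shift) auto
          also have "\<dots> = H \<alpha> * (cmod (cf x \<beta>) * weight s 1 \<beta>)" by (simp add: H_def)
          also have "\<dots> \<le> H \<alpha> * B" using H0 B by (intro mult_left_mono)
          finally show "cmod (cf h (fst i)) * cmod (cf x (snd i)) * weight s 1 \<gamma> \<le> H (fst i) * B" by (simp add: i)
        qed
        also have "\<dots> = sum H (fst ` antidiag \<gamma>) * B"
          by (subst sum.reindex) (auto simp: inj_on_def sum_distrib_right)
        also have "\<dots> \<le> infsum H UNIV * B"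
          using B0 H0 by (intro mult_right_mono finite_sum_le_infsum[OF H]) auto
        finally show ?thesis .
      qed
      then show ?thesis by (auto simp: X_inf_def)
    qed
    show "(\<lambda>j. complex_of_real (r j)) \<in> D_infty (cf ` X_inf s)" by (rule conv[OF r(3)])
    show "(\<lambda>_. 0) \<in> lp_open_ball 1" using in_open_ball_finite[of 1 "\<lambda>_. 0"] by simp
    fix b :: "nat \<Rightarrow> complex"
    assume ne: "\<And>z m. z \<in> lp_open_ball 1 \<Longrightarrow> z \<in> D_infty (cf ` X_inf s) \<Longrightarrow> (\<And>k. k \<ge> m \<Longrightarrow> z k = 0) \<Longrightarrow>
      (\<Sum>k<m. b k * z k) \<noteq> 1"
    have b1: "cmod (b k) \<le> 1" for k
    proof (rule ccontr)
      assume "\<not> ?thesis"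
      then have bk: "cmod (b k) > 1" by simp
      \<comment> \<open>A single coordinate suffices: a coefficient of modulus above 1 has its zero
        of \<open>1 - b k * z k\<close> inside the open l1-ball.\<close>
      define z where "z j = (if j = k then 1 / b k else 0)" for j
      have z0: "z j = 0" if "j \<ge> Suc k" for j using that by (simp add: z_def)
      have fs: "(\<lambda>j. cmod (z j) powr 1) summable_on UNIV"
        "(\<Sum>\<^sub>\<infinity>j. cmod (z j) powr 1) = (\<Sum>j<Suc k. cmod (z j) powr 1)"
        by (rule finite_support_powr_sum, rule z0, assumption)+
      have V: "(\<Sum>\<^sub>\<infinity>j. cmod (z j) powr 1) < 1" 
      proof -
        have "1 / cmod (b k) < 1" using bk by (subst divide_less_eq) auto
        then show ?thesis unfolding fs(2) by (simp add: z_def norm_divide)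
      qed
      have ball: "z \<in> lp_open_ball 1" using in_open_ball_finite[of 1 z] fs(1) V by simp
      have "(\<lambda>\<alpha>. (cmod (monomial_at z \<alpha>) / weight s (1 / 1) \<alpha>) powr 1) summable_on UNIV"
        using s V by (intro critical_weight_summable[OF _ fs(1) refl]) auto
      then have "(\<lambda>\<alpha>. cmod (monomial_at z \<alpha>) / weight s 1 \<alpha>) summable_on UNIV"
        by (simp add: less_imp_le)
      then have "z \<in> D_infty (cf ` X_inf s)" by (rule conv)
      then have "(\<Sum>j<Suc k. b j * z j) \<noteq> 1" by (rule ne[OF ball]) (rule z0)
      moreover have "(\<Sum>j<Suc k. b j * z j) = b k * z k" by (simp add: z_def)
      ultimately show False using bk by (cases "b k = 0") (auto simp: z_def)
    qed
    \<comment> \<open>Here only boundedness of \<open>c n * (n + 1) powr s\<close> is required, and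
      \<open>s \<le> 1\<close> makes the harmonic sequence sufficient.\<close>
    define c where "c n = 1 / (real n + 1)" for n :: nat
    have "cmod (of_real (c (mdeg \<alpha>) * (multinomial \<alpha> * cmod (monomial_at b \<alpha>)))) * weight s 1 \<alpha> \<le> 1" for \<alpha>
    proof -
      have "cmod (of_real (c (mdeg \<alpha>) * (multinomial \<alpha> * cmod (monomial_at b \<alpha>)))) * weight s 1 \<alpha> =
        c (mdeg \<alpha>) * cmod (monomial_at b \<alpha>) * (real (mdeg \<alpha>) + 1) powr s"
        unfolding norm_of_real by (simp add: weight_eq powr_minus abs_mult c_def)
      also have "\<dots> \<le> c (mdeg \<alpha>) * 1 * (real (mdeg \<alpha>) + 1) powr 1"
      proof (intro mult_mono)
        show "cmod (monomial_at b \<alpha>) \<le> 1"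
          using monomial_at_mono[of b "\<lambda>_. 1" \<alpha>] b1 by (simp add: monomial_at_def)
        show "(real (mdeg \<alpha>) + 1) powr s \<le> (real (mdeg \<alpha>) + 1) powr 1" using s by (intro powr_mono) auto
      qed (auto simp: c_def)
      also have "\<dots> = 1" by (simp add: c_def)
      finally show ?thesis .
    qed
    then have "Ser (\<lambda>\<alpha>. of_real (c (mdeg \<alpha>) * (multinomial \<alpha> * cmod (monomial_at b \<alpha>)))) \<in> X_inf s"
      unfolding X_inf_def mem_Collect_eq cf_Ser by blast
    moreover have "\<not> summable c"
    proof -
      have "\<not> summable (\<lambda>k. real k powr - 1)" by (subst summable_real_powr_iff) simp
      then have "\<not> summable (\<lambda>k. real (Suc k) powr - 1)" by (subst summable_Suc_iff)
      then show ?thesis by (simp add: c_def[abs_def] powr_minus inverse_eq_divide add.commute)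
    qed
    moreover have "\<forall>n. c n \<ge> 0" by (simp add: c_def)
    ultimately show "\<exists>c. (\<forall>n. c n \<ge> 0) \<and> \<not> summable c \<and>
      Ser (\<lambda>\<alpha>. of_real (c (mdeg \<alpha>) * (multinomial \<alpha> * cmod (monomial_at b \<alpha>)))) \<in> X_inf s" by blast
  qed (use r W_mult W_finite in auto)
  then show ?thesis by blast
qed

lemma function_algebra_D_space:
  assumes P: "1 \<le> P" and alg: "weighted_algebra P (weight s t) K" and st: "s \<ge> 0" "t \<ge> 0"
  shows "function_algebra_on_max_ideal_space (D_space (ennreal P) s t) (D_norm (ennreal P) s t)"
    "x \<in> D_space (ennreal P) s t \<Longrightarrow> cyclic (D_space (ennreal P) s t) x \<longleftrightarrow>
      (\<forall>z\<in>D_infty (D_space (ennreal P) s t). series x z \<noteq> 0)"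
proof -
  obtain r where "series_algebra P (weight s t) K r" using series_algebra_weight[OF alg st] by blast
  then interpret series_algebra P "weight s t" K r .
  note eq = D_space_eq[OF P, of s t]
  show "function_algebra_on_max_ideal_space (D_space (ennreal P) s t) (D_norm (ennreal P) s t)"
    unfolding eq by (rule function_algebra) (rule D_norm_eq[OF P])
  show "x \<in> D_space (ennreal P) s t \<Longrightarrow> cyclic (D_space (ennreal P) s t) x \<longleftrightarrow>
      (\<forall>z\<in>D_infty (D_space (ennreal P) s t). series x z \<noteq> 0)"
    unfolding eq using cyclic_iff_nonzero by auto
qed

text \<open>In \<open>ennreal\<close>, \<open>1 / \<infinity> = 0\<close> and
  \<open>1 / 0 = \<infinity>\<close>; the latter excludes \<open>p' = 0\<close>. In the finite case
  both reciprocals are positive, so both exponents exceed 1.\<close>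

lemma conjugate_exponents:
  fixes p p' :: ennreal
  assumes "1 \<le> p" "1 / p + 1 / p' = 1"
  obtains (one) "p = 1" "p' = \<infinity>"
    | (infinity) "p = \<infinity>" "p' = 1"
    | (finite) P q where "p = ennreal P" "p' = ennreal q" "P > 1" "q > 1" "1 / P + 1 / q = 1"
proof (cases p)
  case top
  then have p': "1 / p' = 1" using assms(2) by simp
  have "p' = 1"
  proof (cases p')
    case (real q)
    then have "q \<noteq> 0" using p' by (auto simp: ennreal_divide_zero)
    then have "ennreal (1 / q) = ennreal 1" using real p' divide_ennreal[of 1 q] by simp
    then have "1 / q = 1" using real by (subst (asm) ennreal_inj) auto
    then show ?thesis using real by simp
  qed (use p' in auto)
  then show thesis using infinity top by simp
next
  case (real P)
  have P: "P \<ge> 1" using assms(1) real by simp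
  have p1: "1 / p = ennreal (1 / P)" using real P divide_ennreal[of 1 P] by simp
  show thesis
  proof (cases p')
    case top
    then have "ennreal (1 / P) = ennreal 1" using assms(2) p1 by simp
    then have "P = 1" using P by (subst (asm) ennreal_inj) auto
    then show thesis using one real top by simp
  next
    case (real q)
    have "q \<noteq> 0"
    proof
      assume "q = 0"
      then have "1 / p' = \<infinity>" using real by (simp add: ennreal_divide_zero)
      then show False using assms(2) by simp
    qed
    then have q: "q > 0" using real by simp
    have q1: "1 / p' = ennreal (1 / q)" using real q divide_ennreal[of 1 q] by simp
    have "ennreal (1 / P + 1 / q) = ennreal 1"
      using assms(2) p1 q1 P q by (simp add: ennreal_plus)
    then have eq: "1 / P + 1 / q = 1" using P q by (subst (asm) ennreal_inj) auto
    have "1 / P < 1" "1 / q < 1" using eq P q zero_less_divide_1_iff[of q] zero_less_divide_1_iff[of P] by linarith+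
    then have "P > 1" "q > 1" using P q by (auto simp: field_simps)
    then show thesis using finite[of P q] eq \<open>p = ennreal P\<close> real by simp
  qed
qed

theorem proposition8p5:
  fixes p p' :: ennreal
  assumes "1 \<le> p" and "1 / p + 1 / p' = 1"
  shows
    "(\<forall>s x. let X = D_space p s (enn2real (1 / p')) in
        0 \<le> s \<and> s \<le> enn2real (1 / p') \<and>
        x \<in> X \<and> x \<in> lp 1 \<and> factorable X x \<and>
        (\<forall>z\<in>lp_open_ball p'. series x z \<noteq> 0) \<and>
        (p = 1 \<longrightarrow> (\<forall>z\<in>lp_closed_ball p'. series x z \<noteq> 0))
        \<longrightarrow> cyclic X x)
     \<and>
     (\<forall>s t. let X = D_space p s t in
        (1 < p \<and> p < \<infinity> \<and> s > enn2real (1 / p') \<and> t \<ge> enn2real (1 / p')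
         \<or> p = 1 \<and> s \<ge> 0 \<and> t \<ge> 0)
        \<longrightarrow> function_algebra_on_max_ideal_space X (D_norm p s t) \<and>
            (t = enn2real (1 / p') \<longrightarrow> D_infty X = lp_closed_ball p') \<and>
            (\<forall>x\<in>X. cyclic X x \<longleftrightarrow> (\<forall>z\<in>D_infty X. series x z \<noteq> 0)))"
  using assms
proof (cases rule: conjugate_exponents)
  case one
  have t0: "enn2real (1 / p') = 0" using one by simp
  note fa = function_algebra_D_space[OF order_refl weighted_algebra_weight_1, unfolded ennreal_1]
  have dom: "D_infty (D_space 1 s 0) = lp_closed_ball p'" if "s \<ge> 0" for s
    using D_infty_eq_closed_polydisc[OF that] D_space_eq[of 1 s 0] one(2) by simp
  \<comment> \<open>For \<open>p = 1\<close> the bound \<open>s \<le> 1/p' = 0\<close> leaves only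
    \<open>s = 0\<close>, and the domain is the closed polydisc, so the nonvanishing criterion
    applies directly.\<close>
  have "cyclic (D_space 1 0 0) x" if "x \<in> D_space 1 0 0" "\<forall>z\<in>lp_closed_ball p'. series x z \<noteq> 0" for x
    using fa(2)[of 0 0 x] that dom[of 0] by simp
  moreover have "function_algebra_on_max_ideal_space (D_space 1 s t) (D_norm 1 s t) \<and>
      (\<forall>x\<in>D_space 1 s t. cyclic (D_space 1 s t) x \<longleftrightarrow> (\<forall>z\<in>D_infty (D_space 1 s t). series x z \<noteq> 0))"
    if "s \<ge> 0" "t \<ge> 0" for s t using fa that by blast
  ultimately show ?thesis unfolding one(1) t0 Let_def using dom by auto
next
  case infinity
  have t1: "enn2real (1 / p') = 1" using infinity by simp
  have "cyclic (D_space \<infinity> s 1) x" if s: "0 \<le> s" "s \<le> 1" and x: "x \<in> D_space \<infinity> s 1"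
    "factorable (D_space \<infinity> s 1) x" "\<forall>z\<in>lp_open_ball 1. series x z \<noteq> 0" for s x
  proof -
    obtain r where "critical_module (X_inf s) (lp_open_ball 1) r" using critical_module_infinity[OF s] by blast
    then interpret critical_module "X_inf s" "lp_open_ball 1" r .
    obtain y where "x = cf y" "y \<in> X_inf s" using x(1) unfolding D_space_infinity by blast
    then show ?thesis using factorable_cyclic[of y] x(2,3) unfolding D_space_infinity by blast
  qed
  then show ?thesis unfolding infinity t1 Let_def by auto
next
  case (finite P q)
  have pq: "P > 1" "q > 1" "1 / P + 1 / q = 1" by (fact finite)+
  have P1: "1 \<le> P" using pq by simp
  have tq: "enn2real (1 / p') = 1 / q" using finite divide_ennreal[of 1 q] by simp
  have p1: "p \<noteq> 1" using finite by (metis ennreal_1 ennreal_inj less_eq_real_def less_irrefl not_less zero_le_one order.trans)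
  have cyc: "cyclic (D_space p s (1 / q)) x" if s: "0 \<le> s" "s \<le> 1 / q" and x: "x \<in> D_space p s (1 / q)"
    "factorable (D_space p s (1 / q)) x" "\<forall>z\<in>lp_open_ball p'. series x z \<noteq> 0" for s x
  proof -
    note eq = D_space_eq[OF P1, of s "1 / q", folded finite(1)]
    obtain r where "critical_module (weighted_space.X P (weight s (1 / q))) (lp_open_ball p') r"
      using critical_module_finite[OF pq s] unfolding finite(2) by blast
    then interpret critical_module "weighted_space.X P (weight s (1 / q))" "lp_open_ball p'" r .
    obtain y where "x = cf y" "y \<in> weighted_space.X P (weight s (1 / q))" using x(1) unfolding eq by blast
    then show ?thesis using factorable_cyclic[of y] x(2,3) unfolding eq by blast
  qed
  have alg: "function_algebra_on_max_ideal_space (D_space p s t) (D_norm p s t) \<and>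
      (t = 1 / q \<longrightarrow> D_infty (D_space p s t) = lp_closed_ball p') \<and>
      (\<forall>x\<in>D_space p s t. cyclic (D_space p s t) x \<longleftrightarrow> (\<forall>z\<in>D_infty (D_space p s t). series x z \<noteq> 0))"
    if st: "s > 1 / q" "t \<ge> 1 / q" for s t
  proof -
    obtain K where K: "weighted_algebra P (weight s t) K" using weighted_algebra_weight[OF pq st] by blast
    have "1 / q > 0" using pq by simp
    then have st0: "s \<ge> 0" "t \<ge> 0" using st by linarith+
    note fa = function_algebra_D_space[OF P1 K st0, folded finite(1)]
    moreover have "D_infty (D_space p s t) = lp_closed_ball p'" if "t = 1 / q"
      using D_infty_eq_closed_ball[of P s q K] K pq st(1) that D_space_eq[OF P1, of s t] finite(1,2) by simp
    ultimately show ?thesis by blast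
  qed
  show ?thesis unfolding tq Let_def
  proof (rule conjI; intro allI impI)
    fix s x
    assume "0 \<le> s \<and> s \<le> 1 / q \<and> x \<in> D_space p s (1 / q) \<and> x \<in> lp 1 \<and>
      factorable (D_space p s (1 / q)) x \<and> (\<forall>z\<in>lp_open_ball p'. series x z \<noteq> 0) \<and>
      (p = 1 \<longrightarrow> (\<forall>z\<in>lp_closed_ball p'. series x z \<noteq> 0))"
    then show "cyclic (D_space p s (1 / q)) x" using cyc by blast
  next
    fix s t
    assume "1 < p \<and> p < \<infinity> \<and> 1 / q < s \<and> 1 / q \<le> t \<or> p = 1 \<and> 0 \<le> s \<and> 0 \<le> t"
    then have "s > 1 / q" "t \<ge> 1 / q" using p1 by auto
    then show "function_algebra_on_max_ideal_space (D_space p s t) (D_norm p s t) \<and>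
      (t = 1 / q \<longrightarrow> D_infty (D_space p s t) = lp_closed_ball p') \<and>
      (\<forall>x\<in>D_space p s t. cyclic (D_space p s t) x \<longleftrightarrow> (\<forall>z\<in>D_infty (D_space p s t). series x z \<noteq> 0))"
      by (rule alg)
  qed
qed

end
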